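(* Assume the hypotheses [Convexity], [Dynamics], [Running cost], [Terminal cost] and [Inner ball] stated in the context, that $g$ is locally semiconcave and that the value function $V$ is continuous. If $N^P_{\mathrm{hypo}(V)}(x,V(x))$ is pointed, i.e. $$N^P_{\mathrm{hypo}(V)}(x,V(x))\cap \left(-N^P_{\mathrm{hypo}(V)}(x,V(x))\right)=\{0\},$$ for every $x\in\mathcal R\setminus\mathcal S$, then $\mathrm{hypo}(V)$ is $\varphi$-convex: there is a continuous function $\varphi:\mathcal R\setminus\mathcal S\to(0,\infty)$ such that for every $x\in\mathcal R\setminus\mathcal S$ every unit vector $v\in N^P_{\mathrm{hypo}(V)}(x,V(x))$ is realized by a ball of radius $\varphi(x)$.
   Context: Setting. $U\subset\mathbb{R}^m$ is nonempty and compact, $\mathcal S\subseteq\mathbb{R}^d$ is nonempty and closed (the target), $\mathcal S^c=\mathbb{R}^d\setminus\mathcal S$, and $f:\mathbb{R}^d\times U\to\mathbb{R}^d$, $r:\mathbb{R}^d\times U\to\mathbb{R}$, $g:\mathbb{R}^d\to\mathbb{R}$ are given. For $x\in\mathbb{R}^d$ and a measurable control $u:[0,\infty)\to U$, $y^{x,u}$ is the Carath\'eodory solution of $y'(s)=f(y(s),u(s))$, $y(0)=x$, and $\tau^{x,u}=\min\{t\ge 0:y^{x,u}(t)\in\mathcal S\}$ ($+\infty$ if $\mathcal S$ is never reached). The value function is $V(x)=\inf_u\big(\int_0^{\tau^{x,u}}r(y^{x,u}(s),u(s))\,ds+g(y^{x,u}(\tau^{x,u}))\big)$, the infimum being over measurable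 controls with $\tau^{x,u}<\infty$ ($V(x)=+\infty$ if there are none). $\mathcal R=\{x:\tau^{x,u}<\infty\text{ for some }u\}$. "$V$ is continuous" means continuous on $\mathcal R$. Hypotheses (with constants $N,L,r_0,\rho_0>0$). [Convexity] For every $x$ the set $\{(v,\lambda)\in\mathbb{R}^d\times\mathbb{R}:\exists\omega\in U,\ v=f(x,\omega),\ \lambda\ge r(x,\omega)\}$ is convex. [Dynamics] $f$ is continuous, $|f|<N$; $D_xf$ exists everywhere and is continuous in $(x,u)$; $|f(y,\omega)-f(x,\omega)|\le L|y-x|$ and $|D_xf(y,\omega)-D_xf(x,\omega)|\le L|y-x|$ for all $x,y\in\mathbb{R}^d$, $\omega\in U$. [Running cost] $r$ is continuous and differentiable in $x$, $D_xr$ is continuous, $|r(y,\omega)-r(x,\omega)|+|D_xr(y,\omega)-D_xr(x,\omega)|\le L|y-x|$ for all $x,y,\omega$, and $r(x,\omega)\ge r_0$ for all $x,\omega$. [Terminal cost] There are a neighborhood $\mathcal N$ of $\partial\mathcal S$ and $0\le G<r_0/N$ with $|g(y)-g(x)|\le G|y-x|$ for $x,y\in\mathcal N$. [Inner ball] For every $x\in\partial\mathcal S$ there is a unit $\xi_x\in N^P_{\overline{\mathcal S^c}}(x)$ with $\xi_x\cdot(y-x)\le\frac1{2\rho_0}|y-x|^2$ for all $y\in\overline{\mathcal S^c}$. Nonsmooth notions. For a set $Q$ and $x\in Q$, $v\in N^P_Q(x)$ (proximal normal) iff there is $\sigma\ge0$ with $v\cdot(y-x)\le\sigma|y-x|^2$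 for all $y\in Q$; it is realized by a ball of radius $\rho$ if this holds with $\sigma=|v|/(2\rho)$. $\mathrm{hypo}(V)=\{(z,\beta)\in\overline{\mathcal S^c}\times\mathbb{R}:\beta\le V(z)\}$. $g$ is locally semiconcave if every point has a ball $B$ and $c>0$ with $(1-\lambda)g(x_0)+\lambda g(x_1)-g((1-\lambda)x_0+\lambda x_1)\le c\lambda(1-\lambda)|x_0-x_1|^2$ for $x_0,x_1\in B$, $\lambda\in[0,1]$. *)

theory Defs
  imports "HOL-Analysis.Analysis"
begin

section \<open>Controlled trajectories\<close>

definition abs_continuous_on :: "real \<Rightarrow> real \<Rightarrow> (real \<Rightarrow> 'a::real_normed_vector) \<Rightarrow> bool" where
  "abs_continuous_on a b y \<longleftrightarrow>
     (\<forall>\<epsilon>>0. \<exists>\<delta>>0. \<forall>D. finite D \<longrightarrow>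
        (\<forall>(s, t)\<in>D. a \<le> s \<and> s \<le> t \<and> t \<le> b) \<longrightarrow>
        pairwise (\<lambda>p q. {fst p<..<snd p} \<inter> {fst q<..<snd q} = {}) D \<longrightarrow>
        (\<Sum>(s, t)\<in>D. t - s) < \<delta> \<longrightarrow>
        (\<Sum>(s, t)\<in>D. norm (y t - y s)) < \<epsilon>)"

text \<open>Controls and trajectories are total functions on the reals of which only the values at
  nonnegative times matter. Measurability of a control is Lebesgue measurability.\<close>

definition admissible_control :: "'u::euclidean_space set \<Rightarrow> (real \<Rightarrow> 'u) \<Rightarrow> bool" where
  "admissible_control U u \<longleftrightarrow> u \<in> borel_measurable (lebesgue_on {0..}) \<and> (\<forall>t\<ge>0. u t \<in> U)"

definition caratheodory_solution ::
    "('a::euclidean_space \<Rightarrow> 'u \<Rightarrow> 'a) \<Rightarrow> 'a \<Rightarrow> (real \<Rightarrow> 'u) \<Rightarrow> (real \<Rightarrow> 'a) \<Rightarrow> bool" where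
  "caratheodory_solution f x u y \<longleftrightarrow>
     y 0 = x \<and> (\<forall>T>0. abs_continuous_on 0 T y) \<and>
     (AE s in lebesgue_on {0..}. (y has_vector_derivative f (y s) (u s)) (at s within {0..}))"

text \<open>For admissible controls and bounded continuous dynamics that are Lipschitz in the state,
  the Caratheodory solution exists and its values at nonnegative times are unique, so the choice
  below only fixes irrelevant values at negative times.\<close>

definition trajectory ::
    "('a::euclidean_space \<Rightarrow> 'u \<Rightarrow> 'a) \<Rightarrow> 'a \<Rightarrow> (real \<Rightarrow> 'u) \<Rightarrow> real \<Rightarrow> 'a" where
  "trajectory f x u = (SOME y. caratheodory_solution f x u y)"

definition hitting_time ::
    "('a::euclidean_space \<Rightarrow> 'u \<Rightarrow> 'a) \<Rightarrow> 'a set \<Rightarrow> 'a \<Rightarrow> (real \<Rightarrow> 'u) \<Rightarrow> ereal" where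
  "hitting_time f S x u =
     (if \<exists>t\<ge>0. trajectory f x u t \<in> S
      then ereal (LEAST t. 0 \<le> t \<and> trajectory f x u t \<in> S) else \<infinity>)"

definition reachable_set ::
    "('a::euclidean_space \<Rightarrow> 'u::euclidean_space \<Rightarrow> 'a) \<Rightarrow> 'u set \<Rightarrow> 'a set \<Rightarrow> 'a set" where
  "reachable_set f U S = {x. \<exists>u. admissible_control U u \<and> hitting_time f S x u < \<infinity>}"

definition exit_cost ::
    "('a::euclidean_space \<Rightarrow> 'u \<Rightarrow> 'a) \<Rightarrow> ('a \<Rightarrow> 'u \<Rightarrow> real) \<Rightarrow> ('a \<Rightarrow> real) \<Rightarrow> 'a set
      \<Rightarrow> 'a \<Rightarrow> (real \<Rightarrow> 'u) \<Rightarrow> real" where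
  "exit_cost f r g S x u =
     (let T = real_of_ereal (hitting_time f S x u); y = trajectory f x u
      in (LINT s:{0..T}|lebesgue. r (y s) (u s)) + g (y T))"

definition value_function ::
    "('a::euclidean_space \<Rightarrow> 'u::euclidean_space \<Rightarrow> 'a) \<Rightarrow> ('a \<Rightarrow> 'u \<Rightarrow> real) \<Rightarrow> ('a \<Rightarrow> real)
      \<Rightarrow> 'u set \<Rightarrow> 'a set \<Rightarrow> 'a \<Rightarrow> ereal" where
  "value_function f r g U S x =
     (INF u\<in>{u. admissible_control U u \<and> hitting_time f S x u < \<infinity>}.
        ereal (exit_cost f r g S x u))"

section \<open>Nonsmooth analysis\<close>

text \<open>The two notions below are meant for base points of the set.\<close>

definition proximal_normals :: "'a::euclidean_space set \<Rightarrow> 'a \<Rightarrow> 'a set" where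
  "proximal_normals Q x =
     {v. \<exists>\<sigma>\<ge>0. \<forall>y\<in>Q. v \<bullet> (y - x) \<le> \<sigma> * (norm (y - x))\<^sup>2}"

definition realized_by_ball :: "'a::euclidean_space set \<Rightarrow> 'a \<Rightarrow> 'a \<Rightarrow> real \<Rightarrow> bool" where
  "realized_by_ball Q x v \<rho> \<longleftrightarrow>
     (\<forall>y\<in>Q. v \<bullet> (y - x) \<le> norm v / (2 * \<rho>) * (norm (y - x))\<^sup>2)"

definition pointed_cone :: "'a::euclidean_space set \<Rightarrow> bool" where
  "pointed_cone C \<longleftrightarrow> C \<inter> uminus ` C = {0}"

text \<open>The hypograph of an extended-real-valued function over the closure of the complement of
  the target; over points where the function is infinite it contains the whole vertical line.\<close>

definition hypo :: "'a::euclidean_space set \<Rightarrow> ('a \<Rightarrow> ereal) \<Rightarrow> ('a \<times> real) set" where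
  "hypo S V = {(z, \<beta>). z \<in> closure (- S) \<and> ereal \<beta> \<le> V z}"

definition phi_convex_hypo :: "'a::euclidean_space set \<Rightarrow> 'a set \<Rightarrow> ('a \<Rightarrow> ereal) \<Rightarrow> bool" where
  "phi_convex_hypo D S V \<longleftrightarrow>
     (\<exists>\<phi>. continuous_on D \<phi> \<and> (\<forall>x\<in>D. \<phi> x > 0) \<and>
        (\<forall>x\<in>D. \<forall>v \<in> proximal_normals (hypo S V) (x, real_of_ereal (V x)).
           norm v = 1 \<longrightarrow> realized_by_ball (hypo S V) (x, real_of_ereal (V x)) v (\<phi> x)))"

definition locally_semiconcave :: "('a::euclidean_space \<Rightarrow> real) \<Rightarrow> bool" where
  "locally_semiconcave g \<longleftrightarrow>
     (\<forall>x. \<exists>e>0. \<exists>c>0. \<forall>x0\<in>ball x e. \<forall>x1\<in>ball x e. \<forall>l\<in>{0..1}.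
        (1 - l) * g x0 + l * g x1 - g ((1 - l) *\<^sub>R x0 + l *\<^sub>R x1)
          \<le> c * l * (1 - l) * (norm (x0 - x1))\<^sup>2)"

end

theory Submission
  imports Defs
begin

text \<open>
  At a point \<open>x\<close> outside the target, a control reaching the target at cost \<open>J\<close> yields a ball that
  touches \<open>hypo V\<close> from outside at \<open>(x, J)\<close>. At the end point \<open>x1\<close> of the trajectory, with \<open>\<xi>\<close> the
  inner normal of the target and \<open>p\<close> a supergradient of \<open>g\<close>, put \<open>q = \<theta> \<xi> - (1 - \<theta>) p\<close>, where \<open>\<theta>\<close> is chosen
  so that \<open>max\<^sub>\<omega> (q \<bullet> f(x1, \<omega>) - (1 - \<theta>) r(x1, \<omega>)) = 0\<close>; the adjoint equation transports \<open>(q, 1 - \<theta>)\<close>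
  back to a normal at \<open>(x, J)\<close>. If \<open>(z, \<beta>)\<close> lies in the ball, the same control, stopped earlier or
  prolonged by a maximizer, leads from \<open>z\<close> into the target at cost less than \<open>\<beta>\<close>. The radius is
  locally uniform, so by a limit argument with nearly optimal controls every frontier point of the
  closure \<open>H\<close> of \<open>hypo V\<close> near a point of the graph has an exterior sphere of fixed radius.

  Pointedness provides a direction \<open>w\<close> with \<open>w \<bullet> k < 0\<close> for all sphere normals \<open>k\<close>. At a frontier
  point \<open>p\<close> the sphere excludes the points \<open>p - s w\<close> from \<open>H\<close>, so a segment in the direction \<open>w\<close> cannot
  leave \<open>H\<close>, and every proximal normal \<open>v\<close> satisfies \<open>v \<bullet> w \<le> 0\<close>. Applying this to \<open>(y - p) + t w\<close>
  with the smallest admissible \<open>t\<close>, which is of order \<open>|y - p|\<^sup>2\<close>, bounds \<open>v \<bullet> (y - p)\<close> uniformly.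
\<close>

section \<open>Indefinite integrals and absolutely continuous functions\<close>

hide_const (open) Polynomial.content

text \<open>\<open>V\<close> may fail to be Lipschitz, since trajectories may graze the target; the
  weight \<open>1 - \<theta>\<close> may then vanish and the normal be horizontal. The zero maximum
  in the choice of \<open>\<theta>\<close> absorbs the unknown hitting time of a perturbed start: if
  \<open>D\<close> is the size of the perturbation, shifting the stopping time by an amount of order
  \<open>D\<close> lowers the weighted sum of depth and cost margin by at most order
  \<open>D\<^sup>2\<close>. Such a \<open>\<theta>\<close> exists because a trajectory that arrives
  from outside admits a velocity with \<open>\<xi> \<bullet> f >= 0\<close>, while
  \<open>G * N < r0\<close> makes \<open>r + p \<bullet> f\<close> positive. A sphere needs a unit
  normal, so \<open>(q, 1 - \<theta>)\<close> must not become small along the adjoint equation;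
  Gronwall's inequality bounds it away from zero, uniformly for bounded hitting times, and these are
  bounded because the total cost grows at least at the rate \<open>r0 - G * N\<close>.\<close>

lemma negligible_bad_points_integral:
  fixes h :: "real \<Rightarrow> 'a::euclidean_space"
  assumes h: "h integrable_on {a..b}" and "\<eta> > 0"
  shows "negligible {x. \<forall>d>0. \<exists>p q. a \<le> p \<and> q \<le> b \<and> p < q \<and> x \<in> {p..q} \<and> q - p < d \<and>
            \<eta> * (q - p) \<le> norm ((q - p) *\<^sub>R h x - integral {p..q} h)}" (is "negligible ?E")
  unfolding negligible_outer_le
proof (intro allI impI)
  fix e :: real assume "e > 0"
  obtain \<gamma> where \<gamma>: "gauge \<gamma>"
    and hen: "\<And>p. \<lbrakk>p tagged_partial_division_of {a..b}; \<gamma> fine p\<rbrakk> \<Longrightarrow>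
             (\<Sum>(x,k)\<in>p. norm (content k *\<^sub>R h x - integral k h)) < e * \<eta>"
    using Henstock_lemma[of h a b "e * \<eta>", OF _ mult_pos_pos[OF \<open>e > 0\<close> \<open>\<eta> > 0\<close>]] h
    unfolding box_real by blast
  \<comment> \<open>Every bad point is covered by arbitrarily short intervals of \<open>K\<close>.
    Vitali extracts a disjoint family that covers almost all of them; its finite parts are fine
    tagged partial divisions, so Henstock's lemma bounds their total length by \<open>e\<close>. The
    tag \<open>x\<close> is carried along for that purpose.\<close>
  define K where "K = {(x, p, q). a \<le> p \<and> q \<le> b \<and> p < q \<and> x \<in> {p..q} \<and> {p..q} \<subseteq> \<gamma> x \<and>
            \<eta> * (q - p) \<le> norm ((q - p) *\<^sub>R h x - integral {p..q} h)}"
  define c where "c = (\<lambda>(x::real, p, q). (p + q) / 2 :: real)"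
  define \<rho> where "\<rho> = (\<lambda>(x::real, p, q). (q - p) / 2 :: real)"
  have cb: "cball (c i) (\<rho> i) = {fst (snd i)..snd (snd i)}" if "i \<in> K" for i
    by (cases i) (simp add: c_def \<rho>_def cball_eq_atLeastAtMost field_simps)
  have pos: "0 < \<rho> i" if "i \<in> K" for i
    using that by (auto simp: \<rho>_def K_def)
  have cover: "\<exists>i. i \<in> K \<and> x \<in> cball (c i) (\<rho> i) \<and> \<rho> i < d" if xE: "x \<in> ?E" "0 < d" for x d
  proof -
    obtain r where r: "r > 0" "ball x r \<subseteq> \<gamma> x"
      using \<gamma> unfolding gauge_def using open_contains_ball by blast
    have "min r d > 0" using r xE by auto
    then obtain p q where pq: "a \<le> p \<and> q \<le> b \<and> p < q \<and> x \<in> {p..q} \<and> q - p < min r d \<and>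
            \<eta> * (q - p) \<le> norm ((q - p) *\<^sub>R h x - integral {p..q} h)"
      using xE(1) by blast
    have "{p..q} \<subseteq> ball x r" using pq by (auto simp: dist_real_def)
    then have "(x, p, q) \<in> K" using pq r by (auto simp: K_def)
    moreover have "\<rho> (x, p, q) < d" using pq by (auto simp: \<rho>_def)
    moreover have "x \<in> cball (c (x, p, q)) (\<rho> (x, p, q))"
      using cb[of "(x,p,q)"] calculation(1) pq by simp
    ultimately show ?thesis by blast
  qed
  obtain C where C: "countable C" "C \<subseteq> K"
    and dis: "pairwise (\<lambda>i j. disjnt (cball (c i) (\<rho> i)) (cball (c j) (\<rho> j))) C"
    and neg: "negligible (?E - (\<Union>i \<in> C. cball (c i) (\<rho> i)))"
    by (rule Vitali_covering_theorem_cballs[of K \<rho> ?E c, OF pos cover])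
  have bound: "measure lebesgue (\<Union>i\<in>I. cball (c i) (\<rho> i)) \<le> e" if I: "I \<subseteq> C" "finite I" for I
  proof -
    define P where "P = (\<lambda>(x, p, q). (x, {p..q::real})) ` I"
    have inj: "inj_on (\<lambda>(x, p, q). (x, {p..q::real})) I"
    proof (rule inj_onI)
      fix i j assume a: "i \<in> I" "j \<in> I"
        "(\<lambda>(x, p, q). (x, {p..q::real})) i = (\<lambda>(x, p, q). (x, {p..q})) j"
      obtain x p q x' p' q' where ij: "i = (x, p, q)" "j = (x', p', q')" by (metis prod.exhaust)
      then have "p < q" "p' < q'" using a I C by (auto simp: K_def)
      then show "i = j" using a(3) ij by (simp add: Icc_eq_Icc)
    qed
    have tag: "P tagged_partial_division_of {a..b}"
      unfolding tagged_partial_division_of_def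
    proof (intro conjI allI impI)
      show "finite P" using I by (simp add: P_def)
      show "x \<in> k" "k \<subseteq> {a..b}" "\<exists>a b. k = cbox a b" if "(x, k) \<in> P" for x k
        using that I C by (auto simp: P_def K_def)
      fix x1 k1 x2 k2
      assume "(x1, k1) \<in> P \<and> (x2, k2) \<in> P \<and> (x1, k1) \<noteq> (x2, k2)"
      then have a: "(x1, k1) \<in> P" "(x2, k2) \<in> P" "(x1, k1) \<noteq> (x2, k2)" by blast+
      obtain p1 q1 p2 q2 where i: "(x1,p1,q1) \<in> I" "k1 = {p1..q1}" "(x2,p2,q2) \<in> I" "k2 = {p2..q2}"
        using a by (auto simp: P_def)
      then have "(x1,p1,q1) \<noteq> (x2,p2,q2)" using a by auto
      then have "disjnt (cball (c (x1,p1,q1)) (\<rho> (x1,p1,q1))) (cball (c (x2,p2,q2)) (\<rho> (x2,p2,q2)))"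
        using dis i I unfolding pairwise_def by blast
      moreover have "(x1,p1,q1) \<in> K" "(x2,p2,q2) \<in> K" using i I C by blast+
      ultimately have "disjnt k1 k2"
        using i(2,4) by (simp only: cb fst_conv snd_conv)
      then show "interior k1 \<inter> interior k2 = {}"
        by (meson disjnt_def disjoint_iff interior_subset subsetD)
    qed
    have fine: "\<gamma> fine P" using I C by (auto simp: P_def K_def fine_def)
    have "measure lebesgue (\<Union>i\<in>I. cball (c i) (\<rho> i)) \<le> (\<Sum>i\<in>I. measure lebesgue (cball (c i) (\<rho> i)))"
      using I by (intro measure_UNION_le) auto
    also have "\<dots> = (\<Sum>(x,p,q)\<in>I. q - p)"
      using I C cb by (intro sum.cong) (auto simp: K_def)
    also have "\<dots> \<le> (\<Sum>(x,p,q)\<in>I. norm (content {p..q} *\<^sub>R h x - integral {p..q} h) / \<eta>)"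
      using I C \<open>\<eta> > 0\<close> by (intro sum_mono) (auto simp: K_def field_simps split: prod.splits)
    also have "\<dots> = (\<Sum>(x,k)\<in>P. norm (content k *\<^sub>R h x - integral k h)) / \<eta>"
      unfolding P_def sum.reindex[OF inj] sum_divide_distrib
      by (intro sum.cong) auto
    also have "\<dots> \<le> e"
      using hen[OF tag fine] \<open>\<eta> > 0\<close> by (simp add: divide_simps)
    finally show ?thesis .
  qed
  let ?T = "(\<Union>i\<in>C. cball (c i) (\<rho> i))"
  have T: "?T \<in> lmeasurable" "measure lebesgue ?T \<le> e"
    by (intro fmeasurable_UN_bound[OF C(1) _ bound] measure_UN_bound[OF C(1) _ bound]; simp)+
  have N: "?E - ?T \<in> lmeasurable" "measure lebesgue (?E - ?T) = 0"
    using neg negligible_imp_measurable negligible_imp_measure0 by blast+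
  have M: "measure lebesgue (?T \<union> (?E - ?T)) \<le> e"
    using measure_Un_le[OF fmeasurableD[OF T(1)] fmeasurableD[OF N(1)]] T(2) N(2) by linarith
  show "\<exists>T. ?E \<subseteq> T \<and> T \<in> lmeasurable \<and> measure lebesgue T \<le> e"
    by (intro exI[of _ "?T \<union> (?E - ?T)"] conjI fmeasurable.Un T(1) N(1) M)
      (simp only: Un_Diff_cancel Un_upper2)
qed

text \<open>Lebesgue's differentiation theorem for the gauge integral: off the bad sets for the
  thresholds \<open>1 / Suc n\<close>, the means over all short intervals containing
  \<open>x\<close> converge to \<open>h x\<close>.\<close>

theorem integral_has_vector_derivative_AE:
  fixes h :: "real \<Rightarrow> 'a::euclidean_space"
  assumes h: "h integrable_on {a..b}"
  obtains Z where "negligible Z"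
    "\<And>x. x \<in> {a<..<b} - Z \<Longrightarrow> ((\<lambda>t. integral {a..t} h) has_vector_derivative h x) (at x)"
proof
  define E where "E = (\<lambda>n::nat. {x. \<forall>d>0. \<exists>p q. a \<le> p \<and> q \<le> b \<and> p < q \<and> x \<in> {p..q} \<and> q - p < d \<and>
            (1 / Suc n) * (q - p) \<le> norm ((q - p) *\<^sub>R h x - integral {p..q} h)})"
  show "negligible (\<Union>n. E n)"
    unfolding E_def by (intro negligible_Union_nat negligible_bad_points_integral h) simp
  fix x assume x: "x \<in> {a<..<b} - (\<Union>n. E n)"
  show "((\<lambda>t. integral {a..t} h) has_vector_derivative h x) (at x)"
    unfolding has_vector_derivative_def has_derivative_at_alt
  proof (intro conjI allI impI)
    show "bounded_linear (\<lambda>t. t *\<^sub>R h x)" by (rule bounded_linear_scaleR_left)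
    fix e :: real assume "e > 0"
    then obtain n where n: "1 / Suc n < e" by (metis inverse_eq_divide reals_Archimedean)
    from x have "x \<notin> E n" by auto
    then obtain d where d: "d > 0" and good: "\<And>p q. \<lbrakk>a \<le> p; q \<le> b; p < q; x \<in> {p..q}; q - p < d\<rbrakk> \<Longrightarrow>
            norm ((q - p) *\<^sub>R h x - integral {p..q} h) < (1 / Suc n) * (q - p)"
      unfolding E_def mem_Collect_eq by (meson not_le)
    define \<delta> where "\<delta> = min d (min (x - a) (b - x))"
    have split: "integral {a..q} h - integral {a..p} h = integral {p..q} h" if "a \<le> p" "p \<le> q" "q \<le> b" for p q
      using Henstock_Kurzweil_Integration.integral_combine[of a p q h] that
        integrable_subinterval_real[OF h, of a q] by (auto simp: algebra_simps)
    have "norm (integral {a..y} h - integral {a..x} h - (y - x) *\<^sub>R h x) \<le> e * norm (y - x)"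
      if y: "norm (y - x) < \<delta>" for y
    proof (cases y x rule: linorder_cases)
      case less
      then have "norm ((x - y) *\<^sub>R h x - integral {y..x} h) < (1 / Suc n) * (x - y)"
        using y x by (intro good) (auto simp: \<delta>_def)
      moreover have "integral {a..y} h - integral {a..x} h - (y - x) *\<^sub>R h x = (x - y) *\<^sub>R h x - integral {y..x} h"
        using split[of y x] less y x by (auto simp: \<delta>_def algebra_simps)
      moreover have "(1 / Suc n) * (x - y) \<le> e * (x - y)" using n less by (intro mult_right_mono) auto
      ultimately show ?thesis using less by simp
    next
      case greater
      then have "norm ((y - x) *\<^sub>R h x - integral {x..y} h) < (1 / Suc n) * (y - x)"
        using y x by (intro good) (auto simp: \<delta>_def)
      moreover have "integral {a..y} h - integral {a..x} h - (y - x) *\<^sub>R h x = - ((y - x) *\<^sub>R h x - integral {x..y} h)"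
        using split[of x y] greater y x by (auto simp: \<delta>_def algebra_simps)
      moreover have "(1 / Suc n) * (y - x) \<le> e * (y - x)" using n greater by (intro mult_right_mono) auto
      ultimately show ?thesis using greater by (metis norm_minus_cancel less_eq_real_def order_trans real_norm_def abs_of_pos diff_gt_0_iff_gt)
    qed simp
    moreover have "\<delta> > 0" using d x by (auto simp: \<delta>_def)
    ultimately show "\<exists>d>0. \<forall>y. norm (y - x) < d \<longrightarrow>
        norm (integral {a..y} h - integral {a..x} h - (y - x) *\<^sub>R h x) \<le> e * norm (y - x)"
      by blast
  qed
qed

text \<open>Off \<open>Z\<close> the derivative supplies the gauge. Tags in \<open>Z\<close> are
  confined to an open set \<open>W\<close> of measure less than the \<open>\<delta>\<close> of
  absolute continuity, so the increments over their intervals add up to little.\<close>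

theorem abs_continuous_has_integral:
  fixes y :: "real \<Rightarrow> 'a::euclidean_space"
  assumes "a \<le> b" and ac: "abs_continuous_on a b y" and Z: "negligible Z"
    and der: "\<And>x. x \<in> {a..b} - Z \<Longrightarrow> (y has_vector_derivative h x) (at x within {a..b})"
  shows "(h has_integral (y b - y a)) {a..b}"
proof -
  \<comment> \<open>With the value 0 on \<open>Z\<close>, tags there contribute only increments of
    \<open>y\<close>.\<close>
  define k where "k x = (if x \<in> Z then 0 else h x)" for x
  have "(k has_integral (y b - y a)) {a..b}"
    unfolding has_integral_factor_content_real
  proof (intro allI impI)
    fix e :: real assume "e > 0"
    show "\<exists>\<gamma>. gauge \<gamma> \<and> (\<forall>p. p tagged_division_of {a..b} \<and> \<gamma> fine p \<longrightarrow>
          norm ((\<Sum>(x, K)\<in>p. content K *\<^sub>R k x) - (y b - y a)) \<le> e * content {a..b})"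
    proof (cases "a = b")
      case True
      then show ?thesis
        using sum_content_null[of a b _ k]
        by (intro exI[of _ "\<lambda>x. ball x 1"]) (simp add: gauge_ball)
    next
      case False
      then have "a < b" using \<open>a \<le> b\<close> by simp
      define \<epsilon> where "\<epsilon> = e * (b - a) / 2"
      have "\<epsilon> > 0" using \<open>e > 0\<close> \<open>a < b\<close> by (simp add: \<epsilon>_def)
      obtain \<delta> where "\<delta> > 0" and \<delta>: "\<And>D. \<lbrakk>finite D; \<forall>(s, t)\<in>D. a \<le> s \<and> s \<le> t \<and> t \<le> b;
          pairwise (\<lambda>p q. {fst p<..<snd p} \<inter> {fst q<..<snd q} = {}) D; (\<Sum>(s, t)\<in>D. t - s) < \<delta>\<rbrakk>
          \<Longrightarrow> (\<Sum>(s, t)\<in>D. norm (y t - y s)) < \<epsilon>"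
        using ac \<open>\<epsilon> > 0\<close> unfolding abs_continuous_on_def by meson
      have Zl: "Z \<in> sets lebesgue" "measure lebesgue Z = 0"
        using Z negligible_imp_sets negligible_imp_measure0 by blast+
      obtain W where W: "open W" "Z \<subseteq> W" "W - Z \<in> lmeasurable" "emeasure lebesgue (W - Z) < ennreal \<delta>"
        using sets_lebesgue_outer_open[OF Zl(1) \<open>\<delta> > 0\<close>] by metis
      have Wm: "W \<in> lmeasurable" "measure lebesgue W < \<delta>"
      proof -
        have ZL: "Z \<in> lmeasurable" using Z negligible_imp_measurable by blast
        have eq: "W = (W - Z) \<union> Z" using W by blast
        show 1: "W \<in> lmeasurable" using fmeasurable.Un[OF W(3) ZL] eq by simp
        have "measure lebesgue W \<le> measure lebesgue (W - Z) + measure lebesgue Z"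
          using measure_Un_le[of "W - Z" lebesgue Z] eq W(3) Zl by auto
        also have "\<dots> < \<delta>" using W \<open>\<delta> > 0\<close> Zl by (simp add: emeasure_eq_measure2 ennreal_less_iff)
        finally show "measure lebesgue W < \<delta>" .
      qed
      have "\<exists>r>0. \<forall>t\<in>{a..b}. norm (t - x) < r \<longrightarrow> norm (y t - y x - (t - x) *\<^sub>R h x) \<le> (e/2) * norm (t - x)"
        if "x \<in> {a..b} - Z" for x
        using der[OF that] \<open>e > 0\<close> unfolding has_vector_derivative_def has_derivative_within_alt
        by (meson half_gt_zero)
      then obtain R where R: "\<And>x. x \<in> {a..b} - Z \<Longrightarrow> R x > 0"
        "\<And>x t. x \<in> {a..b} - Z \<Longrightarrow> t \<in> {a..b} \<Longrightarrow> norm (t - x) < R x \<Longrightarrow>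
              norm (y t - y x - (t - x) *\<^sub>R h x) \<le> (e/2) * norm (t - x)"
        by metis
      define \<gamma> where "\<gamma> x = (if x \<in> Z then W else if x \<in> {a..b} then ball x (R x) else ball x 1)" for x
      have gauge: "gauge \<gamma>"
        unfolding gauge_def \<gamma>_def using W R by (auto intro: centre_in_ball[THEN iffD2])
      have main: "norm ((\<Sum>(x, K)\<in>p. content K *\<^sub>R k x) - (y b - y a)) \<le> e * content {a..b}"
        if p: "p tagged_division_of {a..b}" "\<gamma> fine p" for p
      proof -
        have fin: "finite p" using p by blast
        have Kf: "\<exists>u v. K = {u..v} \<and> a \<le> u \<and> u \<le> x \<and> x \<le> v \<and> v \<le> b" if xK: "(x, K) \<in> p" for x K
        proof -
          obtain u v where "K = {u..v}" using tagged_division_ofD(4)[OF p(1) xK] by auto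
          then show ?thesis using tagged_division_ofD(2,3)[OF p(1) xK] by fastforce
        qed
        \<comment> \<open>Absolute continuity sums over a set of pairs of endpoints, so distinct
          tagged pieces must have distinct endpoints. Equal pieces would have to be degenerate, and
          then their tags agree as well.\<close>
        have inj: "K \<noteq> K' \<and> interior K \<inter> interior K' = {}"
          if xK: "(x, K) \<in> p" "(x', K') \<in> p" "(x, K) \<noteq> (x', K')" for x K x' K'
        proof -
          have dj: "interior K \<inter> interior K' = {}" using tagged_division_ofD(5)[OF p(1)] xK by blast
          moreover have "K \<noteq> K'"
          proof
            assume "K = K'"
            obtain u v where K: "K = {u..v}" "u \<le> x" "x \<le> v" using Kf[OF xK(1)] by auto
            obtain u' v' where K': "K' = {u'..v'}" "u' \<le> x'" "x' \<le> v'" using Kf[OF xK(2)] by auto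
            have "{u<..<v} = {}" using dj \<open>K = K'\<close> K by auto
            then have "u = v" using K by auto
            then have "x = x'" using \<open>K = K'\<close> K K' by (metis Icc_eq_Icc antisym order_trans)
            then show False using \<open>K = K'\<close> xK by simp
          qed
          ultimately show ?thesis by blast
        qed
        define Y where "Y K = y (Sup K) - y (Inf K)" for K
        have sumY: "(\<Sum>(x, K)\<in>p. Y K) = y b - y a"
          unfolding Y_def using additive_tagged_division_1[OF \<open>a \<le> b\<close> p(1)] by simp
        define p1 where "p1 = {z \<in> p. fst z \<in> Z}"
        define p2 where "p2 = {z \<in> p. fst z \<notin> Z}"
        have pp: "p = p1 \<union> p2" "p1 \<inter> p2 = {}" "finite p1" "finite p2"
          using fin by (auto simp: p1_def p2_def)
        have "(\<Sum>(x, K)\<in>p. content K *\<^sub>R k x) - (y b - y a) = (\<Sum>(x, K)\<in>p. content K *\<^sub>R k x - Y K)"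
          unfolding sumY[symmetric] sum_subtractf[symmetric] by (intro sum.cong) auto
        also have "\<dots> = (\<Sum>(x, K)\<in>p1. content K *\<^sub>R k x - Y K) + (\<Sum>(x, K)\<in>p2. content K *\<^sub>R k x - Y K)"
          using pp sum.union_disjoint[OF pp(3,4,2)] by simp
        finally have "(\<Sum>(x, K)\<in>p. content K *\<^sub>R k x) - (y b - y a) =
           (\<Sum>(x, K)\<in>p1. content K *\<^sub>R k x - Y K) + (\<Sum>(x, K)\<in>p2. content K *\<^sub>R k x - Y K)" .
        then have "norm ((\<Sum>(x, K)\<in>p. content K *\<^sub>R k x) - (y b - y a)) \<le>
           (\<Sum>(x, K)\<in>p1. norm (content K *\<^sub>R k x - Y K)) + (\<Sum>(x, K)\<in>p2. norm (content K *\<^sub>R k x - Y K))"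
          unfolding split_def
          by (simp only:) (rule order_trans[OF norm_triangle_ineq add_mono[OF norm_sum norm_sum]])
        moreover have "(\<Sum>(x, K)\<in>p1. norm (content K *\<^sub>R k x - Y K)) \<le> \<epsilon>"
        proof -
          define D where "D = (\<lambda>(x, K). (Inf K, Sup K :: real)) ` p1"
          have injD: "inj_on (\<lambda>(x, K). (Inf K, Sup K :: real)) p1"
          proof (rule inj_onI, clarify)
            fix x K x' K' assume a: "(x, K) \<in> p1" "(x', K') \<in> p1" "Inf K = Inf K'" "Sup K = Sup K'"
            then have "K = K'" using Kf[of x K] Kf[of x' K'] by (auto simp: p1_def)
            then show "x = x' \<and> K = K'" using inj[of x K x' K'] a by (auto simp: p1_def)
          qed
          have "finite D" using pp by (simp add: D_def)
          moreover have "\<forall>(s, t)\<in>D. a \<le> s \<and> s \<le> t \<and> t \<le> b"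
            using Kf by (fastforce simp: D_def p1_def)
          moreover have "pairwise (\<lambda>p q. {fst p<..<snd p} \<inter> {fst q<..<snd q} = {}) D"
          proof (rule pairwiseI)
            fix d d' assume d: "d \<in> D" "d' \<in> D" "d \<noteq> d'"
            obtain x K where K: "(x, K) \<in> p" "d = (Inf K, Sup K)" using d by (auto simp: D_def p1_def)
            obtain x' K' where K': "(x', K') \<in> p" "d' = (Inf K', Sup K')" using d by (auto simp: D_def p1_def)
            have "interior K \<inter> interior K' = {}" using inj[OF K(1) K'(1)] d K K' by auto
            then show "{fst d<..<snd d} \<inter> {fst d'<..<snd d'} = {}"
              using Kf[OF K(1)] Kf[OF K'(1)] K K' by auto
          qed
          moreover have "(\<Sum>(s, t)\<in>D. t - s) < \<delta>"
          proof -
            have "(\<Sum>(s, t)\<in>D. t - s) = (\<Sum>(x, K)\<in>p1. content K)"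
              unfolding D_def sum.reindex[OF injD] using Kf by (intro sum.cong) (fastforce simp: p1_def)+
            also have "\<dots> = (\<Sum>K\<in>snd ` p1. content K)"
              using inj by (subst sum.reindex) (auto simp: inj_on_def p1_def split_def)
            also have "\<dots> = measure lebesgue (\<Union>(snd ` p1))"
            proof -
              have div: "snd ` p1 division_of \<Union> (snd ` p1)"
                using division_of_union_self[OF division_of_tagged_division[OF p(1)]]
                by (rule division_of_subset) (auto simp: p1_def)
              have "(\<Sum>K\<in>snd ` p1. content K) = (\<Sum>K\<in>snd ` p1. measure lebesgue K)"
                using Kf by (intro sum.cong) (fastforce simp: p1_def)+
              then show ?thesis using content_division[OF div] by simp
            qed
            also have "\<dots> \<le> measure lebesgue W"
            proof (rule measure_mono_fmeasurable[OF _ _ Wm(1)])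
              show "\<Union> (snd ` p1) \<subseteq> W" using p(2) by (fastforce simp: p1_def fine_def \<gamma>_def)
              show "\<Union> (snd ` p1) \<in> sets lebesgue"
                using pp(3) by (intro sets.finite_Union) (auto simp: p1_def dest!: Kf)
            qed
            also have "\<dots> < \<delta>" by (rule Wm)
            finally show ?thesis .
          qed
          ultimately have "(\<Sum>(s, t)\<in>D. norm (y t - y s)) < \<epsilon>" by (rule \<delta>)
          moreover have "(\<Sum>(s, t)\<in>D. norm (y t - y s)) = (\<Sum>(x, K)\<in>p1. norm (content K *\<^sub>R k x - Y K))"
            unfolding D_def sum.reindex[OF injD] by (intro sum.cong) (auto simp: p1_def k_def Y_def norm_minus_commute)
          ultimately show ?thesis by simp
        qed
        moreover have "(\<Sum>(x, K)\<in>p2. norm (content K *\<^sub>R k x - Y K)) \<le> \<epsilon>"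
        proof -
          have "norm (content K *\<^sub>R k x - Y K) \<le> (e/2) * content K" if xK: "(x, K) \<in> p2" for x K
          proof -
            have "(x, K) \<in> p" using xK by (simp add: p2_def)
            obtain u v where uv: "K = {u..v}" "a \<le> u" "u \<le> x" "x \<le> v" "v \<le> b" using Kf[OF \<open>(x,K) \<in> p\<close>] by auto
            have xZ: "x \<in> {a..b} - Z" using xK uv by (auto simp: p2_def)
            have "K \<subseteq> \<gamma> x" using p(2) \<open>(x,K) \<in> p\<close> by (auto simp: fine_def)
            then have "K \<subseteq> ball x (R x)" using xZ by (simp add: \<gamma>_def)
            then have "norm (u - x) < R x" "norm (v - x) < R x"
              using uv subsetD[of K "ball x (R x)" u] subsetD[of K "ball x (R x)" v]
              by (auto simp: dist_real_def)
            then have "norm (y u - y x - (u - x) *\<^sub>R h x) \<le> (e/2) * (x - u)"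
                      "norm (y v - y x - (v - x) *\<^sub>R h x) \<le> (e/2) * (v - x)"
              using R(2)[OF xZ, of u] R(2)[OF xZ, of v] uv by auto
            then have "norm ((y u - y x - (u - x) *\<^sub>R h x) - (y v - y x - (v - x) *\<^sub>R h x)) \<le> (e/2) * (x - u) + (e/2) * (v - x)"
              by (meson norm_triangle_le_diff add_mono)
            moreover have "(y u - y x - (u - x) *\<^sub>R h x) - (y v - y x - (v - x) *\<^sub>R h x) = content K *\<^sub>R k x - Y K"
              using uv xZ by (auto simp: k_def Y_def algebra_simps)
            ultimately have "norm (content K *\<^sub>R k x - Y K) \<le> (e/2) * (x - u) + (e/2) * (v - x)" by simp
            also have "\<dots> = (e/2) * content K" using uv by (simp add: field_simps)
            finally show ?thesis .
          qed
          then have "(\<Sum>(x, K)\<in>p2. norm (content K *\<^sub>R k x - Y K)) \<le> (\<Sum>(x, K)\<in>p2. (e/2) * content K)"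
            by (intro sum_mono) auto
          also have "\<dots> \<le> (\<Sum>(x, K)\<in>p. (e/2) * content K)"
            using fin \<open>e > 0\<close> by (intro sum_mono2) (auto simp: p2_def)
          also have "\<dots> = (e/2) * (\<Sum>(x, K)\<in>p. content K)"
            by (simp add: sum_distrib_left split_def)
          also have "\<dots> = (e/2) * (b - a)"
            using additive_content_tagged_division[of p a b] p \<open>a \<le> b\<close> by simp
          finally show ?thesis by (simp add: \<epsilon>_def)
        qed
        moreover have "\<epsilon> + \<epsilon> = e * content {a..b}" using \<open>a \<le> b\<close> unfolding \<epsilon>_def by simp
        ultimately show ?thesis by linarith
      qed
      show ?thesis
        by (intro exI[of _ \<gamma>] conjI allI impI gauge) (elim conjE, rule main)
    qed
  qed
  then show ?thesis
    by (rule has_integral_spike[OF Z, rotated]) (simp add: k_def)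
qed

section \<open>Integral equations\<close>

text \<open>The hypothesis says that \<open>exp (- L * s) * (a + L * integral {0..s} \<phi>)\<close>
  has a nonpositive derivative.\<close>

lemma gronwall_integral:
  fixes \<phi> :: "real \<Rightarrow> real"
  assumes cont: "continuous_on {0..T} \<phi>" and "L \<ge> 0"
    and le: "\<And>t. t \<in> {0..T} \<Longrightarrow> \<phi> t \<le> a + L * integral {0..t} \<phi>"
    and t: "t \<in> {0..T}"
  shows "\<phi> t \<le> a * exp (L * t)"
proof -
  define G where "G s = a + L * integral {0..s} \<phi>" for s
  have der: "((\<lambda>s. exp (- L * s) * G s) has_real_derivative exp (- L * s) * (L * (\<phi> s - G s))) (at s within {0..T})"
    if "s \<in> {0..T}" for s
  proof -
    have 1: "((\<lambda>s. exp (- L * s)) has_real_derivative exp (- L * s) * - L) (at s within {0..T})"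
      by (auto intro!: derivative_eq_intros)
    have 2: "(G has_real_derivative L * \<phi> s) (at s within {0..T})"
      unfolding G_def[abs_def]
      using DERIV_add[OF DERIV_const DERIV_cmult[OF integral_has_real_derivative[OF cont that], of L]] by simp
    show ?thesis using DERIV_mult[OF 1 2] by (simp add: algebra_simps)
  qed
  have "((\<lambda>s. exp (- L * s) * G s) has_vector_derivative exp (- L * s) * (L * (\<phi> s - G s))) (at s within {0..t})"
    if s: "s \<in> {0..t}" for s
  proof -
    have "s \<in> {0..T}" "{0..t} \<subseteq> {0..T}" using s t by auto
    then show ?thesis
      using has_field_derivative_subset[OF der] by (simp add: has_real_derivative_iff_has_vector_derivative)
  qed
  then have "((\<lambda>s. exp (- L * s) * (L * (\<phi> s - G s))) has_integral
      exp (- L * t) * G t - exp (- L * 0) * G 0) {0..t}"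
    using t by (intro fundamental_theorem_of_calculus) auto
  then have "exp (- L * t) * G t - exp (- L * 0) * G 0 \<le> 0"
    by (rule has_integral_le[OF _ has_integral_0])
      (use le t \<open>L \<ge> 0\<close> in \<open>auto simp: G_def intro!: mult_nonneg_nonpos\<close>)
  then have "exp (- (L * t)) * G t \<le> a" by (simp add: G_def)
  then have "exp (L * t) * (exp (- (L * t)) * G t) \<le> exp (L * t) * a" by (intro mult_left_mono) auto
  moreover have "exp (L * t) * (exp (- (L * t)) * G t) = G t" by (simp add: exp_minus)
  ultimately have "G t \<le> a * exp (L * t)" using mult.commute[of a "exp (L * t)"] by linarith
  then show ?thesis using le[OF t] by (simp add: G_def)
qed

lemma power_fact_derivative:
  "((\<lambda>s::real. s ^ Suc k / fact (Suc k)) has_real_derivative s ^ k / fact k) (at s within A)"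
proof -
  have "((\<lambda>s::real. s ^ Suc k / fact (Suc k)) has_real_derivative
      (real (Suc k) * s ^ (Suc k - Suc 0)) / fact (Suc k)) (at s within A)"
    by (intro DERIV_cdivide DERIV_pow)
  moreover have "(real (Suc k) * s ^ (Suc k - Suc 0)) / fact (Suc k) = s ^ k / fact k"
    by (simp add: divide_simps del: of_nat_Suc)
  ultimately show ?thesis by simp
qed

text \<open>Picard iteration for a field that is merely integrable in time; successive iterates
  differ by at most \<open>C * L ^ n * t ^ Suc n / fact (Suc n)\<close>. The interval
  \<open>I\<close> will be \<open>{0..}\<close> for trajectories and \<open>{0..T}\<close> for the
  adjoint equation.\<close>

theorem picard_integral_equation:
  fixes F :: "real \<Rightarrow> 'a::euclidean_space \<Rightarrow> 'a"
  assumes I: "\<And>t. t \<in> I \<Longrightarrow> 0 \<le> t" "\<And>s t. t \<in> I \<Longrightarrow> 0 \<le> s \<Longrightarrow> s \<le> t \<Longrightarrow> s \<in> I"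
    and int: "\<And>w t. t \<in> I \<Longrightarrow> continuous_on {0..t} w \<Longrightarrow> (\<lambda>s. F s (w s)) integrable_on {0..t}"
    and lip: "\<And>s p q. s \<in> I \<Longrightarrow> norm (F s p - F s q) \<le> L * norm (p - q)" and "L \<ge> 0"
    and bnd: "\<And>s. s \<in> I \<Longrightarrow> norm (F s x) \<le> C"
  obtains y where "y 0 = x"
    "\<And>t. t \<in> I \<Longrightarrow> ((\<lambda>s. F s (y s)) has_integral (y t - x)) {0..t}"
    "\<And>t. t \<in> I \<Longrightarrow> continuous_on {0..t} y"
proof -
  define Y where "Y = rec_nat (\<lambda>t. x) (\<lambda>n w t. x + integral {0..t} (\<lambda>s. F s (w s)))"
  have Y0: "Y 0 t = x" and YS: "Y (Suc n) t = x + integral {0..t} (\<lambda>s. F s (Y n s))" for n t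
    by (simp_all add: Y_def)
  have cont: "continuous_on {0..t} (Y n)" if "t \<in> I" for n t
  proof (induction n)
    case (Suc n)
    show ?case unfolding YS[abs_def]
      by (intro continuous_intros indefinite_integral_continuous_1 int that Suc)
  qed (simp add: Y0[abs_def])
  have Yint: "(\<lambda>s. F s (Y n s)) integrable_on {0..t}" if "t \<in> I" for n t
    by (rule int[OF that cont[OF that]])
  have diff: "norm (Y (Suc n) t - Y n t) \<le> C * (L ^ n * (t ^ Suc n / fact (Suc n)))" if "t \<in> I" for n t
    using that
  proof (induction n arbitrary: t)
    case 0
    have "norm (integral {0..t} (\<lambda>s. F s x)) \<le> integral {0..t} (\<lambda>s. C)"
      using bnd I[OF 0] I(2)[OF 0] Yint[OF 0, of 0]
      by (intro integral_norm_bound_integral) (auto simp: Y0)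
    then show ?case using I[OF 0] by (simp add: YS Y0 mult.commute)
  next
    case (Suc n)
    have hi: "((\<lambda>s. L * (C * (L ^ n * (s ^ Suc n / fact (Suc n))))) has_integral
        L * (C * (L ^ n * (t ^ Suc (Suc n) / fact (Suc (Suc n)))))) {0..t}"
    proof -
      have "((\<lambda>s::real. s ^ Suc n / fact (Suc n)) has_integral
          t ^ Suc (Suc n) / fact (Suc (Suc n)) - 0 ^ Suc (Suc n) / fact (Suc (Suc n))) {0..t}"
      proof (rule fundamental_theorem_of_calculus)
        show "((\<lambda>s. s ^ Suc (Suc n) / fact (Suc (Suc n))) has_vector_derivative
            s ^ Suc n / fact (Suc n)) (at s within {0..t})" for s :: real
          unfolding has_real_derivative_iff_has_vector_derivative[symmetric]
          by (rule power_fact_derivative)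
      qed (use I(1)[OF Suc.prems] in simp)
      then show ?thesis by (intro has_integral_mult_right) simp
    qed
    have "norm (Y (Suc (Suc n)) t - Y (Suc n) t) =
        norm (integral {0..t} (\<lambda>s. F s (Y (Suc n) s) - F s (Y n s)))"
      by (subst integral_diff[OF Yint Yint]) (use Suc.prems in \<open>simp_all add: YS\<close>)
    also have "\<dots> \<le> integral {0..t} (\<lambda>s. L * (C * (L ^ n * (s ^ Suc n / fact (Suc n)))))"
    proof (rule integral_norm_bound_integral)
      show "(\<lambda>s. F s (Y (Suc n) s) - F s (Y n s)) integrable_on {0..t}"
        by (intro integrable_diff Yint Suc.prems)
      show "(\<lambda>s. L * (C * (L ^ n * (s ^ Suc n / fact (Suc n))))) integrable_on {0..t}"
        using hi by blast
      fix s assume s: "s \<in> {0..t}"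
      then have sI: "s \<in> I" using I(2)[OF Suc.prems] by simp
      have "norm (F s (Y (Suc n) s) - F s (Y n s)) \<le> L * norm (Y (Suc n) s - Y n s)"
        by (rule lip[OF sI])
      also have "\<dots> \<le> L * (C * (L ^ n * (s ^ Suc n / fact (Suc n))))"
        by (intro mult_left_mono Suc.IH[OF sI] \<open>L \<ge> 0\<close>)
      finally show "norm (F s (Y (Suc n) s) - F s (Y n s)) \<le> L * (C * (L ^ n * (s ^ Suc n / fact (Suc n))))" .
    qed
    also have "\<dots> = L * (C * (L ^ n * (t ^ Suc (Suc n) / fact (Suc (Suc n)))))"
      using hi by (rule integral_unique)
    finally show ?case by (simp only: power_Suc mult_ac)
  qed
  define y where "y t = x + (\<Sum>n. Y (Suc n) t - Y n t)" for t
  have lim: "uniform_limit {0..T} Y y sequentially" if T: "T \<in> I" for T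
  proof -
    have "C \<ge> 0" using order_trans[OF norm_ge_zero bnd[OF T]] .
    define M where "M n = C * T * (inverse (fact n) * (L * T) ^ n)" for n
    have "summable M" unfolding M_def by (intro summable_mult summable_exp)
    moreover have "norm (Y (Suc n) t - Y n t) \<le> M n" if t: "t \<in> {0..T}" for n t
    proof -
      have "norm (Y (Suc n) t - Y n t) \<le> C * (L ^ n * (t ^ Suc n / fact (Suc n)))"
        using t I(2)[OF T] by (intro diff) simp
      also have "\<dots> \<le> C * (L ^ n * (T ^ Suc n / fact n))"
        using t \<open>C \<ge> 0\<close> \<open>L \<ge> 0\<close>
        by (intro mult_left_mono frac_le power_mono fact_mono) auto
      also have "\<dots> = M n" by (simp add: M_def power_mult_distrib field_simps)
      finally show ?thesis .
    qed
    ultimately have "uniform_limit {0..T} (\<lambda>n t. \<Sum>i<n. Y (Suc i) t - Y i t) (\<lambda>t. \<Sum>i. Y (Suc i) t - Y i t) sequentially"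
      by (intro Weierstrass_m_test) auto
    then have "uniform_limit {0..T} (\<lambda>n t. x + (\<Sum>i<n. Y (Suc i) t - Y i t)) y sequentially"
      unfolding y_def by (intro uniform_limit_intros)
    moreover have "x + (\<Sum>i<n. Y (Suc i) t - Y i t) = Y n t" for n t
      using sum_lessThan_telescope[of "\<lambda>i. Y i t" n] by (simp add: Y0)
    ultimately show ?thesis by (simp only:)
  qed
  have ycont: "continuous_on {0..t} y" if "t \<in> I" for t
    by (rule uniform_limit_theorem[OF _ lim[OF that]]) (auto simp: cont that)
  show thesis
  proof (rule that[OF _ _ ycont])
    have "Y n 0 = x" for n by (cases n) (simp_all add: Y0 YS)
    then show "y 0 = x" by (simp add: y_def)
    fix t assume t: "t \<in> I"
    have yint: "(\<lambda>s. F s (y s)) integrable_on {0..t}" by (rule int[OF t ycont[OF t]])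
    have "(\<lambda>n. integral {0..t} (\<lambda>s. F s (Y n s))) \<longlonglongrightarrow> integral {0..t} (\<lambda>s. F s (y s))"
    proof (rule LIMSEQ_I)
      fix e :: real assume "e > 0"
      define d where "d = e / (2 * (L * t + 1))"
      have Lt: "L * t + 1 > 0" using \<open>L \<ge> 0\<close> I(1)[OF t] by (simp add: add_nonneg_pos)
      have "d > 0" using \<open>e > 0\<close> Lt by (simp add: d_def)
      obtain N where N: "\<And>n s. n \<ge> N \<Longrightarrow> s \<in> {0..t} \<Longrightarrow> dist (Y n s) (y s) < d"
        using uniform_limitD[OF lim[OF t] \<open>d > 0\<close>] unfolding eventually_sequentially by blast
      have "norm (integral {0..t} (\<lambda>s. F s (Y n s)) - integral {0..t} (\<lambda>s. F s (y s))) < e" if "n \<ge> N" for n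
      proof -
        have "norm (integral {0..t} (\<lambda>s. F s (Y n s) - F s (y s))) \<le> integral {0..t} (\<lambda>s. L * d)"
        proof (rule integral_norm_bound_integral)
          show "(\<lambda>s. F s (Y n s) - F s (y s)) integrable_on {0..t}" by (intro integrable_diff Yint yint t)
          fix s assume s: "s \<in> {0..t}"
          have "norm (F s (Y n s) - F s (y s)) \<le> L * norm (Y n s - y s)" using s I(2)[OF t] by (intro lip) simp
          also have "\<dots> \<le> L * d" using N[OF \<open>n \<ge> N\<close> s] \<open>L \<ge> 0\<close> by (intro mult_left_mono) (simp_all add: dist_norm)
          finally show "norm (F s (Y n s) - F s (y s)) \<le> L * d" .
        qed auto
        also have "\<dots> = (L * t) * d" using I(1)[OF t] by simp
        also have "\<dots> \<le> (L * t + 1) * d" using \<open>d > 0\<close> by simp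
        also have "\<dots> = e / 2" using Lt by (simp add: d_def field_simps)
        also have "\<dots> < e" using \<open>e > 0\<close> by simp
        finally show ?thesis unfolding integral_diff[OF Yint[OF t] yint] .
      qed
      then show "\<exists>no. \<forall>n\<ge>no. norm (integral {0..t} (\<lambda>s. F s (Y n s)) - integral {0..t} (\<lambda>s. F s (y s))) < e"
        by blast
    qed
    then have "(\<lambda>n. Y (Suc n) t) \<longlonglongrightarrow> x + integral {0..t} (\<lambda>s. F s (y s))"
      unfolding YS by (intro tendsto_intros)
    moreover have "(\<lambda>n. Y (Suc n) t) \<longlonglongrightarrow> y t"
      using LIMSEQ_Suc[OF tendsto_uniform_limitI[OF lim[OF t], of t]] I(1)[OF t] by simp
    ultimately have "y t = x + integral {0..t} (\<lambda>s. F s (y s))" by (rule LIMSEQ_unique[symmetric])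
    then show "((\<lambda>s. F s (y s)) has_integral (y t - x)) {0..t}"
      using yint by (simp add: has_integral_iff)
  qed
qed

lemma has_integral_lipschitz:
  fixes W :: "real \<Rightarrow> 'a::euclidean_space"
  assumes W: "\<And>t. t \<in> {0..T} \<Longrightarrow> (h has_integral (W t - W 0)) {0..t}"
    and h: "\<And>s. s \<in> {0..T} \<Longrightarrow> norm (h s) \<le> B"
    and st: "0 \<le> s" "s \<le> t" "t \<le> T"
  shows "norm (W t - W s) \<le> B * (t - s)" and "(h has_integral (W t - W s)) {s..t}"
proof -
  have it: "h integrable_on {0..t}" and ist: "h integrable_on {s..t}"
    using W[of t] st integrable_subinterval_real[of h 0 t s t] by (auto simp: has_integral_iff)
  have "integral {0..s} h + integral {s..t} h = integral {0..t} h"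
    using st it by (intro Henstock_Kurzweil_Integration.integral_combine) auto
  moreover have "integral {0..s} h = W s - W 0" "integral {0..t} h = W t - W 0"
    using W[of s] W[of t] st by (auto simp: has_integral_iff)
  ultimately have eq: "integral {s..t} h = W t - W s" by (simp add: algebra_simps)
  then show hi: "(h has_integral (W t - W s)) {s..t}" using ist by (simp add: has_integral_iff)
  have "B \<ge> 0" using order_trans[OF norm_ge_zero h[of s]] st by simp
  then have "norm (W t - W s) \<le> B * content (cbox s t)"
    using hi h st by (intro has_integral_bound[of B h]) auto
  then show "norm (W t - W s) \<le> B * (t - s)" using st by simp
qed

lemma lipschitz_imp_abs_continuous_on:
  fixes y :: "real \<Rightarrow> 'a::real_normed_vector"
  assumes lip: "\<And>s t. a \<le> s \<Longrightarrow> s \<le> t \<Longrightarrow> t \<le> b \<Longrightarrow> norm (y t - y s) \<le> B * (t - s)" and "B \<ge> 0"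
  shows "abs_continuous_on a b y"
  unfolding abs_continuous_on_def
proof (intro allI impI)
  fix e :: real assume "e > 0"
  show "\<exists>\<delta>>0. \<forall>D. finite D \<longrightarrow> (\<forall>(s, t)\<in>D. a \<le> s \<and> s \<le> t \<and> t \<le> b) \<longrightarrow>
        pairwise (\<lambda>p q. {fst p<..<snd p} \<inter> {fst q<..<snd q} = {}) D \<longrightarrow>
        (\<Sum>(s, t)\<in>D. t - s) < \<delta> \<longrightarrow> (\<Sum>(s, t)\<in>D. norm (y t - y s)) < e"
  proof (intro exI[of _ "e / (B + 1)"] conjI allI impI)
    show "e / (B + 1) > 0" using \<open>e > 0\<close> \<open>B \<ge> 0\<close> by simp
    fix D assume D: "\<forall>(s, t)\<in>D. a \<le> s \<and> s \<le> t \<and> t \<le> b" "(\<Sum>(s, t)\<in>D. t - s) < e / (B + 1)"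
    have "(\<Sum>(s, t)\<in>D. norm (y t - y s)) \<le> (\<Sum>(s, t)\<in>D. B * (t - s))"
      using D(1) by (intro sum_mono) (auto intro!: lip)
    also have "\<dots> = B * (\<Sum>(s, t)\<in>D. t - s)" by (simp add: sum_distrib_left split_def)
    also have "\<dots> \<le> (B + 1) * (\<Sum>(s, t)\<in>D. t - s)"
      using D(1) by (intro mult_right_mono sum_nonneg) auto
    also have "\<dots> < e" using D(2) \<open>B \<ge> 0\<close> by (simp add: field_simps)
    finally show "(\<Sum>(s, t)\<in>D. norm (y t - y s)) < e" .
  qed
qed

lemma indefinite_integral_derivative_AE:
  fixes W :: "real \<Rightarrow> 'a::euclidean_space"
  assumes W: "\<And>t. t \<in> {0..T} \<Longrightarrow> (h has_integral (W t - W 0)) {0..t}"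
  shows "\<exists>Z. negligible Z \<and> (\<forall>x\<in>{0<..<T} - Z. (W has_vector_derivative h x) (at x))"
proof (cases "T \<ge> 0")
  case True
  then have "h integrable_on {0..T}" using W[of T] by auto
  then obtain Z where Z: "negligible Z"
    "\<And>x. x \<in> {0<..<T} - Z \<Longrightarrow> ((\<lambda>t. integral {0..t} h) has_vector_derivative h x) (at x)"
    using integral_has_vector_derivative_AE by blast
  have "(W has_vector_derivative h x) (at x)" if x: "x \<in> {0<..<T} - Z" for x
  proof (rule has_vector_derivative_transform_within_open)
    show "((\<lambda>t. W 0 + integral {0..t} h) has_vector_derivative h x) (at x)"
      using has_vector_derivative_add[OF has_vector_derivative_const Z(2)[OF x]] by simp
    show "open {0<..<T}" "x \<in> {0<..<T}" using x by auto
    show "W 0 + integral {0..t} h = W t" if "t \<in> {0<..<T}" for t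
      using W[of t] that by (auto simp: has_integral_iff)
  qed
  then show ?thesis using Z(1) by blast
next
  case False
  then show ?thesis by (intro exI[of _ "{}"]) auto
qed

text \<open>Integration by parts. Bounded integrands make both factors Lipschitz, so their product
  is absolutely continuous, and the product rule holds almost everywhere.\<close>

lemma has_integral_inner_product:
  fixes P W :: "real \<Rightarrow> 'a::euclidean_space"
  assumes P: "\<And>t. t \<in> {0..T} \<Longrightarrow> (p has_integral (P t - P 0)) {0..t}"
    and W: "\<And>t. t \<in> {0..T} \<Longrightarrow> (w has_integral (W t - W 0)) {0..t}"
    and p: "\<And>s. s \<in> {0..T} \<Longrightarrow> norm (p s) \<le> A"
    and w: "\<And>s. s \<in> {0..T} \<Longrightarrow> norm (w s) \<le> B"
    and "0 \<le> T"
  shows "((\<lambda>s. p s \<bullet> W s + P s \<bullet> w s) has_integral (P T \<bullet> W T - P 0 \<bullet> W 0)) {0..T}"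
proof -
  have AE1: "\<exists>Z. negligible Z \<and> (\<forall>x\<in>{0<..<T} - Z. (P has_vector_derivative p x) (at x))"
    by (rule indefinite_integral_derivative_AE) (rule P)
  have AE2: "\<exists>Z. negligible Z \<and> (\<forall>x\<in>{0<..<T} - Z. (W has_vector_derivative w x) (at x))"
    by (rule indefinite_integral_derivative_AE) (rule W)
  obtain Z1 where Z1: "negligible Z1" "\<And>x. x \<in> {0<..<T} - Z1 \<Longrightarrow> (P has_vector_derivative p x) (at x)"
    using AE1 by blast
  obtain Z2 where Z2: "negligible Z2" "\<And>x. x \<in> {0<..<T} - Z2 \<Longrightarrow> (W has_vector_derivative w x) (at x)"
    using AE2 by blast
  have AB: "A \<ge> 0" "B \<ge> 0" using order_trans[OF norm_ge_zero p[of 0]] order_trans[OF norm_ge_zero w[of 0]] \<open>0 \<le> T\<close> by simp_all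
  have lipP: "norm (P t - P s) \<le> A * (t - s)" and lipW: "norm (W t - W s) \<le> B * (t - s)"
    if "0 \<le> s" "s \<le> t" "t \<le> T" for s t
    using has_integral_lipschitz(1)[of T p P A s t] has_integral_lipschitz(1)[of T w W B s t] P W p w that
    by blast+
  define a where "a = norm (P 0) + A * T"
  define b where "b = norm (W 0) + B * T"
  have Pb: "norm (P t) \<le> a" and Wb: "norm (W t) \<le> b" if "t \<in> {0..T}" for t
  proof -
    have "norm (P t - P 0) \<le> A * (t - 0)" "norm (W t - W 0) \<le> B * (t - 0)"
      using that lipP[of 0 t] lipW[of 0 t] by auto
    moreover have "A * t \<le> A * T" "B * t \<le> B * T" using that AB by (auto intro: mult_left_mono)
    ultimately show "norm (P t) \<le> a" "norm (W t) \<le> b"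
      using norm_triangle_sub[of "P t" "P 0"] norm_triangle_sub[of "W t" "W 0"]
      by (simp_all add: a_def b_def)
  qed
  have ab: "a \<ge> 0" "b \<ge> 0" using AB \<open>0 \<le> T\<close> by (auto simp: a_def b_def)
  have "abs_continuous_on 0 T (\<lambda>s. P s \<bullet> W s)"
  proof (rule lipschitz_imp_abs_continuous_on)
    show "A * b + a * B \<ge> 0" using AB ab by simp
    fix s t assume st: "0 \<le> s" "s \<le> t" "t \<le> T"
    have "P t \<bullet> W t - P s \<bullet> W s = (P t - P s) \<bullet> W t + P s \<bullet> (W t - W s)"
      by (simp add: inner_diff_left inner_diff_right)
    then have "norm (P t \<bullet> W t - P s \<bullet> W s) \<le> norm (P t - P s) * norm (W t) + norm (P s) * norm (W t - W s)"
      by (metis norm_triangle_le add_mono Cauchy_Schwarz_ineq2 real_norm_def)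
    also have "\<dots> \<le> (A * (t - s)) * b + a * (B * (t - s))"
      using lipP[OF st] lipW[OF st] Pb[of s] Wb[of t] st ab AB by (intro add_mono mult_mono) auto
    finally show "norm (P t \<bullet> W t - P s \<bullet> W s) \<le> (A * b + a * B) * (t - s)" by (simp add: algebra_simps)
  qed
  moreover have "negligible (Z1 \<union> Z2 \<union> {0, T})" using Z1 Z2 by (intro negligible_Un) auto
  moreover have "((\<lambda>s. P s \<bullet> W s) has_vector_derivative (p x \<bullet> W x + P x \<bullet> w x)) (at x within {0..T})"
    if x: "x \<in> {0..T} - (Z1 \<union> Z2 \<union> {0, T})" for x
  proof -
    have d: "(P has_vector_derivative p x) (at x)" "(W has_vector_derivative w x) (at x)"
      using Z1(2)[of x] Z2(2)[of x] x by auto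
    have "((\<lambda>s. P s \<bullet> W s) has_derivative (\<lambda>h. P x \<bullet> (h *\<^sub>R w x) + (h *\<^sub>R p x) \<bullet> W x)) (at x)"
      using d unfolding has_vector_derivative_def by (rule has_derivative_inner)
    then have "((\<lambda>s. P s \<bullet> W s) has_vector_derivative (p x \<bullet> W x + P x \<bullet> w x)) (at x)"
      unfolding has_vector_derivative_def by (simp add: algebra_simps)
    then show ?thesis by (rule has_vector_derivative_at_within)
  qed
  ultimately show ?thesis by (intro abs_continuous_has_integral[OF \<open>0 \<le> T\<close>])
qed

lemma control_composition_integrable:
  fixes F :: "'a::euclidean_space \<Rightarrow> 'u::euclidean_space \<Rightarrow> 'b::euclidean_space"
  assumes U: "compact U" and F: "continuous_on (UNIV \<times> U) (\<lambda>(x, \<omega>). F x \<omega>)"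
    and w: "continuous_on {0..t} w" and u: "admissible_control U u"
  shows "(\<lambda>s. F (w s) (u s)) absolutely_integrable_on {0..t}"
proof -
  have uU: "u s \<in> U" if "s \<ge> 0" for s using u that by (simp add: admissible_control_def)
  have "u \<in> borel_measurable (lebesgue_on {0..t})"
    using u by (auto simp: admissible_control_def intro: measurable_restrict_mono)
  moreover have "w \<in> borel_measurable (lebesgue_on {0..t})"
    using w by (intro continuous_imp_measurable_on_sets_lebesgue) auto
  ultimately have m: "(\<lambda>s. (w s, u s)) \<in> borel_measurable (lebesgue_on {0..t})"
    by (rule borel_measurable_Pair[rotated])
  \<comment> \<open>\<open>F\<close> is continuous on \<open>UNIV \<times> U\<close> only. Extended
    by zero off this closed set it is Borel measurable, and the control never leaves
    \<open>U\<close>.\<close>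
  have "closed (UNIV \<times> U)" using U by (intro closed_Times compact_imp_closed) auto
  then have "(\<lambda>x. indicator (UNIV \<times> U) x *\<^sub>R (\<lambda>(x, \<omega>). F x \<omega>) x) \<in> borel_measurable borel"
    by (intro borel_measurable_continuous_on_indicator F) (rule borel_closed)
  from measurable_compose[OF m this]
  have meas: "(\<lambda>s. F (w s) (u s)) \<in> borel_measurable (lebesgue_on {0..t})"
    by (rule measurable_cong[THEN iffD1, rotated]) (auto simp: space_restrict_space indicator_def uU)
  have "compact ((\<lambda>(x, \<omega>). F x \<omega>) ` (w ` {0..t} \<times> U))"
    by (intro compact_continuous_image continuous_on_subset[OF F] compact_Times compact_continuous_image w U) auto
  then obtain B where B: "\<And>z. z \<in> (\<lambda>(x, \<omega>). F x \<omega>) ` (w ` {0..t} \<times> U) \<Longrightarrow> norm z \<le> B"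
    using compact_imp_bounded bounded_iff by metis
  have bound: "norm (F (w s) (u s)) \<le> B" if "s \<in> {0..t}" for s
    using that uU by (intro B) (auto intro!: image_eqI[of _ _ "(w s, u s)"])
  show ?thesis
    by (rule measurable_bounded_by_integrable_imp_absolutely_integrable[OF meas _ _ bound]) auto
qed

lemma norm_integral_equation_bound:
  fixes Q :: "real \<Rightarrow> 'a::euclidean_space"
  assumes Q: "\<And>t. t \<in> {0..T} \<Longrightarrow> ((\<lambda>s. B s) has_integral (Q t - Q 0)) {0..t}"
    and cont: "continuous_on {0..T} Q"
    and B: "\<And>s. s \<in> {0..T} \<Longrightarrow> norm (B s) \<le> K + L * norm (Q s)" and KL: "K \<ge> 0" "L \<ge> 0"
    and t: "t \<in> {0..T}"
  shows "norm (Q t) \<le> (norm (Q 0) + K * T) * exp (L * T)"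
proof -
  have "norm (Q t) \<le> (norm (Q 0) + K * T) * exp (L * t)"
  proof (rule gronwall_integral[where T = T and \<phi> = "\<lambda>t. norm (Q t)"])
    show "continuous_on {0..T} (\<lambda>t. norm (Q t))" by (intro continuous_intros cont)
    fix t assume t: "t \<in> {0..T}"
    have c: "continuous_on {0..t} (\<lambda>t. norm (Q t))"
      using t by (intro continuous_intros continuous_on_subset[OF cont]) auto
    have "norm (integral {0..t} B) \<le> integral {0..t} (\<lambda>s. K + L * norm (Q s))"
    proof (rule integral_norm_bound_integral)
      show "B integrable_on {0..t}" using Q[OF t] by blast
      show "(\<lambda>s. K + L * norm (Q s)) integrable_on {0..t}"
        by (intro integrable_continuous_real continuous_on_add continuous_on_mult continuous_on_const c)
      show "norm (B s) \<le> K + L * norm (Q s)" if "s \<in> {0..t}" for s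
        using B[of s] that t by simp
    qed
    also have "\<dots> = K * t + L * integral {0..t} (\<lambda>s. norm (Q s))"
      using t integrable_continuous_real[OF c]
      by (subst integral_add) (auto intro: integrable_on_mult_right)
    finally have "norm (Q t - Q 0) \<le> K * t + L * integral {0..t} (\<lambda>s. norm (Q s))"
      using integral_unique[OF Q[OF t]] by simp
    moreover have "K * t \<le> K * T" using t KL by (intro mult_left_mono) auto
    ultimately show "norm (Q t) \<le> norm (Q 0) + K * T + L * integral {0..t} (\<lambda>s. norm (Q s))"
      using norm_triangle_sub[of "Q t" "Q 0"] by linarith
  qed (use KL t in auto)
  also have "\<dots> \<le> (norm (Q 0) + K * T) * exp (L * T)"
    using t KL by (intro mult_left_mono) (auto intro: mult_left_mono)
  finally show ?thesis .
qed

lemma has_integral_reflect_shift: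
  fixes h :: "real \<Rightarrow> 'a::euclidean_space"
  shows "((\<lambda>s. h (T - s)) has_integral I) {T - b..T - a} \<longleftrightarrow> (h has_integral I) {a..b}"
  using has_integral_shift_real_ivl_iff[of "\<lambda>s. h (T - s)" I "T - b" "T - a" T] by simp

text \<open>Picard's theorem after time reversal. The last estimate bounds the prescribed end value
  by the initial value; it later keeps the transported normal away from zero.\<close>

theorem backward_integral_equation:
  fixes A :: "real \<Rightarrow> 'a::euclidean_space \<Rightarrow> 'a"
  assumes "0 \<le> T"
    and int: "\<And>w. continuous_on {0..T} w \<Longrightarrow> (\<lambda>s. A s (w s)) integrable_on {0..T}"
    and lip: "\<And>s p q. s \<in> {0..T} \<Longrightarrow> norm (A s p - A s q) \<le> L * norm (p - q)"
    and bnd: "\<And>s. s \<in> {0..T} \<Longrightarrow> norm (A s 0) \<le> K" and "L \<ge> 0"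
  obtains q where "q T = qT" "continuous_on {0..T} q"
    "\<And>t. t \<in> {0..T} \<Longrightarrow> ((\<lambda>s. - A s (q s)) has_integral (q t - q 0)) {0..t}"
    "\<And>t. t \<in> {0..T} \<Longrightarrow> norm (q t) \<le> (norm qT + K * T) * exp (L * T)"
    "norm qT \<le> (norm (q 0) + K * T) * exp (L * T)"
proof -
  have K: "K \<ge> 0" using order_trans[OF norm_ge_zero bnd[of 0]] \<open>0 \<le> T\<close> by simp
  have growth: "norm (A s p) \<le> K + L * norm p" if "s \<in> {0..T}" for s p
    using lip[OF that, of p 0] bnd[OF that] norm_triangle_sub[of "A s p" "A s 0"] by simp
  have intT: "(\<lambda>s. A (T - s) (w s)) integrable_on {0..t}" if t: "t \<in> {0..T}" and w: "continuous_on {0..t} w" for t w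
  proof -
    \<comment> \<open>\<open>w\<close> is known on \<open>{0..t}\<close> only; freezing it at
      \<open>t\<close> yields a continuous function of the reversed time on all of
      \<open>{0..T}\<close>, to which \<open>int\<close> applies.\<close>
    have "continuous_on {0..T} (\<lambda>\<sigma>. w (min t (T - \<sigma>)))"
      by (rule continuous_on_compose2[OF w]) (use t in \<open>auto intro!: continuous_intros\<close>)
    then have "(\<lambda>\<sigma>. A \<sigma> (w (min t (T - \<sigma>)))) integrable_on {T - t..T}"
      using t by (intro integrable_subinterval_real[OF int]) auto
    then obtain i where "((\<lambda>\<sigma>. A \<sigma> (w (min t (T - \<sigma>)))) has_integral i) {T - t..T}" by blast
    then have "((\<lambda>s. A (T - s) (w (min t s))) has_integral i) {0..t}"
      using has_integral_reflect_shift[of "\<lambda>\<sigma>. A \<sigma> (w (min t (T - \<sigma>)))" T i T "T - t"] by simp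
    then have "((\<lambda>s. A (T - s) (w s)) has_integral i) {0..t}"
      by (rule has_integral_eq[rotated]) (simp add: min_absorb2)
    then show ?thesis by blast
  qed
  obtain Q where Q: "Q 0 = qT"
    "\<And>t. t \<in> {0..T} \<Longrightarrow> ((\<lambda>s. A (T - s) (Q s)) has_integral (Q t - qT)) {0..t}"
    "\<And>t. t \<in> {0..T} \<Longrightarrow> continuous_on {0..t} Q"
  proof (rule picard_integral_equation[of "{0..T}" "\<lambda>s. A (T - s)" L qT "K + L * norm qT"])
    show "norm (A (T - s) p - A (T - s) q) \<le> L * norm (p - q)" if "s \<in> {0..T}" for s p q
      using that by (intro lip) auto
    show "norm (A (T - s) qT) \<le> K + L * norm qT" if "s \<in> {0..T}" for s
      using that by (intro growth) auto
    show "(\<lambda>s. A (T - s) (w s)) integrable_on {0..t}" if "t \<in> {0..T}" "continuous_on {0..t} w" for t w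
      using that by (rule intT)
  qed (use \<open>L \<ge> 0\<close> in simp_all)
  define q where "q s = Q (T - s)" for s
  have contQ: "continuous_on {0..T} Q" using Q(3)[of T] \<open>0 \<le> T\<close> by simp
  have contq: "continuous_on {0..T} q" unfolding q_def
    by (rule continuous_on_compose2[OF contQ]) (auto intro!: continuous_intros)
  have AQ: "((\<lambda>s. A s (q s)) has_integral (q 0 - q t)) {0..t}" if t: "t \<in> {0..T}" for t
  proof -
    have 1: "((\<lambda>s. A (T - s) (Q s)) has_integral (Q T - Q (T - t))) {T - t..T}"
    proof -
      have "(\<lambda>s. A (T - s) (Q s)) integrable_on {0..T}" using Q(2)[of T] \<open>0 \<le> T\<close> by auto
      then have "integral {0..T - t} (\<lambda>s. A (T - s) (Q s)) + integral {T - t..T} (\<lambda>s. A (T - s) (Q s)) =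
          integral {0..T} (\<lambda>s. A (T - s) (Q s))" "(\<lambda>s. A (T - s) (Q s)) integrable_on {T - t..T}"
        using t by (auto intro!: Henstock_Kurzweil_Integration.integral_combine integrable_subinterval_real[of _ 0 T])
      moreover have "integral {0..T} (\<lambda>s. A (T - s) (Q s)) = Q T - qT"
        "integral {0..T - t} (\<lambda>s. A (T - s) (Q s)) = Q (T - t) - qT"
        using Q(2)[of T] Q(2)[of "T - t"] t by (auto simp del: has_integral_iff intro!: integral_unique)
      ultimately show ?thesis by (simp add: has_integral_iff eq_diff_eq[symmetric] add.commute)
    qed
    then show ?thesis
      using has_integral_reflect_shift[of "\<lambda>s. A s (q s)" T "Q T - Q (T - t)" t 0] by (simp add: q_def)
  qed
  have Aq: "((\<lambda>s. - A s (q s)) has_integral (q t - q 0)) {0..t}" if t: "t \<in> {0..T}" for t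
    using has_integral_neg[OF AQ[OF that]] by simp
  show thesis
  proof (rule that[of q])
    show "q T = qT" by (simp add: q_def Q)
    show "norm (q t) \<le> (norm qT + K * T) * exp (L * T)" if t: "t \<in> {0..T}" for t
    proof -
      have "norm (Q (T - t)) \<le> (norm (Q 0) + K * T) * exp (L * T)"
      proof (rule norm_integral_equation_bound[OF _ contQ])
        show "((\<lambda>s. A (T - s) (Q s)) has_integral Q t - Q 0) {0..t}" if "t \<in> {0..T}" for t
          using Q that by simp
        show "norm (A (T - s) (Q s)) \<le> K + L * norm (Q s)" if "s \<in> {0..T}" for s
          using that by (intro growth) auto
      qed (use K \<open>L \<ge> 0\<close> t in auto)
      then show ?thesis by (simp add: q_def Q)
    qed
    have "norm (q T) \<le> (norm (q 0) + K * T) * exp (L * T)"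
    proof (rule norm_integral_equation_bound[OF Aq contq])
      show "norm (- A s (q s)) \<le> K + L * norm (q s)" if "s \<in> {0..T}" for s
        using growth[OF that] by simp
    qed (use K \<open>L \<ge> 0\<close> \<open>0 \<le> T\<close> in simp_all)
    then show "norm qT \<le> (norm (q 0) + K * T) * exp (L * T)" by (simp add: q_def Q)
    show "continuous_on {0..T} q" by (rule contq)
    show "((\<lambda>s. - A s (q s)) has_integral (q t - q 0)) {0..t}" if "t \<in> {0..T}" for t
      by (rule Aq[OF that])
  qed
qed

section \<open>Exterior spheres and proximal normals\<close>

text \<open>For \<open>\<sigma> > 0\<close> the inequality says that the open ball of radius
  \<open>1 / (2 * \<sigma>)\<close> centred at \<open>p + k / (2 * \<sigma>)\<close> misses
  \<open>H\<close>. In contrast to \<open>proximal_normals\<close> the constant is fixed, and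
  \<open>p\<close> may lie outside \<open>H\<close>.\<close>

definition sphere_normals :: "'a::euclidean_space set \<Rightarrow> real \<Rightarrow> 'a \<Rightarrow> 'a set" where
  "sphere_normals H \<sigma> p = {k. norm k = 1 \<and> (\<forall>y\<in>H. k \<bullet> (y - p) \<le> \<sigma> * (norm (y - p))\<^sup>2)}"

text \<open>The constant \<open>\<sigma>\<close> is common to the sequence, so the inequality
  survives a simultaneous limit of base point and normal.\<close>

lemma sphere_normals_limit:
  assumes "p \<longlonglongrightarrow> p0" "k \<longlonglongrightarrow> k0" "\<And>n. k n \<in> sphere_normals H \<sigma> (p n)"
  shows "k0 \<in> sphere_normals H \<sigma> p0"
proof -
  have "(\<lambda>n. norm (k n)) \<longlonglongrightarrow> norm k0" using assms(2) by (rule tendsto_norm)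
  then have "norm k0 = 1"
    using assms(3) LIMSEQ_unique tendsto_const by (simp add: sphere_normals_def) blast
  moreover have "k0 \<bullet> (y - p0) \<le> \<sigma> * (norm (y - p0))\<^sup>2" if "y \<in> H" for y
  proof (rule LIMSEQ_le)
    show "(\<lambda>n. k n \<bullet> (y - p n)) \<longlonglongrightarrow> k0 \<bullet> (y - p0)"
      by (intro tendsto_intros assms)
    show "(\<lambda>n. \<sigma> * (norm (y - p n))\<^sup>2) \<longlonglongrightarrow> \<sigma> * (norm (y - p0))\<^sup>2"
      by (intro tendsto_intros assms)
    show "\<exists>N. \<forall>n\<ge>N. k n \<bullet> (y - p n) \<le> \<sigma> * (norm (y - p n))\<^sup>2"
      using assms(3) that by (auto simp: sphere_normals_def)
  qed
  ultimately show ?thesis by (simp add: sphere_normals_def)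
qed

lemma compact_sphere_normals: "compact (sphere_normals H \<sigma> p)"
proof -
  have "closed (sphere_normals H \<sigma> p)"
    unfolding closed_sequential_limits
    using sphere_normals_limit[OF tendsto_const] by blast
  moreover have "bounded (sphere_normals H \<sigma> p)"
    by (auto simp: bounded_iff sphere_normals_def intro!: exI[of _ 1])
  ultimately show ?thesis by (simp add: compact_eq_bounded_closed)
qed

lemma sphere_normals_proximal: "0 \<le> \<sigma> \<Longrightarrow> sphere_normals H \<sigma> p \<subseteq> proximal_normals H p"
  by (auto simp: sphere_normals_def proximal_normals_def)

text \<open>Otherwise normals at points tending to \<open>p0\<close> would subconverge, by
  compactness of the unit sphere, to a sphere normal at \<open>p0\<close> whose product with
  \<open>w\<close> is nonnegative.\<close>

lemma sphere_normals_uniformly_negative: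
  fixes w :: "'a::euclidean_space"
  assumes "\<And>k. k \<in> sphere_normals H \<sigma> p0 \<Longrightarrow> k \<bullet> w < 0"
  obtains \<eta> \<delta> where "\<eta> > 0" "\<delta> > 0"
    "\<And>p k. dist p p0 < \<delta> \<Longrightarrow> k \<in> sphere_normals H \<sigma> p \<Longrightarrow> k \<bullet> w \<le> - \<eta>"
proof -
  have "\<exists>n::nat. \<forall>p k. dist p p0 < 1 / Suc n \<longrightarrow> k \<in> sphere_normals H \<sigma> p \<longrightarrow> k \<bullet> w \<le> - (1 / Suc n)"
  proof (rule ccontr)
    assume "\<not> ?thesis"
    then obtain p k where pk: "\<And>n::nat. dist (p n) p0 < 1 / Suc n"
        "\<And>n. k n \<in> sphere_normals H \<sigma> (p n)" "\<And>n. - (1 / Suc n) < k n \<bullet> w"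
      by (metis not_le)
    have "\<forall>n. k n \<in> sphere 0 1" using pk by (auto simp: sphere_normals_def)
    then obtain k0 s where s: "strict_mono (s :: nat \<Rightarrow> nat)" "(k \<circ> s) \<longlonglongrightarrow> k0"
      using compact_sphere[of "0::'a" 1] unfolding compact_def by metis
    have inv: "(\<lambda>n. 1 / real (Suc n)) \<longlonglongrightarrow> 0"
      using LIMSEQ_inverse_real_of_nat by (simp add: inverse_eq_divide)
    have "p \<longlonglongrightarrow> p0"
      by (rule metric_tendsto_imp_tendsto[OF inv])
        (use pk(1) in \<open>auto intro!: always_eventually less_imp_le simp: less_eq_real_def\<close>)
    then have ps: "(p \<circ> s) \<longlonglongrightarrow> p0" using s(1) LIMSEQ_subseq_LIMSEQ by blast
    have "k0 \<in> sphere_normals H \<sigma> p0"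
      by (rule sphere_normals_limit[OF ps s(2)]) (simp add: pk)
    then have "k0 \<bullet> w < 0" by (rule assms)
    moreover have "0 \<le> k0 \<bullet> w"
    proof (rule LIMSEQ_le)
      show "(\<lambda>n. - (1 / real (Suc (s n)))) \<longlonglongrightarrow> 0"
        using LIMSEQ_subseq_LIMSEQ[OF inv s(1)] tendsto_minus_cancel_left by (fastforce simp: o_def)
      show "(\<lambda>n. (k \<circ> s) n \<bullet> w) \<longlonglongrightarrow> k0 \<bullet> w" by (intro tendsto_intros s)
      show "\<exists>N. \<forall>n\<ge>N. - (1 / real (Suc (s n))) \<le> (k \<circ> s) n \<bullet> w"
        using pk(3) by (auto intro: less_imp_le)
    qed
    ultimately show False by simp
  qed
  then obtain n :: nat where n: "\<And>p k. dist p p0 < 1 / Suc n \<Longrightarrow> k \<in> sphere_normals H \<sigma> p \<Longrightarrow> k \<bullet> w \<le> - (1 / Suc n)"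
    by blast
  show thesis by (rule that[OF _ _ n, of "1 / Suc n"]) auto
qed

text \<open>A segment in the direction \<open>w\<close> from an interior point cannot leave \<open>H\<close>: at the exit point
  the exterior sphere would exclude the points behind it.\<close>

lemma proximal_normal_nonpositive:
  fixes H :: "'a::euclidean_space set"
  assumes "closed H" and p0: "p0 \<in> closure (interior H)" and "\<sigma> \<ge> 0" and "\<delta> > 0"
    and sph: "\<And>p. p \<in> frontier H \<Longrightarrow> dist p p0 < \<delta> \<Longrightarrow> sphere_normals H \<sigma> p \<noteq> {}"
    and w: "\<And>k. k \<in> sphere_normals H \<sigma> p0 \<Longrightarrow> k \<bullet> w < 0"
    and v: "v \<in> proximal_normals H p0"
  shows "v \<bullet> w \<le> 0"
proof -
  obtain \<eta> \<delta>1 where \<eta>: "\<eta> > 0" "\<delta>1 > 0"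
    and neg: "\<And>p k. dist p p0 < \<delta>1 \<Longrightarrow> k \<in> sphere_normals H \<sigma> p \<Longrightarrow> k \<bullet> w \<le> - \<eta>"
    using sphere_normals_uniformly_negative[OF w] by blast
  define d where "d = min \<delta> \<delta>1"
  have "d > 0" using \<open>\<delta> > 0\<close> \<eta> by (simp add: d_def)
  \<comment> \<open>The first bound makes the quadratic term
    \<open>s * \<sigma> * (norm w)\<^sup>2\<close> at most \<open>\<eta> / 2\<close>; the second
    keeps segments that start within \<open>d/2\<close> of \<open>p0\<close> in the region where
    spheres are available.\<close>
  define t0 where "t0 = min (\<eta> / (2 * (\<sigma> * (norm w)\<^sup>2 + 1))) (d / (2 * (norm w + 1)))"
  have pos: "\<sigma> * (norm w)\<^sup>2 + 1 > 0" "norm w + 1 > 0"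
    using \<open>\<sigma> \<ge> 0\<close> by (auto intro: add_nonneg_pos)
  have t0: "t0 > 0" using \<eta> \<open>d > 0\<close> pos by (simp add: t0_def)
  have behind: "p - s *\<^sub>R w \<notin> H" if fr: "p \<in> frontier H" "dist p p0 < d" "0 < s" "s \<le> t0" for p s
  proof
    assume inH: "p - s *\<^sub>R w \<in> H"
    obtain k where k: "k \<in> sphere_normals H \<sigma> p" using sph fr by (auto simp: d_def)
    have "k \<bullet> w \<le> - \<eta>" using neg[OF _ k] that by (simp add: d_def)
    then have "s * \<eta> \<le> k \<bullet> ((p - s *\<^sub>R w) - p)"
      using mult_left_mono[of "k \<bullet> w" "- \<eta>" s] \<open>0 < s\<close> by (simp add: inner_minus_right)
    also have "\<dots> \<le> \<sigma> * (norm ((p - s *\<^sub>R w) - p))\<^sup>2"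
      using k inH unfolding sphere_normals_def by blast
    also have "\<dots> = s * (s * (\<sigma> * (norm w)\<^sup>2))"
      using \<open>0 < s\<close> by (simp add: power_mult_distrib power2_eq_square)
    finally have "\<eta> \<le> s * (\<sigma> * (norm w)\<^sup>2)" using \<open>0 < s\<close> by simp
    also have "\<dots> \<le> s * (\<sigma> * (norm w)\<^sup>2 + 1)" using \<open>0 < s\<close> by (intro mult_left_mono) auto
    also have "\<dots> \<le> (\<eta> / (2 * (\<sigma> * (norm w)\<^sup>2 + 1))) * (\<sigma> * (norm w)\<^sup>2 + 1)"
      using that pos by (intro mult_right_mono) (auto simp: t0_def)
    also have "\<dots> = \<eta> / 2" using pos by (simp add: field_simps)
    finally show False using \<eta> by simp
  qed
  have fwd: "x + t *\<^sub>R w \<in> H" if x: "x \<in> interior H" "dist x p0 < d/2" and t: "0 \<le> t" "t \<le> t0" for x t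
  proof (rule ccontr)
    assume out: "x + t *\<^sub>R w \<notin> H"
    define T where "T = (\<lambda>s. x + s *\<^sub>R w) ` {0..t}"
    have "connected T" unfolding T_def
      by (intro connected_continuous_image continuous_intros) auto
    moreover have "x \<in> T \<inter> H" using t x interior_subset by (force simp: T_def intro!: image_eqI[of _ _ 0])
    moreover have "x + t *\<^sub>R w \<in> T - H" using t out by (auto simp: T_def)
    ultimately have "T \<inter> frontier H \<noteq> {}" by (intro connected_Int_frontier) auto
    then obtain s where s: "0 \<le> s" "s \<le> t" "x + s *\<^sub>R w \<in> frontier H" by (auto simp: T_def)
    have "s \<noteq> 0" using s(3) x by (auto simp: frontier_def)
    have "dist (x + s *\<^sub>R w) p0 \<le> dist x p0 + s * norm w"
      using s norm_triangle_ineq[of "x - p0" "s *\<^sub>R w"] by (simp add: dist_norm algebra_simps)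
    also have "s * norm w \<le> t0 * (norm w + 1)" using s t by (intro mult_mono) auto
    also have "\<dots> \<le> (d / (2 * (norm w + 1))) * (norm w + 1)" using pos by (intro mult_right_mono) (auto simp: t0_def)
    also have "\<dots> = d / 2" using pos by (simp add: field_simps)
    finally have "dist (x + s *\<^sub>R w) p0 < d" using x by linarith
    then have "(x + s *\<^sub>R w) - s *\<^sub>R w \<notin> H"
      using s t \<open>s \<noteq> 0\<close> by (intro behind) auto
    then show False using x interior_subset by auto
  qed
  \<comment> \<open>Interior starting points tending to \<open>p0\<close> transfer the segment to
    \<open>p0\<close> itself, because \<open>H\<close> is closed.\<close>
  have lim: "p0 + t *\<^sub>R w \<in> H" if "0 \<le> t" "t \<le> t0" for t
  proof -
    obtain x where x: "\<And>n. x n \<in> interior H" "x \<longlonglongrightarrow> p0"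
      using p0 unfolding closure_sequential by blast
    have "eventually (\<lambda>n. dist (x n) p0 < d/2) sequentially"
      using tendstoD[OF x(2) half_gt_zero[OF \<open>d > 0\<close>]] .
    then have "eventually (\<lambda>n. x n + t *\<^sub>R w \<in> H) sequentially"
      using fwd x that by (auto elim: eventually_mono)
    moreover have "(\<lambda>n. x n + t *\<^sub>R w) \<longlonglongrightarrow> p0 + t *\<^sub>R w" by (intro tendsto_intros x)
    ultimately show ?thesis using \<open>closed H\<close> by (metis Lim_in_closed_set trivial_limit_sequentially)
  qed
  obtain c where c: "c \<ge> 0" "\<And>y. y \<in> H \<Longrightarrow> v \<bullet> (y - p0) \<le> c * (norm (y - p0))\<^sup>2"
    using v by (auto simp: proximal_normals_def)
  \<comment> \<open>The proximal inequality at \<open>p0 + t *\<^sub>R w\<close>, divided by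
    \<open>t\<close>, leaves a bound that vanishes with \<open>t\<close>.\<close>
  have "v \<bullet> w \<le> t * (c * (norm w)\<^sup>2)" if "0 < t" "t \<le> t0" for t
  proof -
    have "t * (v \<bullet> w) \<le> t * (t * (c * (norm w)\<^sup>2))"
      using c(2)[OF lim[of t]] that by (simp add: power_mult_distrib power2_eq_square mult_ac)
    then show ?thesis using that by simp
  qed
  then have ev: "eventually (\<lambda>t. v \<bullet> w \<le> t * (c * (norm w)\<^sup>2)) (at_right 0)"
    using t0 unfolding eventually_at_right_field by (meson less_imp_le)
  have "((\<lambda>t. t * (c * (norm w)\<^sup>2)) \<longlongrightarrow> 0 * (c * (norm w)\<^sup>2)) (at_right 0)"
    by (intro tendsto_intros)
  then show ?thesis
    using tendsto_lowerbound[OF _ ev] by auto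
qed

lemma proximal_normals_cone:
  assumes "u \<in> proximal_normals H p" "v \<in> proximal_normals H p" "0 \<le> a" "0 \<le> b"
  shows "a *\<^sub>R u + b *\<^sub>R v \<in> proximal_normals H p"
proof -
  obtain c d where cd: "c \<ge> 0" "\<And>y. y \<in> H \<Longrightarrow> u \<bullet> (y - p) \<le> c * (norm (y - p))\<^sup>2"
     "d \<ge> 0" "\<And>y. y \<in> H \<Longrightarrow> v \<bullet> (y - p) \<le> d * (norm (y - p))\<^sup>2"
    using assms by (auto simp: proximal_normals_def)
  have "(a *\<^sub>R u + b *\<^sub>R v) \<bullet> (y - p) \<le> (a * c + b * d) * (norm (y - p))\<^sup>2" if "y \<in> H" for y
    using mult_left_mono[OF cd(2)[OF that] assms(3)] mult_left_mono[OF cd(4)[OF that] assms(4)]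
    by (simp add: inner_add_left algebra_simps)
  then show ?thesis using cd assms unfolding proximal_normals_def
    by (intro CollectI exI[of _ "a * c + b * d"]) auto
qed

text \<open>Pointedness makes the set of nonzero proximal normals convex. It contains the sphere
  normals, hence also their compact convex hull, which can therefore be strictly separated from
  0.\<close>

lemma pointed_sphere_normals_direction:
  assumes pt: "pointed_cone (proximal_normals H p)" and "\<sigma> \<ge> 0"
  obtains w where "w \<noteq> 0" "\<And>k. k \<in> sphere_normals H \<sigma> p \<Longrightarrow> k \<bullet> w < 0"
proof -
  let ?C = "proximal_normals H p"
  have "convex (?C - {0})"
  proof (rule convexI)
    fix u v :: 'a and a b :: real
    assume uv: "u \<in> ?C - {0}" "v \<in> ?C - {0}" and ab: "0 \<le> a" "0 \<le> b" "a + b = 1"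
    have "a *\<^sub>R u + b *\<^sub>R v \<noteq> 0"
    proof
      assume z: "a *\<^sub>R u + b *\<^sub>R v = 0"
      have 1: "a *\<^sub>R u \<in> ?C" "b *\<^sub>R v \<in> ?C"
        using proximal_normals_cone[of u H p v a 0] proximal_normals_cone[of u H p v 0 b] uv ab by auto
      have "a *\<^sub>R u = - (b *\<^sub>R v)" using z by (simp add: eq_neg_iff_add_eq_0)
      then have "a *\<^sub>R u \<in> ?C \<inter> uminus ` ?C" using 1 by blast
      then have "a *\<^sub>R u = 0" using pt unfolding pointed_cone_def by blast
      then show False using z uv ab by auto
    qed
    then show "a *\<^sub>R u + b *\<^sub>R v \<in> ?C - {0}"
      using proximal_normals_cone[of u H p v a b] uv ab by auto
  qed
  then have "convex hull (sphere_normals H \<sigma> p) \<subseteq> ?C - {0}"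
    using sphere_normals_proximal[OF \<open>\<sigma> \<ge> 0\<close>, of H p]
    by (intro hull_minimal) (auto simp: sphere_normals_def)
  then have "0 \<notin> convex hull (sphere_normals H \<sigma> p)" by blast
  moreover have "closed (convex hull (sphere_normals H \<sigma> p))"
    using compact_sphere_normals compact_convex_hull compact_imp_closed by blast
  ultimately obtain a b where ab: "a \<noteq> 0" "b > 0" "\<And>x. x \<in> convex hull (sphere_normals H \<sigma> p) \<Longrightarrow> a \<bullet> x > b"
    using separating_hyperplane_closed_0[of "convex hull (sphere_normals H \<sigma> p)"] by auto
  show thesis
  proof (rule that[of "- a"])
    show "k \<bullet> - a < 0" if "k \<in> sphere_normals H \<sigma> p" for k
      using ab(3)[OF hull_inc[OF that]] ab(2) by (simp add: inner_commute)
  qed (use ab in simp)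
qed

text \<open>The direction \<open>w\<close> and the constant \<open>\<eta>\<close> found at
  \<open>p0\<close> serve all base points nearby, so that one radius is valid around
  \<open>p0\<close>. Base points lie in \<open>closure (interior H)\<close> because the segments in
  the direction \<open>w\<close> start in the interior.\<close>

theorem exterior_sphere_pointed_imp_realized:
  fixes H :: "'a::euclidean_space set"
  assumes "closed H" and "\<sigma> \<ge> 0" and "\<delta> > 0"
    and sph: "\<And>p. p \<in> frontier H \<Longrightarrow> dist p p0 < \<delta> \<Longrightarrow> sphere_normals H \<sigma> p \<noteq> {}"
    and pt: "pointed_cone (proximal_normals H p0)"
  obtains \<rho> d where "\<rho> > 0" "d > 0"
    "\<And>p v. p \<in> closure (interior H) \<Longrightarrow> dist p p0 < d \<Longrightarrow> v \<in> proximal_normals H p \<Longrightarrow>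
       norm v = 1 \<Longrightarrow> realized_by_ball H p v \<rho>"
proof -
  obtain w where w: "w \<noteq> 0" "\<And>k. k \<in> sphere_normals H \<sigma> p0 \<Longrightarrow> k \<bullet> w < 0"
    using pointed_sphere_normals_direction[OF pt \<open>\<sigma> \<ge> 0\<close>] by blast
  obtain \<eta> \<delta>1 where \<eta>: "\<eta> > 0" "\<delta>1 > 0"
    and neg: "\<And>p k. dist p p0 < \<delta>1 \<Longrightarrow> k \<in> sphere_normals H \<sigma> p \<Longrightarrow> k \<bullet> w \<le> - \<eta>"
    using sphere_normals_uniformly_negative[OF w(2)] by blast
  \<comment> \<open>The estimate below produces \<open>\<sigma> * norm w / \<eta>\<close>; adding 1
    keeps \<open>c\<close> positive when \<open>\<sigma> = 0\<close>.\<close>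
  define c where "c = \<sigma> * norm w / \<eta> + 1"
  have "c > 0" using \<open>\<sigma> \<ge> 0\<close> \<eta> by (auto simp: c_def intro: add_nonneg_pos)
  show thesis
  proof (rule that[of "1 / (2 * c)" "min \<delta>1 (\<delta>/2)"])
    fix p v assume p: "p \<in> closure (interior H)" "dist p p0 < min \<delta>1 (\<delta>/2)"
      and v: "v \<in> proximal_normals H p" "norm v = 1"
    have sph': "sphere_normals H \<sigma> q \<noteq> {}" if "q \<in> frontier H" "dist q p < \<delta> / 2" for q
      using that p dist_triangle[of q p0 p] by (intro sph) auto
    have "v \<bullet> (y - p) \<le> c * (norm (y - p))\<^sup>2" if "y \<in> H" for y
    proof -
      define h where "h = y - p"
      \<comment> \<open>Adding the multiple \<open>\<sigma> * (norm h)\<^sup>2 / \<eta>\<close> of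
        \<open>w\<close> to \<open>h\<close> makes the products with all sphere normals nonpositive;
        the extra \<open>e\<close> makes them strictly negative and is sent to zero
        afterwards.\<close>
      have "v \<bullet> h \<le> (\<sigma> * (norm h)\<^sup>2 / \<eta> + e) * norm w" if "e > 0" for e
      proof -
        define \<theta> where "\<theta> = \<sigma> * (norm h)\<^sup>2 / \<eta> + e"
        have "k \<bullet> (h + \<theta> *\<^sub>R w) < 0" if k: "k \<in> sphere_normals H \<sigma> p" for k
        proof -
          have "k \<bullet> h \<le> \<sigma> * (norm h)\<^sup>2" using k \<open>y \<in> H\<close> by (simp add: sphere_normals_def h_def)
          moreover have "\<theta> * (k \<bullet> w) \<le> \<theta> * - \<eta>"
            using neg[OF _ k] p \<open>e > 0\<close> \<open>\<sigma> \<ge> 0\<close> \<eta> by (intro mult_left_mono) (auto simp: \<theta>_def)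
          moreover have "\<theta> * - \<eta> = - (\<sigma> * (norm h)\<^sup>2) - e * \<eta>" using \<eta> by (simp add: \<theta>_def field_simps)
          moreover have "e * \<eta> > 0" using \<eta> \<open>e > 0\<close> by simp
          ultimately show ?thesis by (simp add: inner_add_right)
        qed
        then have "v \<bullet> (h + \<theta> *\<^sub>R w) \<le> 0"
          using \<open>\<delta> > 0\<close>
          by (intro proximal_normal_nonpositive[OF \<open>closed H\<close> p(1) \<open>\<sigma> \<ge> 0\<close> half_gt_zero sph' _ v(1)]) auto
        then have "v \<bullet> h \<le> \<theta> * - (v \<bullet> w)" by (simp add: inner_add_right)
        also have "\<dots> \<le> \<theta> * norm w"
          using Cauchy_Schwarz_ineq2[of v w] v(2) \<open>e > 0\<close> \<open>\<sigma> \<ge> 0\<close> \<eta>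
          by (intro mult_left_mono) (auto simp: \<theta>_def)
        finally show ?thesis by (simp add: \<theta>_def)
      qed
      then have "v \<bullet> h \<le> (\<sigma> * (norm h)\<^sup>2 / \<eta>) * norm w + e" if "e > 0" for e
        using that w(1) divide_pos_pos[OF that, of "norm w"]
        by (metis (no_types, opaque_lifting) distrib_right nonzero_eq_divide_eq norm_eq_zero zero_less_norm_iff)
      then have "v \<bullet> h \<le> (\<sigma> * (norm h)\<^sup>2 / \<eta>) * norm w" by (rule field_le_epsilon)
      also have "\<dots> \<le> c * (norm h)\<^sup>2" by (simp add: c_def field_simps)
      finally show ?thesis by (simp add: h_def)
    qed
    then show "realized_by_ball H p v (1 / (2 * c))"
      using v \<open>c > 0\<close> by (simp add: realized_by_ball_def)
  qed (use \<open>c > 0\<close> \<eta> \<open>\<delta> > 0\<close> in auto)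
qed

section \<open>Passage to the closure, and continuous radii from local ones\<close>

lemma quadratic_bound_closure:
  fixes p :: "'a::euclidean_space"
  shows "(\<forall>y\<in>closure A. k \<bullet> (y - p) \<le> \<sigma> * (norm (y - p))\<^sup>2) \<longleftrightarrow>
    (\<forall>y\<in>A. k \<bullet> (y - p) \<le> \<sigma> * (norm (y - p))\<^sup>2)"
proof
  assume A: "\<forall>y\<in>A. k \<bullet> (y - p) \<le> \<sigma> * (norm (y - p))\<^sup>2"
  have "closed {y. k \<bullet> (y - p) \<le> \<sigma> * (norm (y - p))\<^sup>2}"
    by (intro closed_Collect_le continuous_intros)
  then have "closure A \<subseteq> {y. k \<bullet> (y - p) \<le> \<sigma> * (norm (y - p))\<^sup>2}"
    using A by (intro closure_minimal) auto
  then show "\<forall>y\<in>closure A. k \<bullet> (y - p) \<le> \<sigma> * (norm (y - p))\<^sup>2" by blast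
qed (use closure_subset in blast)

text \<open>The sphere argument works with a closed set, and the hypograph is not known to be one;
  its normals do not change when it is replaced by its closure.\<close>

lemma proximal_normals_closure: "proximal_normals (closure A) p = proximal_normals A p"
  by (simp add: proximal_normals_def quadratic_bound_closure)

lemma sphere_normals_closure: "sphere_normals (closure A) \<sigma> p = sphere_normals A \<sigma> p"
  by (simp add: sphere_normals_def quadratic_bound_closure)

text \<open>\<open>\<phi> x\<close> is the supremum of the \<open>d\<close> such that \<open>d\<close> works on the ball of radius \<open>d\<close> around \<open>x\<close>;
  this function is Lipschitz with constant 1.\<close>

lemma continuous_radius_from_local:
  fixes D :: "'a::metric_space set" and P :: "'a \<Rightarrow> real \<Rightarrow> bool"
  assumes mono: "\<And>x \<rho> \<rho>'. P x \<rho> \<Longrightarrow> 0 < \<rho>' \<Longrightarrow> \<rho>' \<le> \<rho> \<Longrightarrow> P x \<rho>'"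
    and lim: "\<And>x \<rho>. 0 < \<rho> \<Longrightarrow> (\<And>\<rho>'. 0 < \<rho>' \<Longrightarrow> \<rho>' < \<rho> \<Longrightarrow> P x \<rho>') \<Longrightarrow> P x \<rho>"
    and loc: "\<And>x. x \<in> D \<Longrightarrow> \<exists>d>0. \<exists>\<rho>>0. \<forall>y\<in>D. dist y x < d \<longrightarrow> P y \<rho>"
  shows "\<exists>\<phi>. continuous_on D \<phi> \<and> (\<forall>x\<in>D. \<phi> x > (0::real)) \<and> (\<forall>x\<in>D. P x (\<phi> x))"
proof -
  \<comment> \<open>The same \<open>d\<close> is the size of the neighbourhood and the radius in
    \<open>P\<close>, so moving the centre by a distance \<open>s\<close> costs at most
    \<open>s\<close>. The cap at 1 keeps the supremum finite.\<close>
  define A where "A x = {d. 0 < d \<and> d \<le> 1 \<and> (\<forall>y\<in>D. dist y x < d \<longrightarrow> P y d)}" for x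
  define \<phi> where "\<phi> x = Sup (A x)" for x
  have bdd: "bdd_above (A x)" for x by (auto simp: A_def intro!: bdd_aboveI[of _ 1])
  have ne: "A x \<noteq> {}" if x: "x \<in> D" for x
  proof -
    obtain d \<rho> where d: "d > 0" "\<rho> > 0" "\<And>y. y \<in> D \<Longrightarrow> dist y x < d \<Longrightarrow> P y \<rho>" using loc[OF x] by blast
    then have "min 1 (min d \<rho>) \<in> A x" by (auto simp: A_def intro: mono[of _ \<rho>])
    then show ?thesis by blast
  qed
  have pos: "\<phi> x > 0" if "x \<in> D" for x
    using ne[OF that] cSup_upper[OF _ bdd, of _ x] unfolding \<phi>_def A_def by force
  \<comment> \<open>The supremum may not be attained; \<open>P\<close> holds for every smaller
    radius, and \<open>lim\<close> closes the gap.\<close>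
  have good: "P x (\<phi> x)" if x: "x \<in> D" for x
  proof (rule lim[OF pos[OF x]])
    fix \<rho>' assume r: "0 < \<rho>'" "\<rho>' < \<phi> x"
    then obtain d where "d \<in> A x" "\<rho>' < d" using less_cSup_iff[OF ne[OF x] bdd] by (auto simp: \<phi>_def)
    then show "P x \<rho>'" using x r by (auto simp: A_def intro: mono[of _ d])
  qed
  have lip: "\<phi> x \<le> \<phi> y + dist x y" if xy: "x \<in> D" "y \<in> D" for x y
    unfolding \<phi>_def
  proof (rule cSup_least[OF ne[OF xy(1)]])
    fix d assume d: "d \<in> A x"
    show "d \<le> Sup (A y) + dist x y"
    proof (cases "d - dist x y > 0")
      case True
      have "P z (d - dist x y)" if "z \<in> D" "dist z y < d - dist x y" for z
      proof (rule mono[of _ d])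
        have "dist z x < d" using that dist_triangle[of z x y] by (simp add: dist_commute)
        then show "P z d" using d that by (simp add: A_def)
      qed (use True in auto)
      moreover have "d - dist x y \<le> 1" using d zero_le_dist[of x y] unfolding A_def mem_Collect_eq by linarith
      ultimately have "d - dist x y \<in> A y" using True by (simp add: A_def)
      then show ?thesis using cSup_upper[OF _ bdd] by fastforce
    next
      case False
      then show ?thesis using pos[OF xy(2)] by (simp add: \<phi>_def)
    qed
  qed
  have "continuous_on D \<phi>"
    unfolding continuous_on_iff
  proof (intro ballI allI impI)
    fix x and e :: real assume "x \<in> D" "e > 0"
    then show "\<exists>d>0. \<forall>x'\<in>D. dist x' x < d \<longrightarrow> dist (\<phi> x') (\<phi> x) < e"
      using lip[of x] lip[of _ x] by (intro exI[of _ e]) (fastforce simp: dist_real_def dist_commute abs_less_iff)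
  qed
  then show ?thesis using pos good by blast
qed

section \<open>Semiconcave functions\<close>

text \<open>A hyperplane that separates \<open>(x, h x)\<close> from the strict epigraph is the
  graph of an affine minorant, provided that it is not vertical.\<close>

lemma convex_subgradient_exists:
  fixes h :: "'a::euclidean_space \<Rightarrow> real"
  assumes "open S" "convex S"
    and conv: "\<And>x y l. x \<in> S \<Longrightarrow> y \<in> S \<Longrightarrow> 0 \<le> l \<Longrightarrow> l \<le> 1 \<Longrightarrow>
      h ((1 - l) *\<^sub>R x + l *\<^sub>R y) \<le> (1 - l) * h x + l * h y"
    and x: "x \<in> S"
  shows "\<exists>a. \<forall>y\<in>S. h x + a \<bullet> (y - x) \<le> h y"
proof -
  define E where "E = {(y, t). y \<in> S \<and> h y < t}"
  have "convex E"
    unfolding convex_alt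
  proof (intro ballI allI impI)
    fix p q :: "'a \<times> real" and l :: real
    assume pq: "p \<in> E" "q \<in> E" and l: "0 \<le> l \<and> l \<le> 1"
    obtain y t z s where p: "p = (y, t)" and q: "q = (z, s)" by (metis surj_pair)
    have m: "y \<in> S" "h y < t" "z \<in> S" "h z < s" using pq p q by (auto simp: E_def)
    have "(1 - l) *\<^sub>R y + l *\<^sub>R z \<in> S" using \<open>convex S\<close> m l by (auto simp: convex_alt)
    moreover have "(1 - l) * h y + l * h z < (1 - l) * t + l * s"
    proof (cases "l = 0")
      case False
      then show ?thesis using m l by (intro add_le_less_mono mult_left_mono mult_strict_left_mono) auto
    qed (use m in simp)
    ultimately show "(1 - l) *\<^sub>R p + l *\<^sub>R q \<in> E"
      using conv[OF m(1,3)] l p q by (force simp: E_def)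
  qed
  moreover have "(x, h x + 1) \<in> E" using x by (simp add: E_def)
  then have "E \<noteq> {}" by blast
  moreover have "{(x, h x)} \<inter> E = {}" by (simp add: E_def)
  ultimately obtain a b where ab: "a \<noteq> 0" "a \<bullet> (x, h x) \<le> b" "\<forall>q\<in>E. b \<le> a \<bullet> q"
    using separating_hyperplane_sets[of "{(x, h x)}" E] by auto
  obtain \<alpha> s where a: "a = (\<alpha>, s)" by fastforce
  have sep: "\<alpha> \<bullet> x + s * h x \<le> \<alpha> \<bullet> y + s * t" if "y \<in> S" "h y < t" for y t
  proof -
    have "b \<le> a \<bullet> (y, t)" using ab(3) that by (auto simp: E_def)
    then show ?thesis using ab(2) a by simp
  qed
  have "s \<ge> 0" using sep[OF x, of "h x + 1"] by (simp add: algebra_simps)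
  \<comment> \<open>A vertical hyperplane would leave a whole ball around \<open>x\<close> on one
    side of a hyperplane through \<open>x\<close>.\<close>
  have "s \<noteq> 0"
  proof
    assume "s = 0"
    then have "\<alpha> \<noteq> 0" using ab(1) a by (auto simp: zero_prod_def)
    have le: "\<alpha> \<bullet> x \<le> \<alpha> \<bullet> y" if "y \<in> S" for y
      using sep[OF that, of "h y + 1"] \<open>s = 0\<close> by simp
    obtain e where e: "e > 0" "ball x e \<subseteq> S" using \<open>open S\<close> x open_contains_ball by blast
    define y where "y = x - (e / (2 * norm \<alpha>)) *\<^sub>R \<alpha>"
    have "y \<in> ball x e" using e \<open>\<alpha> \<noteq> 0\<close> by (simp add: y_def dist_norm)
    then have "\<alpha> \<bullet> x \<le> \<alpha> \<bullet> y" using e le by blast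
    then have "(e / (2 * norm \<alpha>)) * (\<alpha> \<bullet> \<alpha>) \<le> 0" by (simp add: y_def inner_diff_right)
    moreover have "(e / (2 * norm \<alpha>)) * (\<alpha> \<bullet> \<alpha>) > 0" using e \<open>\<alpha> \<noteq> 0\<close> by (intro mult_pos_pos) auto
    ultimately show False by simp
  qed
  then have "s > 0" using \<open>s \<ge> 0\<close> by simp
  have "h x + (- (1 / s) *\<^sub>R \<alpha>) \<bullet> (y - x) \<le> h y" if y: "y \<in> S" for y
  proof -
    have "\<alpha> \<bullet> x + s * h x \<le> \<alpha> \<bullet> y + s * h y + e" if "e > 0" for e
      using sep[OF y, of "h y + e / s"] that \<open>s > 0\<close> by (simp add: algebra_simps)
    then have "\<alpha> \<bullet> x + s * h x \<le> \<alpha> \<bullet> y + s * h y" by (rule field_le_epsilon)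
    moreover have "(- (1 / s) *\<^sub>R \<alpha>) \<bullet> (y - x) = (\<alpha> \<bullet> x - \<alpha> \<bullet> y) / s"
      by (simp add: inner_diff_right diff_divide_distrib)
    moreover have "h x + (\<alpha> \<bullet> x - \<alpha> \<bullet> y) / s = (\<alpha> \<bullet> x + s * h x - \<alpha> \<bullet> y) / s"
      using \<open>s > 0\<close> by (simp add: add_divide_distrib diff_divide_distrib)
    ultimately show ?thesis using \<open>s > 0\<close> by (simp add: pos_divide_le_eq mult.commute)
  qed
  then show ?thesis by blast
qed

text \<open>Semiconcavity means that \<open>c * (norm y)\<^sup>2 - g y\<close> is convex, and a
  subgradient of this function yields the supergradient \<open>p\<close>. Halving the radius makes
  the model valid on a ball of fixed size around every nearby \<open>x\<close>.\<close>

lemma locally_semiconcave_upper_model: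
  assumes "locally_semiconcave g"
  obtains e c where "e > 0" "c > 0"
    "\<And>x. x \<in> ball z e \<Longrightarrow> \<exists>p. \<forall>y\<in>ball x e. g y \<le> g x + p \<bullet> (y - x) + c * (norm (y - x))\<^sup>2"
proof -
  obtain e c where e: "e > 0" "c > 0" and sc: "\<And>x0 x1 l. x0 \<in> ball z e \<Longrightarrow> x1 \<in> ball z e \<Longrightarrow> l \<in> {0..1} \<Longrightarrow>
        (1 - l) * g x0 + l * g x1 - g ((1 - l) *\<^sub>R x0 + l *\<^sub>R x1) \<le> c * l * (1 - l) * (norm (x0 - x1))\<^sup>2"
    using assms unfolding locally_semiconcave_def by meson
  define h where "h y = c * (norm y)\<^sup>2 - g y" for y
  have conv: "h ((1 - l) *\<^sub>R x + l *\<^sub>R y) \<le> (1 - l) * h x + l * h y"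
    if "x \<in> ball z e" "y \<in> ball z e" "0 \<le> l" "l \<le> 1" for x y l
  proof -
    have "(norm ((1 - l) *\<^sub>R x + l *\<^sub>R y))\<^sup>2 = (1 - l) * (norm x)\<^sup>2 + l * (norm y)\<^sup>2 - l * (1 - l) * (norm (x - y))\<^sup>2"
      unfolding power2_norm_eq_inner by (simp add: algebra_simps inner_commute power2_eq_square)
    then have eq: "c * (norm ((1 - l) *\<^sub>R x + l *\<^sub>R y))\<^sup>2 =
        (1 - l) * (c * (norm x)\<^sup>2) + l * (c * (norm y)\<^sup>2) - c * l * (1 - l) * (norm (x - y))\<^sup>2"
      by (simp only:) (simp add: algebra_simps)
    show ?thesis using sc[OF that(1,2), of l] that unfolding h_def eq
      by (simp add: right_diff_distrib)
  qed
  show thesis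
  proof (rule that[of "e/2" c])
    fix x assume x: "x \<in> ball z (e/2)"
    then have "x \<in> ball z e" using e by simp
    then have "\<exists>a. \<forall>y\<in>ball z e. h x + a \<bullet> (y - x) \<le> h y"
      by (intro convex_subgradient_exists[OF open_ball convex_ball conv])
    then obtain a where a: "\<And>y. y \<in> ball z e \<Longrightarrow> h x + a \<bullet> (y - x) \<le> h y" by blast
    have "g y \<le> g x + (2 * c) *\<^sub>R x \<bullet> (y - x) - a \<bullet> (y - x) + c * (norm (y - x))\<^sup>2" if "y \<in> ball x (e/2)" for y
    proof -
      have "y \<in> ball z e" using that x dist_triangle[of z y x] by simp
      then have "g y \<le> g x + c * ((norm y)\<^sup>2 - (norm x)\<^sup>2) - a \<bullet> (y - x)"
        using a[of y] by (simp add: h_def algebra_simps)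
      moreover have "(norm y)\<^sup>2 - (norm x)\<^sup>2 = 2 * (x \<bullet> (y - x)) + (norm (y - x))\<^sup>2"
        unfolding power2_norm_eq_inner by (simp add: algebra_simps inner_commute)
      ultimately show ?thesis by (simp add: algebra_simps)
    qed
    then show "\<exists>p. \<forall>y\<in>ball x (e/2). g y \<le> g x + p \<bullet> (y - x) + c * (norm (y - x))\<^sup>2"
      by (intro exI[of _ "(2 * c) *\<^sub>R x - a"]) (simp add: inner_diff_left add_diff_eq)
  qed (use e in auto)
qed

text \<open>The radius of the exterior spheres will depend on \<open>e\<close> and \<open>c\<close>,
  so they must be common to all end points of trajectories; a finite subcover provides this.\<close>

lemma locally_semiconcave_upper_model_compact:
  assumes "locally_semiconcave g" and "compact K"
  obtains e c where "e > 0" "c > 0"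
    "\<And>x. x \<in> K \<Longrightarrow> \<exists>p. \<forall>y\<in>ball x e. g y \<le> g x + p \<bullet> (y - x) + c * (norm (y - x))\<^sup>2"
proof -
  have "\<exists>e c. e > 0 \<and> c > 0 \<and> (\<forall>x\<in>ball z e. \<exists>p. \<forall>y\<in>ball x e. g y \<le> g x + p \<bullet> (y - x) + c * (norm (y - x))\<^sup>2)" for z
    using locally_semiconcave_upper_model[OF assms(1), of z] by metis
  then obtain E C where EC: "\<And>z. E z > 0" "\<And>z. C z > (0::real)"
    "\<And>z x. x \<in> ball z (E z) \<Longrightarrow> \<exists>p. \<forall>y\<in>ball x (E z). g y \<le> g x + p \<bullet> (y - x) + C z * (norm (y - x))\<^sup>2"
    by metis
  obtain F where F: "F \<subseteq> K" "finite F" "K \<subseteq> (\<Union>z\<in>F. ball z (E z))"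
    using compactE_image[OF assms(2), of K "\<lambda>z. ball z (E z)"] EC(1) by (force simp del: mem_ball)
  define e where "e = Min (insert 1 (E ` F))"
  define c where "c = Max (insert 1 (C ` F))"
  have "e > 0" using F EC by (simp add: e_def)
  moreover have "c \<ge> 1" using F by (simp add: c_def)
  moreover have "\<exists>p. \<forall>y\<in>ball x e. g y \<le> g x + p \<bullet> (y - x) + c * (norm (y - x))\<^sup>2" if xK: "x \<in> K" for x
  proof -
    obtain z where z: "z \<in> F" "x \<in> ball z (E z)" using F(3) xK by blast
    obtain p where p: "\<And>y. y \<in> ball x (E z) \<Longrightarrow> g y \<le> g x + p \<bullet> (y - x) + C z * (norm (y - x))\<^sup>2"
      using EC(3)[OF z(2)] by blast
    have "e \<le> E z" "C z \<le> c" using F z by (auto simp: e_def c_def)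
    have "g y \<le> g x + p \<bullet> (y - x) + c * (norm (y - x))\<^sup>2" if "y \<in> ball x e" for y
      using p[of y] that \<open>e \<le> E z\<close> mult_right_mono[OF \<open>C z \<le> c\<close>, of "(norm (y - x))\<^sup>2"] by simp
    then show ?thesis by blast
  qed
  ultimately show thesis by (intro that[of e c]) auto
qed

text \<open>\<open>\<theta>\<close> is the smallest weight for which the maximum over \<open>U\<close> is nonnegative.\<close>

lemma balanced_weight_exists:
  fixes a b :: "'u::euclidean_space \<Rightarrow> real"
  assumes "compact U" and cont: "continuous_on U a" "continuous_on U b"
    and b: "\<And>\<omega>. \<omega> \<in> U \<Longrightarrow> b \<omega> > 0" and a: "\<omega>0 \<in> U" "a \<omega>0 \<ge> 0"
  obtains \<theta> \<omega>1 where "0 \<le> \<theta>" "\<theta> \<le> 1" "\<omega>1 \<in> U" "\<theta> * a \<omega>1 - (1 - \<theta>) * b \<omega>1 \<ge> 0"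
    "\<And>\<omega>. \<omega> \<in> U \<Longrightarrow> \<theta> * a \<omega> - (1 - \<theta>) * b \<omega> \<le> 0"
proof -
  define H where "H = (\<lambda>(\<theta>, \<omega>). \<theta> * a \<omega> - (1 - \<theta>) * b \<omega>)"
  define A where "A = {z \<in> {0..1} \<times> U. 0 \<le> H z}"
  have "continuous_on ({0..1} \<times> U) H" unfolding H_def split_def
    by (intro continuous_intros continuous_on_compose2[OF cont(1)] continuous_on_compose2[OF cont(2)]) auto
  then have "closed A"
    unfolding A_def using compact_imp_closed[OF \<open>compact U\<close>]
    by (intro continuous_on_closed_Collect_le continuous_intros closed_Times) auto
  moreover have "bounded ({0..1::real} \<times> U)"
    by (intro compact_imp_bounded compact_Times compact_Icc \<open>compact U\<close>)
  then have "bounded A" by (rule bounded_subset) (auto simp: A_def)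
  moreover have "(1, \<omega>0) \<in> A" using a by (simp add: A_def H_def)
  ultimately have "\<exists>z\<in>A. \<forall>y\<in>A. fst z \<le> fst y"
    by (intro continuous_attains_inf) (auto simp: compact_eq_bounded_closed intro!: continuous_on_fst continuous_on_id)
  then obtain z where z: "z \<in> A" "\<And>y. y \<in> A \<Longrightarrow> fst z \<le> fst y" by blast
  obtain \<theta> \<omega>1 where z': "z = (\<theta>, \<omega>1)" by fastforce
  show thesis
  proof (rule that[of \<theta> \<omega>1])
    show "0 \<le> \<theta>" "\<theta> \<le> 1" "\<omega>1 \<in> U" "\<theta> * a \<omega>1 - (1 - \<theta>) * b \<omega>1 \<ge> 0"
      using z(1) z' by (auto simp: A_def H_def)
    fix \<omega> assume \<omega>: "\<omega> \<in> U"
    show "\<theta> * a \<omega> - (1 - \<theta>) * b \<omega> \<le> 0"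
    proof (rule ccontr)
      assume pos: "\<not> ?thesis"
      \<comment> \<open>If the expression were positive at \<open>\<omega>\<close>, the smaller
        weight \<open>b \<omega> / s\<close> would already make it zero there, against the
        minimality of \<open>\<theta>\<close>.\<close>
      define s where "s = a \<omega> + b \<omega>"
      have sp: "s * \<theta> > b \<omega>" using pos by (simp add: s_def algebra_simps)
      then have "s * \<theta> > 0" using b[OF \<omega>] by simp
      then have "s > 0" "\<theta> > 0" using \<open>0 \<le> \<theta>\<close> by (auto simp: zero_less_mult_iff)
      define \<theta>' where "\<theta>' = b \<omega> / s"
      have "\<theta>' < \<theta>" using sp \<open>s > 0\<close> by (simp add: \<theta>'_def field_simps)
      moreover have "0 \<le> \<theta>'" using b[OF \<omega>] \<open>s > 0\<close> by (simp add: \<theta>'_def)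
      moreover have "H (\<theta>', \<omega>) = \<theta>' * s - b \<omega>" by (simp add: H_def s_def algebra_simps)
      then have "H (\<theta>', \<omega>) = 0" using \<open>s > 0\<close> by (simp add: \<theta>'_def)
      ultimately have "(\<theta>', \<omega>) \<in> A" using \<omega> \<open>\<theta> \<le> 1\<close> by (simp add: A_def)
      then show False using z(2) z' \<open>\<theta>' < \<theta>\<close> by fastforce
    qed
  qed
qed

text \<open>Moving from \<open>x\<close> a distance \<open>t\<close> against \<open>p\<close> lowers
  the model by \<open>t * norm p\<close> up to order \<open>t\<^sup>2\<close>, while
  \<open>g\<close> can fall by at most \<open>G * t\<close>. The bound ensures that
  \<open>r + p \<bullet> f\<close> stays positive.\<close>

lemma supergradient_norm_le:
  fixes g :: "'a::euclidean_space \<Rightarrow> real"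
  assumes "open W" "x \<in> W" and lip: "\<And>y. y \<in> W \<Longrightarrow> \<bar>g y - g x\<bar> \<le> G * norm (y - x)"
    and p: "\<And>y. y \<in> ball x e \<Longrightarrow> g y \<le> g x + p \<bullet> (y - x) + c * (norm (y - x))\<^sup>2"
    and "e > 0" "c \<ge> 0" "G \<ge> 0"
  shows "norm p \<le> G"
proof (cases "p = 0")
  case False
  then have np: "norm p > 0" by simp
  obtain d where d: "d > 0" "ball x d \<subseteq> W" using assms(1,2) open_contains_ball by blast
  show ?thesis
  proof (rule field_le_epsilon)
    fix \<epsilon> :: real assume "\<epsilon> > 0"
    define t where "t = min (min (d / 2) (e / 2)) (\<epsilon> / (c + 1))"
    have t: "0 < t" "t < d" "t < e" "t \<le> \<epsilon> / (c + 1)"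
      using d \<open>e > 0\<close> \<open>\<epsilon> > 0\<close> \<open>c \<ge> 0\<close> by (auto simp: t_def)
    define y where "y = x - (t / norm p) *\<^sub>R p"
    have n: "norm (y - x) = t" using t np by (simp add: y_def)
    have yW: "y \<in> W" using d t n by (auto simp: dist_norm norm_minus_commute)
    have ye: "y \<in> ball x e" using t n by (simp add: dist_norm norm_minus_commute)
    have "p \<bullet> (y - x) = - (t * norm p)"
      using np by (simp add: y_def dot_square_norm power2_eq_square)
    then have "g y \<le> g x - t * norm p + c * t\<^sup>2" using p[OF ye] n by simp
    moreover have "g x - G * t \<le> g y" using lip[OF yW, unfolded n] by linarith
    ultimately have "t * norm p \<le> t * (G + c * t)" by (simp add: power2_eq_square algebra_simps)
    then have "norm p \<le> G + c * t" using t by simp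
    also have "c * t \<le> (c + 1) * t" using t by simp
    also have "\<dots> \<le> \<epsilon>" using t(4) \<open>c \<ge> 0\<close> by (simp add: field_simps)
    finally show "norm p \<le> G + \<epsilon>" by simp
  qed
qed (use assms in simp)

section \<open>Controlled trajectories\<close>

locale control_system =
  fixes f :: "'a::euclidean_space \<Rightarrow> 'u::euclidean_space \<Rightarrow> 'a" and U :: "'u set" and N L :: real
  assumes compact_U: "compact U" and U_nonempty: "U \<noteq> {}"
    and f_cont: "continuous_on (UNIV \<times> U) (\<lambda>(x, \<omega>). f x \<omega>)"
    and f_bound: "\<And>x \<omega>. \<omega> \<in> U \<Longrightarrow> norm (f x \<omega>) \<le> N"
    and f_lip: "\<And>x y \<omega>. \<omega> \<in> U \<Longrightarrow> norm (f y \<omega> - f x \<omega>) \<le> L * norm (y - x)"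
    and L_nonneg: "L \<ge> 0"
begin

lemma N_nonneg: "N \<ge> 0"
  using U_nonempty f_bound norm_ge_zero order_trans by blast

lemma control_in_U: "admissible_control U u \<Longrightarrow> 0 \<le> t \<Longrightarrow> u t \<in> U"
  by (simp add: admissible_control_def)

lemma dynamics_integrable:
  "admissible_control U u \<Longrightarrow> continuous_on {0..t} w \<Longrightarrow> (\<lambda>s. f (w s) (u s)) integrable_on {0..t}"
  using control_composition_integrable[OF compact_U f_cont] set_lebesgue_integral_eq_integral(1) by blast

lemma caratheodory_has_integral:
  assumes "caratheodory_solution f x u y" "0 \<le> t"
  shows "((\<lambda>s. f (y s) (u s)) has_integral (y t - x)) {0..t}"
proof (cases "t = 0")
  case True
  then show ?thesis using assms by (simp add: caratheodory_solution_def has_integral_refl)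
next
  case False
  then have "t > 0" using assms by simp
  have y: "y 0 = x" "abs_continuous_on 0 t y"
    and ae: "AE s in lebesgue_on {0..}. (y has_vector_derivative f (y s) (u s)) (at s within {0..})"
    using assms \<open>t > 0\<close> by (auto simp: caratheodory_solution_def)
  have "AE s in lebesgue. s \<in> {0..} \<longrightarrow> (y has_vector_derivative f (y s) (u s)) (at s within {0..})"
    using ae by (simp add: AE_restrict_space_iff)
  then obtain Z where Z: "negligible Z"
    "\<And>s. s \<notin> Z \<Longrightarrow> 0 \<le> s \<Longrightarrow> (y has_vector_derivative f (y s) (u s)) (at s within {0..})"
    unfolding eventually_ae_filter negligible_iff_null_sets by auto
  have "(y has_vector_derivative f (y s) (u s)) (at s within {0..t})" if "s \<in> {0..t} - Z" for s
    by (rule has_vector_derivative_within_subset[OF Z(2)]) (use that in auto)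
  then show ?thesis
    using abs_continuous_has_integral[OF less_imp_le[OF \<open>t > 0\<close>] y(2) Z(1)] y(1) by simp
qed

text \<open>Together with \<open>caratheodory_has_integral\<close> this allows the integral equation
  to replace the differential equation throughout. The exceptional null sets are collected over the
  intervals from 0 to \<open>n\<close>.\<close>

lemma has_integral_caratheodory:
  assumes y: "\<And>t. 0 \<le> t \<Longrightarrow> ((\<lambda>s. f (y s) (u s)) has_integral (y t - x)) {0..t}"
    and u: "admissible_control U u"
  shows "caratheodory_solution f x u y"
proof -
  have "((\<lambda>s. f (y s) (u s)) has_integral 0) {0..0}" by (rule has_integral_null_real) simp
  then have y0: "y 0 = x" using has_integral_unique[OF y[OF order_refl]] by fastforce
  have bnd: "norm (f (y s) (u s)) \<le> N" if "0 \<le> s" for s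
    using f_bound control_in_U[OF u that] by blast
  have ac: "abs_continuous_on 0 T y" for T
  proof (rule lipschitz_imp_abs_continuous_on[OF _ N_nonneg])
    show "norm (y t - y s) \<le> N * (t - s)" if "0 \<le> s" "s \<le> t" "t \<le> T" for s t
      using that by (intro has_integral_lipschitz(1)[where T = T and h = "\<lambda>s. f (y s) (u s)"])
        (auto simp: y0 intro: y bnd)
  qed
  have "\<exists>Z. negligible Z \<and> (\<forall>s\<in>{0<..<real n} - Z. (y has_vector_derivative f (y s) (u s)) (at s))" for n
    by (rule indefinite_integral_derivative_AE) (simp add: y0 y)
  then obtain Z where Z: "\<And>n. negligible (Z n)"
    "\<And>n s. s \<in> {0<..<real n} - Z n \<Longrightarrow> (y has_vector_derivative f (y s) (u s)) (at s)"
    by metis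
  have "negligible (insert 0 (\<Union>n. Z n))" using Z(1) by (simp add: negligible_Union_nat)
  moreover have "(y has_vector_derivative f (y s) (u s)) (at s within {0..})"
    if s: "s \<notin> insert 0 (\<Union>n. Z n)" "0 \<le> s" for s
  proof -
    obtain n where "s < real n" using reals_Archimedean2 by blast
    then have "(y has_vector_derivative f (y s) (u s)) (at s)" using s by (intro Z(2)[of s n]) auto
    then show ?thesis by (rule has_vector_derivative_at_within)
  qed
  ultimately have "AE s in lebesgue. s \<in> {0..} \<longrightarrow> (y has_vector_derivative f (y s) (u s)) (at s within {0..})"
    unfolding eventually_ae_filter negligible_iff_null_sets by (intro bexI[of _ "insert 0 (\<Union>n. Z n)"]) auto
  then show ?thesis using y0 ac by (simp add: caratheodory_solution_def AE_restrict_space_iff)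
qed

lemma caratheodory_solution_exists:
  assumes u: "admissible_control U u"
  shows "\<exists>y. caratheodory_solution f x u y"
proof (rule picard_integral_equation[of "{0..}" "\<lambda>s p. f p (u s)" L x N])
  fix y :: "real \<Rightarrow> 'a"
  assume "\<And>t. t \<in> {0..} \<Longrightarrow> ((\<lambda>s. f (y s) (u s)) has_integral (y t - x)) {0..t}"
  then have "caratheodory_solution f x u y" by (intro has_integral_caratheodory[OF _ u]) simp
  then show ?thesis by blast
next
  fix s t :: real and p q :: 'a and w :: "real \<Rightarrow> 'a"
  show "t \<in> {0..} \<Longrightarrow> 0 \<le> t" "t \<in> {0..} \<Longrightarrow> 0 \<le> s \<Longrightarrow> s \<le> t \<Longrightarrow> s \<in> {0..}" by simp_all
  show "continuous_on {0..t} w \<Longrightarrow> (\<lambda>s. f (w s) (u s)) integrable_on {0..t}"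
    by (rule dynamics_integrable[OF u])
  show "norm (f p (u s) - f q (u s)) \<le> L * norm (p - q)" "norm (f x (u s)) \<le> N" if "s \<in> {0..}"
    using control_in_U[OF u, of s] that by (auto intro!: f_lip f_bound)
qed (rule L_nonneg)

context
  fixes x :: 'a and u :: "real \<Rightarrow> 'u" assumes u: "admissible_control U u"
begin

lemma trajectory_caratheodory: "caratheodory_solution f x u (trajectory f x u)"
  unfolding trajectory_def by (rule someI_ex[OF caratheodory_solution_exists[OF u]])

lemma trajectory_0: "trajectory f x u 0 = x"
  using trajectory_caratheodory by (simp add: caratheodory_solution_def)

lemma trajectory_has_integral:
  "0 \<le> t \<Longrightarrow> ((\<lambda>s. f (trajectory f x u s) (u s)) has_integral (trajectory f x u t - x)) {0..t}"
  by (rule caratheodory_has_integral[OF trajectory_caratheodory])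

lemma trajectory_lipschitz:
  assumes "0 \<le> s" "s \<le> t"
  shows "norm (trajectory f x u t - trajectory f x u s) \<le> N * (t - s)"
    and "((\<lambda>s. f (trajectory f x u s) (u s)) has_integral (trajectory f x u t - trajectory f x u s)) {s..t}"
proof -
  have 1: "((\<lambda>s. f (trajectory f x u s) (u s)) has_integral (trajectory f x u r - trajectory f x u 0)) {0..r}"
    if "r \<in> {0..t}" for r
    using trajectory_has_integral[of r] that by (simp add: trajectory_0)
  have 2: "norm (f (trajectory f x u r) (u r)) \<le> N" if "r \<in> {0..t}" for r
    using control_in_U[OF u, of r] that by (simp add: f_bound)
  show "norm (trajectory f x u t - trajectory f x u s) \<le> N * (t - s)"
    using has_integral_lipschitz(1)[where T = t, OF 1 2 assms order_refl] by simp
  show "((\<lambda>s. f (trajectory f x u s) (u s)) has_integral (trajectory f x u t - trajectory f x u s)) {s..t}"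
    using has_integral_lipschitz(2)[where T = t, OF 1 2 assms order_refl] by simp
qed

lemma trajectory_continuous: "continuous_on {0..} (trajectory f x u)"
proof (rule continuous_on_subset[OF _ order_refl])
  have "N-lipschitz_on {0..} (trajectory f x u)"
  proof (rule lipschitz_onI[OF _ N_nonneg])
    show "dist (trajectory f x u s) (trajectory f x u t) \<le> N * dist s t" if "s \<in> {0..}" "t \<in> {0..}" for s t
      using trajectory_lipschitz(1)[of s t] trajectory_lipschitz(1)[of t s] that
      by (cases "s \<le> t") (auto simp: dist_norm norm_minus_commute abs_if)
  qed
  then show "continuous_on {0..} (trajectory f x u)" by (rule lipschitz_on_continuous_on)
qed

lemma trajectory_continuous_on: "continuous_on {0..t} (trajectory f x u)"
  using trajectory_continuous by (rule continuous_on_subset) auto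

end

text \<open>Gronwall's inequality. The controls agree only up to \<open>T\<close>, because the
  control of the perturbed trajectory will be changed after that time.\<close>

lemma trajectory_dependence:
  assumes u: "admissible_control U u" "admissible_control U u'"
    and agree: "\<And>s. 0 \<le> s \<Longrightarrow> s \<le> T \<Longrightarrow> u' s = u s" and t: "0 \<le> t" "t \<le> T"
  shows "norm (trajectory f z u' t - trajectory f x u t) \<le> norm (z - x) * exp (L * t)"
proof (rule gronwall_integral[where T = T and \<phi> = "\<lambda>t. norm (trajectory f z u' t - trajectory f x u t)"])
  show cont: "continuous_on {0..T} (\<lambda>t. norm (trajectory f z u' t - trajectory f x u t))"
    by (intro continuous_intros trajectory_continuous_on u)
  show "norm (trajectory f z u' t - trajectory f x u t) \<le>
      norm (z - x) + L * integral {0..t} (\<lambda>t. norm (trajectory f z u' t - trajectory f x u t))"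
    if t: "t \<in> {0..T}" for t
  proof -
    let ?D = "\<lambda>s. f (trajectory f z u' s) (u' s) - f (trajectory f x u s) (u s)"
    have c: "continuous_on {0..t} (\<lambda>t. norm (trajectory f z u' t - trajectory f x u t))"
      using cont by (rule continuous_on_subset) (use t in auto)
    have hi: "(?D has_integral ((trajectory f z u' t - z) - (trajectory f x u t - x))) {0..t}"
      using t by (intro has_integral_diff trajectory_has_integral u) auto
    have "norm (integral {0..t} ?D) \<le>
        integral {0..t} (\<lambda>s. L * norm (trajectory f z u' s - trajectory f x u s))"
    proof (rule integral_norm_bound_integral)
      show "?D integrable_on {0..t}" using hi by blast
      show "(\<lambda>s. L * norm (trajectory f z u' s - trajectory f x u s)) integrable_on {0..t}"
        by (intro integrable_continuous_real continuous_intros c)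
      show "norm (?D s) \<le> L * norm (trajectory f z u' s - trajectory f x u s)" if "s \<in> {0..t}" for s
        using that t agree[of s] control_in_U[OF u(1), of s] by (simp add: f_lip)
    qed
    then have "norm ((trajectory f z u' t - z) - (trajectory f x u t - x)) \<le>
        L * integral {0..t} (\<lambda>s. norm (trajectory f z u' s - trajectory f x u s))"
      using integral_unique[OF hi] by simp
    moreover have "norm (trajectory f z u' t - trajectory f x u t) \<le>
        norm (z - x) + norm ((trajectory f z u' t - z) - (trajectory f x u t - x))"
      using norm_triangle_ineq[of "z - x" "(trajectory f z u' t - z) - (trajectory f x u t - x)"] by simp
    ultimately show ?thesis by linarith
  qed
qed (use t L_nonneg in auto)

section \<open>Hitting times and the switching of controls\<close>

lemma hitting_time_finite_iff: "hitting_time f S x u < \<infinity> \<longleftrightarrow> (\<exists>t\<ge>0. trajectory f x u t \<in> S)"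
  by (simp add: hitting_time_def)

text \<open>\<open>LEAST\<close> over the reals is informative only if the minimum is attained,
  which follows from the compactness of the set of hitting instants in
  \<open>{0..t}\<close>.\<close>

lemma hitting_time_attained:
  assumes u: "admissible_control U u" and S: "closed S" and t: "0 \<le> t" "trajectory f x u t \<in> S"
  obtains T where "hitting_time f S x u = ereal T" "0 \<le> T" "T \<le> t" "trajectory f x u T \<in> S"
    "\<And>s. 0 \<le> s \<Longrightarrow> s < T \<Longrightarrow> trajectory f x u s \<notin> S"
proof -
  define A where "A = {s \<in> {0..t}. trajectory f x u s \<in> S}"
  have "A = {0..t} \<inter> trajectory f x u -` S" by (auto simp: A_def)
  then have "closed A"
    using continuous_closed_preimage[OF trajectory_continuous_on[OF u] _ S] by simp
  moreover have "bounded A" by (rule bounded_subset[of "{0..t}"]) (auto simp: A_def)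
  moreover have "A \<noteq> {}" using t by (auto simp: A_def)
  ultimately obtain T where T: "T \<in> A" "\<And>s. s \<in> A \<Longrightarrow> T \<le> s"
    using compact_attains_inf[of A] by (auto simp: compact_eq_bounded_closed)
  have min: "T \<le> s" if "0 \<le> s" "trajectory f x u s \<in> S" for s
    using T that by (cases "s \<le> t") (auto simp: A_def)
  have "(LEAST t. 0 \<le> t \<and> trajectory f x u t \<in> S) = T"
    using T(1) min by (intro Least_equality) (auto simp: A_def)
  then have "hitting_time f S x u = ereal T" using t by (auto simp: hitting_time_def)
  then show thesis using that[of T] T(1) min by (force simp: A_def)
qed

text \<open>From an interior point continuity would place slightly earlier states in
  \<open>S\<close>; at time 0 the assumption on \<open>x\<close> excludes this case.\<close>

lemma hit_in_frontier:
  assumes u: "admissible_control U u" and x: "x \<notin> interior S"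
    and T: "0 \<le> T" "trajectory f x u T \<in> S" "\<And>s. 0 \<le> s \<Longrightarrow> s < T \<Longrightarrow> trajectory f x u s \<notin> S"
  shows "trajectory f x u T \<in> frontier S"
proof -
  have "trajectory f x u T \<notin> interior S"
  proof
    assume int: "trajectory f x u T \<in> interior S"
    then have "T \<noteq> 0" using x trajectory_0[OF u] by metis
    then have "T > 0" using T by simp
    have "(trajectory f x u \<longlongrightarrow> trajectory f x u T) (at T within {0..})"
      using trajectory_continuous[OF u] T by (simp add: continuous_on)
    then have "eventually (\<lambda>s. trajectory f x u s \<in> interior S) (at T within {0..})"
      using int by (intro topological_tendstoD) auto
    then obtain d where d: "d > 0" "\<And>s. s \<ge> 0 \<Longrightarrow> s \<noteq> T \<Longrightarrow> dist s T < d \<Longrightarrow> trajectory f x u s \<in> interior S"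
      unfolding eventually_at by auto
    define s where "s = max 0 (T - d/2)"
    have "0 \<le> s" "s < T" "dist s T < d" using d \<open>T > 0\<close> by (auto simp: s_def dist_real_def)
    then show False using d(2)[of s] T(3)[of s] interior_subset by auto
  qed
  then show ?thesis using T(2) closure_subset by (auto simp: frontier_def)
qed

lemma admissible_control_switch:
  assumes u: "admissible_control U u" and \<omega>: "\<omega> \<in> U"
  shows "admissible_control U (\<lambda>t. if t \<le> T then u t else \<omega>)"
proof -
  have "(\<lambda>t. if t \<le> T then u t else \<omega>) \<in> borel_measurable (lebesgue_on {0..})"
  proof (rule measurable_If)
    have "{..T} \<inter> {0..} \<in> sets (lebesgue_on {0..})" by (auto simp: sets_restrict_space)
    then show "{t \<in> space (lebesgue_on {0..}). t \<le> T} \<in> sets (lebesgue_on {0..})"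
      by (simp add: Int_def conj_commute)
  qed (use u in \<open>auto simp: admissible_control_def\<close>)
  then show ?thesis using u \<omega> by (auto simp: admissible_control_def)
qed

end

section \<open>Exterior spheres of the hypograph of the value function\<close>

lemma closure_hypo_downward:
  assumes "(z, b) \<in> closure (hypo S V)" "b' \<le> b"
  shows "(z, b') \<in> closure (hypo S V)"
proof -
  let ?h = "\<lambda>q. q - (0, b - b')"
  have "?h ` closure (hypo S V) \<subseteq> closure (hypo S V)"
  proof (rule image_closure_subset)
    have "?h ` hypo S V \<subseteq> hypo S V"
      using assms(2) by (auto simp: hypo_def intro: order_trans[rotated])
    then show "?h ` hypo S V \<subseteq> closure (hypo S V)" using closure_subset by blast
  qed (auto intro!: continuous_intros)
  then have "?h (z, b) \<in> closure (hypo S V)" using assms(1) by blast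
  then show ?thesis by simp
qed

locale exit_problem =
  fixes f :: "'a::euclidean_space \<Rightarrow> 'u::euclidean_space \<Rightarrow> 'a" and r :: "'a \<Rightarrow> 'u \<Rightarrow> real"
    and g :: "'a \<Rightarrow> real" and Df :: "'a \<Rightarrow> 'u \<Rightarrow> 'a \<Rightarrow>\<^sub>L 'a" and Dr :: "'a \<Rightarrow> 'u \<Rightarrow> 'a \<Rightarrow>\<^sub>L real"
    and U :: "'u set" and S W :: "'a set" and N L r0 \<rho>0 G :: real
  assumes compact_U: "compact U" and U_nonempty: "U \<noteq> {}" and closed_S: "closed S"
    and constants: "N > 0" "L > 0" "r0 > 0" "\<rho>0 > 0"
    and f_cont: "continuous_on (UNIV \<times> U) (\<lambda>(x, \<omega>). f x \<omega>)"
    and f_bound: "\<And>x \<omega>. \<omega> \<in> U \<Longrightarrow> norm (f x \<omega>) < N"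
    and f_deriv: "\<And>x \<omega>. \<omega> \<in> U \<Longrightarrow> ((\<lambda>z. f z \<omega>) has_derivative blinfun_apply (Df x \<omega>)) (at x)"
    and Df_cont: "continuous_on (UNIV \<times> U) (\<lambda>(x, \<omega>). Df x \<omega>)"
    and f_lip: "\<And>x y \<omega>. \<omega> \<in> U \<Longrightarrow> norm (f y \<omega> - f x \<omega>) \<le> L * norm (y - x)"
    and Df_lip: "\<And>x y \<omega>. \<omega> \<in> U \<Longrightarrow> norm (Df y \<omega> - Df x \<omega>) \<le> L * norm (y - x)"
    and r_cont: "continuous_on (UNIV \<times> U) (\<lambda>(x, \<omega>). r x \<omega>)"
    and r_deriv: "\<And>x \<omega>. \<omega> \<in> U \<Longrightarrow> ((\<lambda>z. r z \<omega>) has_derivative blinfun_apply (Dr x \<omega>)) (at x)"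
    and Dr_cont: "continuous_on (UNIV \<times> U) (\<lambda>(x, \<omega>). Dr x \<omega>)"
    and r_lips: "\<And>x y \<omega>. \<omega> \<in> U \<Longrightarrow>
        \<bar>r y \<omega> - r x \<omega>\<bar> + norm (Dr y \<omega> - Dr x \<omega>) \<le> L * norm (y - x)"
    and r_lower: "\<And>x \<omega>. \<omega> \<in> U \<Longrightarrow> r x \<omega> \<ge> r0"
    and W: "open W" "frontier S \<subseteq> W" and G: "0 \<le> G" "G < r0 / N"
    and g_lip: "\<And>x y. x \<in> W \<Longrightarrow> y \<in> W \<Longrightarrow> \<bar>g y - g x\<bar> \<le> G * norm (y - x)"
    and inner_ball: "\<And>x. x \<in> frontier S \<Longrightarrow>
        \<exists>\<xi>. norm \<xi> = 1 \<and> (\<forall>y \<in> closure (- S). \<xi> \<bullet> (y - x) \<le> 1 / (2 * \<rho>0) * (norm (y - x))\<^sup>2)"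
begin

sublocale control_system f U N L
  using compact_U U_nonempty f_cont f_bound f_lip constants by unfold_locales (auto intro: less_imp_le)

lemma r_lip: "\<omega> \<in> U \<Longrightarrow> \<bar>r y \<omega> - r x \<omega>\<bar> \<le> L * norm (y - x)"
  and Dr_lip: "\<omega> \<in> U \<Longrightarrow> norm (Dr y \<omega> - Dr x \<omega>) \<le> L * norm (y - x)"
  using r_lips[of \<omega> y x] norm_ge_zero[of "Dr y \<omega> - Dr x \<omega>"] abs_ge_zero[of "r y \<omega> - r x \<omega>"] by linarith+

text \<open>The net rate of cost: per unit of time the running cost contributes at least
  \<open>r0\<close>, and near the frontier of \<open>S\<close> the terminal cost can drop by at most
  \<open>G * N\<close>.\<close>

definition \<gamma> :: real where "\<gamma> = r0 - G * N"

lemma \<gamma>_pos: "\<gamma> > 0"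
  using G constants by (simp add: \<gamma>_def field_simps)

definition running_cost :: "'a \<Rightarrow> (real \<Rightarrow> 'u) \<Rightarrow> real \<Rightarrow> real" where
  "running_cost x u t = integral {0..t} (\<lambda>s. r (trajectory f x u s) (u s))"

context
  fixes x :: 'a and u :: "real \<Rightarrow> 'u" assumes u: "admissible_control U u"
begin

lemma running_cost_integrable:
  "(\<lambda>s. r (trajectory f x u s) (u s)) absolutely_integrable_on {0..t}"
  by (rule control_composition_integrable[OF compact_U r_cont trajectory_continuous_on[OF u] u])

lemma running_cost_has_integral:
  assumes "0 \<le> s" "s \<le> t"
  shows "((\<lambda>s. r (trajectory f x u s) (u s)) has_integral (running_cost x u t - running_cost x u s)) {s..t}"
proof -
  have i: "(\<lambda>s. r (trajectory f x u s) (u s)) integrable_on {0..t}"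
    using running_cost_integrable set_lebesgue_integral_eq_integral(1) by blast
  then have "integral {0..s} (\<lambda>s. r (trajectory f x u s) (u s)) + integral {s..t} (\<lambda>s. r (trajectory f x u s) (u s)) =
      integral {0..t} (\<lambda>s. r (trajectory f x u s) (u s))"
    using assms by (intro Henstock_Kurzweil_Integration.integral_combine) auto
  moreover have "(\<lambda>s. r (trajectory f x u s) (u s)) integrable_on {s..t}"
    by (rule integrable_subinterval_real[OF i]) (use assms in auto)
  ultimately show ?thesis by (simp add: has_integral_iff running_cost_def algebra_simps)
qed

lemma running_cost_0: "running_cost x u 0 = 0"
  by (simp add: running_cost_def)

lemma running_cost_continuous: "continuous_on {0..t} (running_cost x u)"
  unfolding running_cost_def[abs_def]
  by (intro indefinite_integral_continuous_1 set_lebesgue_integral_eq_integral(1) running_cost_integrable)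

lemma running_cost_growth:
  assumes "0 \<le> s" "s \<le> t"
  shows "r0 * (t - s) \<le> running_cost x u t - running_cost x u s"
proof (rule has_integral_le[OF _ running_cost_has_integral[OF assms]])
  show "((\<lambda>_. r0) has_integral r0 * (t - s)) {s..t}"
    using has_integral_const_real[of r0 s t] assms by (simp add: mult.commute)
  show "r0 \<le> r (trajectory f x u \<sigma>) (u \<sigma>)" if "\<sigma> \<in> {s..t}" for \<sigma>
    using that assms control_in_U[OF u, of \<sigma>] by (simp add: r_lower)
qed

text \<open>Absolute integrability identifies the Lebesgue integral in \<open>exit_cost\<close> with
  the gauge integral in \<open>running_cost\<close>.\<close>

lemma exit_cost_eq:
  assumes "hitting_time f S x u = ereal T"
  shows "exit_cost f r g S x u = running_cost x u T + g (trajectory f x u T)"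
  using set_lebesgue_integral_eq_integral(2)[OF running_cost_integrable[of T]] assms
  by (simp add: exit_cost_def running_cost_def Let_def)

text \<open>Stopping later is never cheaper near the target because \<open>G * N < r0\<close>.\<close>

lemma value_function_less:
  assumes x: "x \<notin> interior S" and t: "0 \<le> t" "trajectory f x u t \<in> S" "trajectory f x u t \<in> W"
    and \<beta>: "running_cost x u t + g (trajectory f x u t) < \<beta>"
  shows "value_function f r g U S x < ereal \<beta>"
proof -
  obtain T where T: "hitting_time f S x u = ereal T" "0 \<le> T" "T \<le> t" "trajectory f x u T \<in> S"
    "\<And>s. 0 \<le> s \<Longrightarrow> s < T \<Longrightarrow> trajectory f x u s \<notin> S"
    using hitting_time_attained[OF u closed_S t(1,2)] by metis
  have "trajectory f x u T \<in> W"
    using hit_in_frontier[OF u x T(2,4,5)] W by blast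
  then have "g (trajectory f x u T) - g (trajectory f x u t) \<le> G * norm (trajectory f x u T - trajectory f x u t)"
    using g_lip[OF t(3)] by (meson abs_le_D1)
  also have "\<dots> \<le> G * (N * (t - T))"
    using trajectory_lipschitz(1)[OF u T(2,3)] G by (intro mult_left_mono) (auto simp: norm_minus_commute)
  finally have 1: "g (trajectory f x u T) \<le> g (trajectory f x u t) + (G * N) * (t - T)" by simp
  have "0 \<le> \<gamma> * (t - T)" using \<gamma>_pos T by simp
  then have "(G * N) * (t - T) \<le> r0 * (t - T)" by (simp add: \<gamma>_def algebra_simps)
  then have "running_cost x u T + g (trajectory f x u T) < \<beta>"
    using 1 running_cost_growth[OF T(2,3)] \<beta> by linarith
  then have "ereal (exit_cost f r g S x u) < ereal \<beta>" by (simp add: exit_cost_eq[OF T(1)])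
  moreover have "value_function f r g U S x \<le> ereal (exit_cost f r g S x u)"
    unfolding value_function_def using u T(1) by (intro INF_lower) simp
  ultimately show ?thesis by (rule le_less_trans[rotated])
qed

end

text \<open>States before \<open>T\<close> lie outside the target, hence outside the inner ball,
  which keeps \<open>\<xi> \<bullet> (y s - y T)\<close> below order \<open>(T - s)\<^sup>2\<close>
  for the trajectory \<open>y\<close>. If all velocities at the end point had a negative product
  with \<open>\<xi>\<close>, this quantity would grow at least linearly in
  \<open>T - s\<close>.\<close>

lemma entering_velocity_exists:
  assumes u: "admissible_control U u" and T: "0 < T" "\<And>s. 0 \<le> s \<Longrightarrow> s < T \<Longrightarrow> trajectory f x u s \<notin> S"
    and \<xi>: "norm \<xi> = 1" "\<And>y. y \<in> closure (- S) \<Longrightarrow>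
      \<xi> \<bullet> (y - trajectory f x u T) \<le> 1 / (2 * \<rho>0) * (norm (y - trajectory f x u T))\<^sup>2"
  shows "\<exists>\<omega>\<in>U. 0 \<le> \<xi> \<bullet> f (trajectory f x u T) \<omega>"
proof -
  let ?y = "trajectory f x u"
  have "continuous_on U (\<lambda>\<omega>. (\<lambda>(x, \<omega>). f x \<omega>) (?y T, \<omega>))"
    by (rule continuous_on_compose2[OF f_cont]) (auto intro!: continuous_intros)
  then have "continuous_on U (\<lambda>\<omega>. \<xi> \<bullet> f (?y T) \<omega>)" by (auto intro!: continuous_intros)
  then obtain \<omega>1 where \<omega>1: "\<omega>1 \<in> U" "\<And>\<omega>. \<omega> \<in> U \<Longrightarrow> \<xi> \<bullet> f (?y T) \<omega> \<le> \<xi> \<bullet> f (?y T) \<omega>1"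
    using continuous_attains_sup[OF compact_U U_nonempty] by metis
  define m where "m = \<xi> \<bullet> f (?y T) \<omega>1"
  \<comment> \<open>The two second-order errors: the variation of \<open>f\<close> along the
    trajectory and the curvature of the inner ball.\<close>
  define C where "C = L * N + N\<^sup>2 / (2 * \<rho>0)"
  have est: "- m \<le> C * (T - s)" if s: "0 \<le> s" "s < T" for s
  proof -
    have hi: "((\<lambda>\<sigma>. \<xi> \<bullet> f (?y \<sigma>) (u \<sigma>)) has_integral \<xi> \<bullet> (?y T - ?y s)) {s..T}"
      using has_integral_linear[OF trajectory_lipschitz(2)[OF u, of s T] bounded_linear_inner_right[of \<xi>]] s
      by (simp add: o_def)
    have up: "\<xi> \<bullet> (?y T - ?y s) \<le> (T - s) * (m + L * (N * (T - s)))"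
    proof (rule has_integral_le[OF hi])
      show "((\<lambda>_. m + L * (N * (T - s))) has_integral (T - s) * (m + L * (N * (T - s)))) {s..T}"
        using has_integral_const_real[of "m + L * (N * (T - s))" s T] s by simp
      fix \<sigma> assume \<sigma>: "\<sigma> \<in> {s..T}"
      then have uU: "u \<sigma> \<in> U" using control_in_U[OF u] s by simp
      have "norm (?y T - ?y \<sigma>) \<le> N * (T - \<sigma>)" using \<sigma> s by (intro trajectory_lipschitz(1)[OF u]) auto
      also have "\<dots> \<le> N * (T - s)" using \<sigma> constants by (intro mult_left_mono) auto
      finally have n: "norm (?y \<sigma> - ?y T) \<le> N * (T - s)" by (simp add: norm_minus_commute)
      have "\<xi> \<bullet> f (?y \<sigma>) (u \<sigma>) - \<xi> \<bullet> f (?y T) (u \<sigma>) \<le> norm \<xi> * norm (f (?y \<sigma>) (u \<sigma>) - f (?y T) (u \<sigma>))"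
        unfolding inner_diff_right[symmetric] by (rule norm_cauchy_schwarz)
      also have "\<dots> \<le> L * norm (?y \<sigma> - ?y T)" using f_lip[OF uU] \<xi> by simp
      also have "\<dots> \<le> L * (N * (T - s))" using n constants by (intro mult_left_mono) auto
      finally show "\<xi> \<bullet> f (?y \<sigma>) (u \<sigma>) \<le> m + L * (N * (T - s))"
        using \<omega>1(2)[OF uU] by (simp add: m_def)
    qed
    have "?y s \<in> closure (- S)" using T(2)[OF s] closure_subset by blast
    then have "\<xi> \<bullet> (?y s - ?y T) \<le> 1 / (2 * \<rho>0) * (norm (?y s - ?y T))\<^sup>2" by (rule \<xi>(2))
    also have "\<dots> \<le> 1 / (2 * \<rho>0) * (N * (T - s))\<^sup>2"
      using trajectory_lipschitz(1)[OF u, of s T] s constants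
      by (intro mult_left_mono power_mono) (auto simp: norm_minus_commute)
    finally have "- (\<xi> \<bullet> (?y T - ?y s)) \<le> 1 / (2 * \<rho>0) * (N * (T - s))\<^sup>2" by (simp add: inner_diff_right)
    then have "0 \<le> (T - s) * (m + L * (N * (T - s))) + 1 / (2 * \<rho>0) * (N * (T - s))\<^sup>2"
      using up by linarith
    also have "h * (m + L * (N * h)) + 1 / (2 * \<rho>0) * (N * h)\<^sup>2 = h * (m + C * h)" for h
      by (simp add: C_def power2_eq_square distrib_left distrib_right)
    finally show ?thesis using s by (simp add: zero_le_mult_iff)
  qed
  have "C > 0" using constants by (simp add: C_def add_pos_nonneg)
  have "0 \<le> m"
  proof (rule ccontr)
    assume "\<not> 0 \<le> m"
    define h where "h = min T (- m / (2 * C))"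
    have h: "0 < h" "h \<le> T" "h \<le> - m / (2 * C)" using \<open>\<not> 0 \<le> m\<close> \<open>C > 0\<close> T by (auto simp: h_def field_simps)
    have "- m \<le> C * h" using est[of "T - h"] h by simp
    also have "\<dots> \<le> C * (- m / (2 * C))" using h \<open>C > 0\<close> by (intro mult_left_mono) auto
    also have "\<dots> = - m / 2" using \<open>C > 0\<close> by simp
    finally show False using \<open>\<not> 0 \<le> m\<close> by simp
  qed
  then show ?thesis using \<omega>1(1) by (auto simp: m_def)
qed

section \<open>First-order expansion of the data and the adjoint arc\<close>

lemma derivative_bounded_by_lipschitz:
  fixes h :: "'a \<Rightarrow> 'b::real_normed_vector"
  assumes d: "(h has_derivative D) (at x)" and lip: "\<And>y. norm (h y - h x) \<le> L * norm (y - x)"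
  shows "norm (D v) \<le> L * norm v"
proof (rule field_le_epsilon)
  fix e :: real assume "e > 0"
  interpret D: bounded_linear D using d by (rule has_derivative_bounded_linear)
  define e' where "e' = e / (norm v + 1)"
  have "e' > 0" using \<open>e > 0\<close> by (simp add: e'_def add_nonneg_pos)
  then obtain d where d: "d > 0" "\<And>y. norm (y - x) < d \<Longrightarrow> norm (h y - h x - D (y - x)) \<le> e' * norm (y - x)"
    using d unfolding has_derivative_at_alt by blast
  define t where "t = d / (2 * (norm v + 1))"
  have nv: "norm v + 1 > 0" by (simp add: add_nonneg_pos)
  then have "t > 0" using d by (simp add: t_def)
  have "t * norm v \<le> t * (norm v + 1)" using \<open>t > 0\<close> by simp
  also have "\<dots> = d / 2" using nv by (simp add: t_def field_simps)
  finally have "norm ((x + t *\<^sub>R v) - x) < d" using d \<open>t > 0\<close> by simp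
  then have 1: "norm (h (x + t *\<^sub>R v) - h x - t *\<^sub>R D v) \<le> e' * (t * norm v)"
    using d(2)[of "x + t *\<^sub>R v"] \<open>t > 0\<close> by (simp add: D.scaleR)
  have "t * norm (D v) = norm ((h (x + t *\<^sub>R v) - h x) - (h (x + t *\<^sub>R v) - h x - t *\<^sub>R D v))"
    using \<open>t > 0\<close> by simp
  also have "\<dots> \<le> L * (t * norm v) + e' * (t * norm v)"
    by (rule order_trans[OF norm_triangle_ineq4])
      (rule add_mono, use lip[of "x + t *\<^sub>R v"] 1 \<open>t > 0\<close> in simp_all)
  also have "\<dots> = t * (L * norm v + e' * norm v)" by (simp add: algebra_simps)
  finally have "norm (D v) \<le> L * norm v + e' * norm v" using \<open>t > 0\<close> by simp
  also have "e' * norm v \<le> e' * (norm v + 1)" using \<open>e' > 0\<close> by simp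
  also have "\<dots> = e" using nv by (simp add: e'_def)
  finally show "norm (D v) \<le> L * norm v + e" by simp
qed

lemma Df_bound: "\<omega> \<in> U \<Longrightarrow> norm (Df x \<omega> v) \<le> L * norm v"
  by (rule derivative_bounded_by_lipschitz[OF f_deriv f_lip])

lemma Dr_bound: "\<omega> \<in> U \<Longrightarrow> \<bar>Dr x \<omega> v\<bar> \<le> L * norm v"
  using derivative_bounded_by_lipschitz[OF r_deriv, of \<omega> x v] r_lip by simp

lemma lipschitz_derivative_remainder:
  fixes h :: "'a \<Rightarrow> 'b::real_normed_vector" and D :: "'a \<Rightarrow> 'a \<Rightarrow>\<^sub>L 'b"
  assumes d: "\<And>x. (h has_derivative blinfun_apply (D x)) (at x)"
    and lip: "\<And>x y. norm (D y - D x) \<le> L * norm (y - x)"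
  shows "norm (h z - h y - D y (z - y)) \<le> L * (norm (z - y))\<^sup>2"
proof -
  have "norm (h z - h y - D y (z - y)) \<le> norm (z - y) * (L * norm (z - y))"
  proof (rule differentiable_bound_linearization[where S = "closed_segment y z" and f' = "\<lambda>x. blinfun_apply (D x)"])
    show "y + t *\<^sub>R (z - y) \<in> closed_segment y z" if "t \<in> {0..1}" for t
      using that by (auto simp: in_segment algebra_simps intro!: exI[of _ t])
    show "(h has_derivative blinfun_apply (D x)) (at x within closed_segment y z)" for x
      by (rule has_derivative_at_withinI[OF d])
    show "onorm (blinfun_apply (D x) - blinfun_apply (D y)) \<le> L * norm (z - y)" if "x \<in> closed_segment y z" for x
    proof -
      have "onorm (blinfun_apply (D x) - blinfun_apply (D y)) = norm (D x - D y)"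
        by (simp add: norm_blinfun.rep_eq minus_blinfun.rep_eq fun_diff_def)
      also have "\<dots> \<le> L * norm (x - y)" by (rule lip)
      also have "\<dots> \<le> L * norm (z - y)"
        using segment_bound(1)[OF that] constants by (intro mult_left_mono) auto
      finally show ?thesis .
    qed
  qed simp
  then show ?thesis by (simp add: power2_eq_square mult_ac)
qed

lemma f_remainder: "\<omega> \<in> U \<Longrightarrow> norm (f z \<omega> - f y \<omega> - Df y \<omega> (z - y)) \<le> L * (norm (z - y))\<^sup>2"
  by (rule lipschitz_derivative_remainder) (auto intro: f_deriv Df_lip)

lemma r_remainder: "\<omega> \<in> U \<Longrightarrow> \<bar>r z \<omega> - r y \<omega> - Dr y \<omega> (z - y)\<bar> \<le> L * (norm (z - y))\<^sup>2"
  using lipschitz_derivative_remainder[of "\<lambda>z. r z \<omega>" "\<lambda>z. Dr z \<omega>" z y] r_deriv Dr_lip by simp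

text \<open>The transposed Jacobian of \<open>f\<close> applied to \<open>q\<close>, minus
  \<open>\<mu>\<close> times the gradient of \<open>r\<close>; the adjoint equation has the negative
  of this as right-hand side. The coordinate form makes its continuity immediate.\<close>

definition adjoint_field :: "real \<Rightarrow> 'a \<Rightarrow> 'u \<Rightarrow> 'a \<Rightarrow> 'a" where
  "adjoint_field \<mu> x \<omega> q = (\<Sum>b\<in>Basis. (q \<bullet> Df x \<omega> b - \<mu> * Dr x \<omega> b) *\<^sub>R b)"

lemma adjoint_field_inner: "adjoint_field \<mu> x \<omega> q \<bullet> v = q \<bullet> Df x \<omega> v - \<mu> * Dr x \<omega> v"
proof -
  have "q \<bullet> Df x \<omega> v - \<mu> * Dr x \<omega> v = q \<bullet> Df x \<omega> (\<Sum>b\<in>Basis. (v \<bullet> b) *\<^sub>R b) - \<mu> * Dr x \<omega> (\<Sum>b\<in>Basis. (v \<bullet> b) *\<^sub>R b)"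
    by (simp add: euclidean_representation)
  also have "\<dots> = (\<Sum>b\<in>Basis. (q \<bullet> Df x \<omega> b - \<mu> * Dr x \<omega> b) * (v \<bullet> b))"
    by (simp add: blinfun.sum_right blinfun.scaleR_right inner_sum_right sum_distrib_left sum_subtractf[symmetric] algebra_simps)
  also have "\<dots> = adjoint_field \<mu> x \<omega> q \<bullet> v"
    unfolding adjoint_field_def inner_sum_left by (intro sum.cong) (simp_all add: inner_commute)
  finally show ?thesis by simp
qed

text \<open>Testing the difference against itself turns the bound on \<open>Df\<close> into the same
  bound on its transpose.\<close>

lemma adjoint_field_lipschitz:
  assumes "\<omega> \<in> U" shows "norm (adjoint_field \<mu> x \<omega> p - adjoint_field \<mu> x \<omega> q) \<le> L * norm (p - q)"
proof -
  define v where "v = adjoint_field \<mu> x \<omega> p - adjoint_field \<mu> x \<omega> q"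
  have "v \<bullet> v = (p - q) \<bullet> Df x \<omega> v"
    unfolding v_def by (subst inner_diff_left) (simp add: adjoint_field_inner inner_diff_left)
  also have "\<dots> \<le> norm (p - q) * (L * norm v)"
    using Df_bound[OF assms, of x v] by (intro order_trans[OF norm_cauchy_schwarz] mult_left_mono) auto
  finally have "norm v * norm v \<le> (L * norm (p - q)) * norm v"
    by (simp add: power2_norm_eq_inner[symmetric] power2_eq_square mult_ac)
  then have "norm v \<le> L * norm (p - q)"
    using constants by (cases "v = 0") auto
  then show ?thesis by (simp add: v_def)
qed

lemma adjoint_field_0:
  assumes "\<omega> \<in> U" "0 \<le> \<mu>" shows "norm (adjoint_field \<mu> x \<omega> 0) \<le> \<mu> * L"
proof -
  define v where "v = adjoint_field \<mu> x \<omega> 0"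
  have "v \<bullet> v = - \<mu> * Dr x \<omega> v"
    unfolding v_def by (subst adjoint_field_inner) simp
  also have "\<dots> \<le> \<mu> * (L * norm v)"
    using mult_left_mono[OF Dr_bound[OF assms(1), of x v] assms(2)] mult_left_mono[OF abs_ge_minus_self[of "Dr x \<omega> v"] assms(2)]
    by linarith
  finally have "norm v * norm v \<le> (\<mu> * L) * norm v"
    by (simp add: power2_norm_eq_inner[symmetric] power2_eq_square mult_ac)
  then have "norm v \<le> \<mu> * L"
    using constants assms by (cases "v = 0") auto
  then show ?thesis by (simp add: v_def)
qed

lemma adjoint_field_continuous:
  "continuous_on (UNIV \<times> U) (\<lambda>((x, q), \<omega>). adjoint_field \<mu> x \<omega> q)"
proof -
  have 1: "continuous_on (UNIV \<times> U) (\<lambda>z :: ('a \<times> 'a) \<times> 'u. (\<lambda>(x, \<omega>). Df x \<omega>) (fst (fst z), snd z))"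
    by (rule continuous_on_compose2[OF Df_cont]) (auto intro!: continuous_intros)
  have 2: "continuous_on (UNIV \<times> U) (\<lambda>z :: ('a \<times> 'a) \<times> 'u. (\<lambda>(x, \<omega>). Dr x \<omega>) (fst (fst z), snd z))"
    by (rule continuous_on_compose2[OF Dr_cont]) (auto intro!: continuous_intros)
  show ?thesis
    unfolding adjoint_field_def split_def
    using 1 2 by (auto intro!: continuous_intros)
qed

text \<open>The adjoint arc transports a normal at the end point of a trajectory back to its start,
  up to an error that is quadratic in the displacement.\<close>

lemma adjoint_arc_exists:
  assumes u: "admissible_control U u" and "0 \<le> T" "0 \<le> \<mu>"
  obtains q0 where "norm qT \<le> (norm q0 + \<mu> * L * T) * exp (L * T)"
    "\<And>z u'. admissible_control U u' \<Longrightarrow> (\<And>s. 0 \<le> s \<Longrightarrow> s \<le> T \<Longrightarrow> u' s = u s) \<Longrightarrow>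
       q0 \<bullet> (z - x) - T * (((norm qT + \<mu> * L * T) * exp (L * T) + \<mu>) * L * (exp (L * T))\<^sup>2) * (norm (z - x))\<^sup>2
       \<le> qT \<bullet> (trajectory f z u' T - trajectory f x u T) - \<mu> * (running_cost z u' T - running_cost x u T)"
proof -
  let ?y = "trajectory f x u"
  define A where "A s = adjoint_field \<mu> (?y s) (u s)" for s
  have uU: "u s \<in> U" if "s \<in> {0..T}" for s using that control_in_U[OF u] by simp
  have int: "(\<lambda>s. A s (w s)) integrable_on {0..T}" if w: "continuous_on {0..T} w" for w
  proof -
    have "continuous_on {0..T} (\<lambda>s. (?y s, w s))"
      by (intro continuous_intros w trajectory_continuous_on u)
    then have "(\<lambda>s. (\<lambda>p \<omega>. adjoint_field \<mu> (fst p) \<omega> (snd p)) (?y s, w s) (u s)) absolutely_integrable_on {0..T}"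
      using adjoint_field_continuous[of \<mu>]
      by (intro control_composition_integrable[OF compact_U _ _ u]) (auto simp: split_def)
    then show ?thesis using set_lebesgue_integral_eq_integral(1) by (auto simp: A_def)
  qed
  obtain q where q: "q T = qT" "continuous_on {0..T} q"
    "\<And>t. t \<in> {0..T} \<Longrightarrow> ((\<lambda>s. - A s (q s)) has_integral (q t - q 0)) {0..t}"
    "\<And>t. t \<in> {0..T} \<Longrightarrow> norm (q t) \<le> (norm qT + \<mu> * L * T) * exp (L * T)"
    "norm qT \<le> (norm (q 0) + \<mu> * L * T) * exp (L * T)"
  proof (rule backward_integral_equation[of T A L "\<mu> * L" qT])
    show "norm (A s p - A s q) \<le> L * norm (p - q)" if "s \<in> {0..T}" for s p q
      unfolding A_def by (rule adjoint_field_lipschitz[OF uU[OF that]])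
    show "norm (A s 0) \<le> \<mu> * L" if "s \<in> {0..T}" for s
      unfolding A_def by (rule adjoint_field_0[OF uU[OF that] \<open>0 \<le> \<mu>\<close>])
  qed (use \<open>0 \<le> T\<close> int constants in \<open>simp_all add: less_imp_le\<close>)
  define Q where "Q = (norm qT + \<mu> * L * T) * exp (L * T)"
  have "Q \<ge> 0" using q(4)[of 0] \<open>0 \<le> T\<close> norm_ge_zero[of "q 0"] unfolding Q_def by (metis atLeastAtMost_iff order_refl order_trans)
  show thesis
  proof (rule that[of "q 0"])
    fix z u' assume u': "admissible_control U u'" and agree: "\<And>s. 0 \<le> s \<Longrightarrow> s \<le> T \<Longrightarrow> u' s = u s"
    let ?z = "trajectory f z u'"
    define w where "w s = ?z s - ?y s" for s
    have w0: "w 0 = z - x" by (simp add: w_def trajectory_0 u u')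
    have wb: "norm (w s) \<le> norm (z - x) * exp (L * T)" if "s \<in> {0..T}" for s
    proof -
      have "norm (w s) \<le> norm (z - x) * exp (L * s)"
        using trajectory_dependence[OF u u' agree, of T s z x] that by (simp add: w_def)
      also have "\<dots> \<le> norm (z - x) * exp (L * T)"
        using that constants by (intro mult_left_mono) auto
      finally show ?thesis .
    qed
    define dw where "dw s = f (?z s) (u' s) - f (?y s) (u s)" for s
    have dwi: "(dw has_integral (w t - w 0)) {0..t}" if "t \<in> {0..T}" for t
    proof -
      have "(dw has_integral ((?z t - z) - (?y t - x))) {0..t}"
        unfolding dw_def using that by (intro has_integral_diff trajectory_has_integral u u') auto
      then show ?thesis by (simp add: w_def trajectory_0 u u' algebra_simps)
    qed
    have dwb: "norm (dw s) \<le> L * (norm (z - x) * exp (L * T))" if s: "s \<in> {0..T}" for s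
    proof -
      have "norm (dw s) \<le> L * norm (w s)"
        using f_lip[OF uU[OF s]] agree[of s] s by (simp add: dw_def w_def)
      also have "\<dots> \<le> L * (norm (z - x) * exp (L * T))" using wb[OF s] constants by (intro mult_left_mono) auto
      finally show ?thesis .
    qed
    have Ab: "norm (- A s (q s)) \<le> \<mu> * L + L * Q" if s: "s \<in> {0..T}" for s
    proof -
      have "norm (A s (q s)) \<le> norm (A s 0) + norm (A s (q s) - A s 0)" by (rule norm_triangle_sub)
      also have "\<dots> \<le> \<mu> * L + L * norm (q s - 0)"
        unfolding A_def by (intro add_mono adjoint_field_lipschitz adjoint_field_0 uU s \<open>0 \<le> \<mu>\<close>)
      also have "\<dots> \<le> \<mu> * L + L * Q" using q(4)[OF s] constants by (simp add: Q_def)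
      finally show ?thesis by simp
    qed
    have hi1: "((\<lambda>s. - A s (q s) \<bullet> w s + q s \<bullet> dw s) has_integral (q T \<bullet> w T - q 0 \<bullet> w 0)) {0..T}"
      by (rule has_integral_inner_product[OF q(3) dwi Ab dwb \<open>0 \<le> T\<close>])
    have hi2: "((\<lambda>s. r (?z s) (u' s) - r (?y s) (u s)) has_integral (running_cost z u' T - running_cost x u T)) {0..T}"
      using has_integral_diff[OF running_cost_has_integral[OF u', of 0 T z] running_cost_has_integral[OF u, of 0 T x]] \<open>0 \<le> T\<close>
      by (simp add: running_cost_0 u u')
    define C where "C = (Q + \<mu>) * L * (norm (z - x) * exp (L * T))\<^sup>2"
    have hi: "((\<lambda>s. (- A s (q s) \<bullet> w s + q s \<bullet> dw s) - \<mu> * (r (?z s) (u' s) - r (?y s) (u s))) has_integral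
        (q T \<bullet> w T - q 0 \<bullet> w 0) - \<mu> * (running_cost z u' T - running_cost x u T)) {0..T}"
      by (intro has_integral_diff hi1 has_integral_mult_right hi2)
    have "- C * T \<le> (q T \<bullet> w T - q 0 \<bullet> w 0) - \<mu> * (running_cost z u' T - running_cost x u T)"
    proof (rule has_integral_le[OF _ hi])
      show "((\<lambda>_. - C) has_integral - C * T) {0..T}"
        using has_integral_const_real[of "- C" 0 T] \<open>0 \<le> T\<close> by (simp add: mult.commute)
      fix s assume s: "s \<in> {0..T}"
      have us: "u' s = u s" using agree s by simp
      define e1 where "e1 = f (?z s) (u s) - f (?y s) (u s) - Df (?y s) (u s) (w s)"
      define e2 where "e2 = r (?z s) (u s) - r (?y s) (u s) - Dr (?y s) (u s) (w s)"
      have e: "norm e1 \<le> L * (norm (w s))\<^sup>2" "\<bar>e2\<bar> \<le> L * (norm (w s))\<^sup>2"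
        unfolding e1_def e2_def w_def by (rule f_remainder r_remainder, rule uU[OF s])+
      \<comment> \<open>The adjoint equation cancels all terms linear in \<open>w\<close>; the
        Taylor remainders \<open>e1\<close> and \<open>e2\<close> that are left are quadratic in
        \<open>w\<close>.\<close>
      have "(- A s (q s) \<bullet> w s + q s \<bullet> dw s) - \<mu> * (r (?z s) (u' s) - r (?y s) (u s)) = q s \<bullet> e1 - \<mu> * e2"
        by (simp add: A_def adjoint_field_inner e1_def e2_def dw_def us inner_diff_right right_diff_distrib)
      moreover have "\<bar>q s \<bullet> e1\<bar> \<le> Q * (L * (norm (w s))\<^sup>2)"
        using Cauchy_Schwarz_ineq2[of "q s" e1] mult_mono[OF q(4)[OF s] e(1)] \<open>Q \<ge> 0\<close>
        unfolding Q_def by fastforce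
      moreover have "\<bar>\<mu> * e2\<bar> \<le> \<mu> * (L * (norm (w s))\<^sup>2)"
        using e(2) \<open>0 \<le> \<mu>\<close> by (simp add: abs_mult mult_left_mono)
      moreover have "(Q + \<mu>) * (L * (norm (w s))\<^sup>2) \<le> C"
      proof -
        have "(Q + \<mu>) * (L * (norm (w s))\<^sup>2) \<le> (Q + \<mu>) * (L * (norm (z - x) * exp (L * T))\<^sup>2)"
          using wb[OF s] constants \<open>Q \<ge> 0\<close> \<open>0 \<le> \<mu>\<close> by (intro mult_left_mono power_mono) auto
        then show ?thesis by (simp add: C_def mult.assoc)
      qed
      ultimately show "- C \<le> (- A s (q s) \<bullet> w s + q s \<bullet> dw s) - \<mu> * (r (?z s) (u' s) - r (?y s) (u s))"
        by (simp add: distrib_right)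
    qed
    moreover have "C * T = T * ((Q + \<mu>) * L * (exp (L * T))\<^sup>2) * (norm (z - x))\<^sup>2"
      by (simp add: C_def power_mult_distrib mult_ac)
    ultimately show "q 0 \<bullet> (z - x) - T * (((norm qT + \<mu> * L * T) * exp (L * T) + \<mu>) * L * (exp (L * T))\<^sup>2) * (norm (z - x))\<^sup>2
       \<le> qT \<bullet> (?z T - ?y T) - \<mu> * (running_cost z u' T - running_cost x u T)"
      unfolding Q_def[symmetric] using q(1) w0 by (simp add: w_def)
  qed (rule q(5))
qed

text \<open>From \<open>T\<close> the control \<open>\<omega>1\<close> is used, or else the trajectory is stopped before \<open>T\<close>: the weighted
  sum \<open>\<Phi>\<close> of the depth in the inner ball and of the margin in the cost is almost monotone on both
  sides, and the margin alone decreases at rate \<open>\<gamma>\<close>, so a time exists at which both are positive.\<close>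

lemma value_function_less_near_hit:
  assumes u: "admissible_control U u" and z: "z \<in> closure (- S)"
    and x1: "x1 \<in> frontier S"
    and \<xi>: "norm \<xi> = 1" "\<And>y. y \<in> closure (- S) \<Longrightarrow> \<xi> \<bullet> (y - x1) \<le> 1 / (2 * \<rho>0) * (norm (y - x1))\<^sup>2"
    and p: "norm p \<le> G" "\<And>y. y \<in> ball x1 e \<Longrightarrow> g y \<le> g x1 + p \<bullet> (y - x1) + c * (norm (y - x1))\<^sup>2"
    and e: "ball x1 e \<subseteq> W" "0 \<le> c"
    and \<theta>: "0 \<le> \<theta>" "\<theta> \<le> 1" and \<omega>1: "\<And>s. T < s \<Longrightarrow> u s = \<omega>1"
    and opt: "0 \<le> \<theta> * (\<xi> \<bullet> f x1 \<omega>1) - (1 - \<theta>) * (r x1 \<omega>1 + p \<bullet> f x1 \<omega>1)"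
      "\<And>\<omega>. \<omega> \<in> U \<Longrightarrow> \<theta> * (\<xi> \<bullet> f x1 \<omega>) - (1 - \<theta>) * (r x1 \<omega> + p \<bullet> f x1 \<omega>) \<le> 0"
    and D: "0 < D" "norm (trajectory f z u T - x1) \<le> C1 * D"
    and \<kappa>: "0 < \<kappa>" "\<kappa> * D \<le> T"
    and C3: "C3 = C1 + N * \<kappa>" "C3 * D < e"
    and K: "K = (1 / (2 * \<rho>0) + c) * C3\<^sup>2 + 1" "K * D \<le> 1"
    and b: "\<bar>\<beta> - running_cost z u T - g x1 - p \<bullet> (trajectory f z u T - x1)\<bar> \<le> (\<gamma> * \<kappa> - 1) * D"
    and \<Phi>: "((2 + G) * L * C3 * \<kappa> + 2 * K) * D\<^sup>2 \<le>
      \<theta> * (\<xi> \<bullet> (trajectory f z u T - x1)) +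
      (1 - \<theta>) * (\<beta> - running_cost z u T - g x1 - p \<bullet> (trajectory f z u T - x1))"
  shows "value_function f r g U S z < ereal \<beta>"
proof -
  let ?z = "trajectory f z u" and ?R = "running_cost z u"
  \<comment> \<open>\<open>\<psi>1\<close> measures the depth in the direction \<open>\<xi>\<close>.
    In the margin \<open>\<psi>2\<close> the terminal cost is replaced by the affine part of its
    upper model at \<open>x1\<close>.\<close>
  define \<psi>1 where "\<psi>1 t = \<xi> \<bullet> (?z t - x1)" for t
  define \<psi>2 where "\<psi>2 t = \<beta> - ?R t - g x1 - p \<bullet> (?z t - x1)" for t
  define \<Phi> where "\<Phi> t = \<theta> * \<psi>1 t + (1 - \<theta>) * \<psi>2 t" for t
  \<comment> \<open>During a time \<open>\<kappa> * D\<close> the margin falls by at least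
    \<open>\<gamma> * \<kappa> * D\<close>, which exceeds by \<open>D\<close> the bound on its
    modulus at \<open>T\<close>. So it is at least \<open>D\<close> at \<open>a\<close> and at most
    \<open>- D\<close> at \<open>d\<close>.\<close>
  define a where "a = T - \<kappa> * D"
  define d where "d = T + \<kappa> * D"
  have kD: "\<kappa> * D > 0" using D \<kappa> by simp
  have ad: "0 \<le> a" "a < T" "T < d" using kD \<kappa> by (auto simp: a_def d_def)
  have uU: "u s \<in> U" if "0 \<le> s" for s using control_in_U[OF u that] .
  have dist: "norm (?z t - x1) \<le> C3 * D" if t: "t \<in> {a..d}" for t
  proof -
    have "norm (?z t - ?z T) \<le> N * \<bar>t - T\<bar>"
      using trajectory_lipschitz(1)[OF u, of t T z] trajectory_lipschitz(1)[OF u, of T t z] t ad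
      by (cases "t \<le> T") (auto simp: norm_minus_commute abs_if)
    also have "\<dots> \<le> N * (\<kappa> * D)" using t constants by (intro mult_left_mono) (auto simp: a_def d_def)
    finally have "norm (?z t - ?z T) \<le> N * (\<kappa> * D)" .
    then have "norm ((?z t - ?z T) + (?z T - x1)) \<le> N * (\<kappa> * D) + C1 * D"
      using D by (intro order_trans[OF norm_triangle_ineq]) simp
    then show ?thesis by (simp add: C3 algebra_simps)
  qed
  have C3D: "C3 * D \<ge> 0" using order_trans[OF norm_ge_zero dist[of T]] ad by simp
  have hz: "((\<lambda>\<sigma>. v \<bullet> f (?z \<sigma>) (u \<sigma>)) has_integral (v \<bullet> ?z t - v \<bullet> ?z s)) {s..t}" if "0 \<le> s" "s \<le> t" for s t v
    using has_integral_linear[OF trajectory_lipschitz(2)[OF u that, of z] bounded_linear_inner_right[of v]]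
    by (simp add: o_def inner_diff_right)
  have hR: "((\<lambda>\<sigma>. r (?z \<sigma>) (u \<sigma>)) has_integral (?R t - ?R s)) {s..t}" if "0 \<le> s" "s \<le> t" for s t
    by (rule running_cost_has_integral[OF u that])
  have h2: "((\<lambda>\<sigma>. - (r (?z \<sigma>) (u \<sigma>) + p \<bullet> f (?z \<sigma>) (u \<sigma>))) has_integral (\<psi>2 t - \<psi>2 s)) {s..t}" if "0 \<le> s" "s \<le> t" for s t
    using has_integral_neg[OF has_integral_add[OF hR[OF that] hz[OF that, of p]]]
    by (simp add: \<psi>2_def inner_diff_right algebra_simps)
  have decr: "\<psi>2 t - \<psi>2 s \<le> - \<gamma> * (t - s)" if "0 \<le> s" "s \<le> t" for s t
  proof (rule has_integral_le[OF h2[OF that]])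
    show "((\<lambda>_. - \<gamma>) has_integral - \<gamma> * (t - s)) {s..t}"
      using has_integral_const_real[of "- \<gamma>" s t] that by (simp add: mult.commute)
    fix \<sigma> assume "\<sigma> \<in> {s..t}"
    then have U\<sigma>: "u \<sigma> \<in> U" using that uU by simp
    have "\<bar>p \<bullet> f (?z \<sigma>) (u \<sigma>)\<bar> \<le> G * N"
      using f_bound[OF U\<sigma>, of "?z \<sigma>"] p(1) G
      by (intro order_trans[OF Cauchy_Schwarz_ineq2] mult_mono) auto
    then show "- (r (?z \<sigma>) (u \<sigma>) + p \<bullet> f (?z \<sigma>) (u \<sigma>)) \<le> - \<gamma>"
      using r_lower[OF U\<sigma>, of "?z \<sigma>"] by (simp add: \<gamma>_def)
  qed
  define F where "F y \<omega> = \<theta> * (\<xi> \<bullet> f y \<omega>) - (1 - \<theta>) * (r y \<omega> + p \<bullet> f y \<omega>)" for y \<omega>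
  have hF: "((\<lambda>\<sigma>. F (?z \<sigma>) (u \<sigma>)) has_integral (\<Phi> t - \<Phi> s)) {s..t}" if "0 \<le> s" "s \<le> t" for s t
    using has_integral_add[OF has_integral_mult_right[OF hz[OF that, of \<xi>], of \<theta>] has_integral_mult_right[OF h2[OF that], of "1 - \<theta>"]]
    by (simp add: F_def \<Phi>_def \<psi>1_def inner_diff_right algebra_simps)
  define C4 where "C4 = (2 + G) * L * C3"
  have FL: "\<bar>F y \<omega> - F x1 \<omega>\<bar> \<le> (2 + G) * L * norm (y - x1)" if "\<omega> \<in> U" for y \<omega>
  proof -
    have "\<bar>\<xi> \<bullet> (f y \<omega> - f x1 \<omega>)\<bar> \<le> L * norm (y - x1)"
      using Cauchy_Schwarz_ineq2[of \<xi> "f y \<omega> - f x1 \<omega>"] f_lip[OF that, of y x1] \<xi> by simp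
    then have 1: "\<bar>\<theta> * (\<xi> \<bullet> (f y \<omega> - f x1 \<omega>))\<bar> \<le> 1 * (L * norm (y - x1))"
      unfolding abs_mult using \<theta> by (intro mult_mono) auto
    have "\<bar>p \<bullet> (f y \<omega> - f x1 \<omega>)\<bar> \<le> G * (L * norm (y - x1))"
      using f_lip[OF that, of y x1] p(1) G by (intro order_trans[OF Cauchy_Schwarz_ineq2] mult_mono) auto
    then have "\<bar>(r y \<omega> - r x1 \<omega>) + p \<bullet> (f y \<omega> - f x1 \<omega>)\<bar> \<le> L * norm (y - x1) + G * (L * norm (y - x1))"
      using r_lip[OF that, of y x1] by linarith
    then have 2: "\<bar>(1 - \<theta>) * ((r y \<omega> - r x1 \<omega>) + p \<bullet> (f y \<omega> - f x1 \<omega>))\<bar> \<le> 1 * (L * norm (y - x1) + G * (L * norm (y - x1)))"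
      unfolding abs_mult using \<theta> by (intro mult_mono) auto
    have "F y \<omega> - F x1 \<omega> = \<theta> * (\<xi> \<bullet> (f y \<omega> - f x1 \<omega>)) - (1 - \<theta>) * ((r y \<omega> - r x1 \<omega>) + p \<bullet> (f y \<omega> - f x1 \<omega>))"
      by (simp add: F_def inner_diff_right algebra_simps)
    then have "\<bar>F y \<omega> - F x1 \<omega>\<bar> \<le> 1 * (L * norm (y - x1)) + 1 * (L * norm (y - x1) + G * (L * norm (y - x1)))"
      by (simp only:) (rule order_trans[OF abs_triangle_ineq4 add_mono[OF 1 2]])
    then show ?thesis by (simp add: algebra_simps)
  qed
  have near: "\<bar>F (?z s) (u s) - F x1 (u s)\<bar> \<le> C4 * D" if "s \<in> {a..d}" for s
  proof -
    have "\<bar>F (?z s) (u s) - F x1 (u s)\<bar> \<le> (2 + G) * L * norm (?z s - x1)" using FL uU that ad by simp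
    also have "\<dots> \<le> (2 + G) * L * (C3 * D)" using dist[OF that] G constants by (intro mult_left_mono) auto
    finally show ?thesis by (simp add: C4_def mult_ac)
  qed
  have C4D: "0 \<le> C4 * D" using order_trans[OF abs_ge_zero near[of T]] ad by simp
  have \<Phi>_ge: "\<Phi> T - C4 * D * (\<kappa> * D) \<le> \<Phi> t" if t: "t \<in> {a..d}" for t
  proof (cases "t \<le> T")
    case True
    have "\<Phi> T - \<Phi> t \<le> C4 * D * (T - t)"
    proof (rule has_integral_le[OF hF])
      show "((\<lambda>_. C4 * D) has_integral C4 * D * (T - t)) {t..T}"
        using has_integral_const_real[of "C4 * D" t T] True by (simp add: mult.commute)
      show "F (?z s) (u s) \<le> C4 * D" if "s \<in> {t..T}" for s
        using near[of s] opt(2)[OF uU[of s]] that t ad by (auto simp: F_def)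
    qed (use t ad True in auto)
    also have "\<dots> \<le> C4 * D * (\<kappa> * D)" using t C4D by (intro mult_left_mono) (auto simp: a_def)
    finally show ?thesis by simp
  next
    case False
    have "C4 * D * (T - t) \<le> \<Phi> t - \<Phi> T"
    proof (rule has_integral_le[OF _ hF])
      \<comment> \<open>At \<open>T\<close> itself the old control is still in force, since
        \<open>\<omega>1\<close> takes over only afterwards; a single point does not affect the
        integral.\<close>
      show "((\<lambda>s. if s = T then F (?z s) (u s) else - (C4 * D)) has_integral C4 * D * (T - t)) {T..t}"
      proof (rule has_integral_spike[OF negligible_sing[of T]])
        show "((\<lambda>_. - (C4 * D)) has_integral C4 * D * (T - t)) {T..t}"
          using has_integral_const_real[of "- (C4 * D)" T t] False by (simp add: algebra_simps)
      qed simp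
      show "(if s = T then F (?z s) (u s) else - (C4 * D)) \<le> F (?z s) (u s)" if "s \<in> {T..t}" for s
        using near[of s] opt(1) \<omega>1[of s] that t ad by (auto simp: F_def)
    qed (use t ad False in auto)
    moreover have "C4 * D * (t - T) \<le> C4 * D * (\<kappa> * D)" using t C4D by (intro mult_left_mono) (auto simp: d_def)
    ultimately show ?thesis by (simp add: algebra_simps)
  qed
  have KD: "K * D\<^sup>2 \<le> D" using mult_right_mono[OF K(2), of D] D by (simp add: power2_eq_square mult_ac)
  have K0: "0 \<le> K * D\<^sup>2"
    unfolding K(1) using e(2) constants by (intro mult_nonneg_nonneg add_nonneg_nonneg) auto
  \<comment> \<open>The level \<open>K * D\<^sup>2\<close> exceeds the quadratic errors of the upper
    model and of the inner ball. As \<open>\<Phi>\<close> stays above twice this level and the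
    margin uses at most one half, the other half is left for the depth.\<close>
  have "\<exists>t. a \<le> t \<and> t \<le> d \<and> \<psi>2 t = K * D\<^sup>2"
  proof (rule IVT2')
    show "\<psi>2 d \<le> K * D\<^sup>2"
      using decr[of T d] ad b K0 D unfolding \<psi>2_def[symmetric] by (simp add: d_def algebra_simps)
    show "K * D\<^sup>2 \<le> \<psi>2 a"
      using decr[of a T] ad b KD unfolding \<psi>2_def[symmetric] by (simp add: a_def algebra_simps)
    show "continuous_on {a..d} \<psi>2"
      unfolding \<psi>2_def
      by (intro continuous_intros continuous_on_subset[OF running_cost_continuous[OF u, of d]]
        continuous_on_subset[OF trajectory_continuous_on[OF u, of d]]) (use ad in auto)
  qed (use ad in simp)
  then obtain t where t: "t \<in> {a..d}" "\<psi>2 t = K * D\<^sup>2" by auto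
  define v where "v = ?z t - x1"
  have nv: "(norm v)\<^sup>2 \<le> C3\<^sup>2 * D\<^sup>2"
    using power_mono[OF dist[OF t(1)], of 2] by (simp add: v_def power_mult_distrib)
  have K': "(1 / (2 * \<rho>0) + c) * (norm v)\<^sup>2 < K * D\<^sup>2"
  proof -
    have "(1 / (2 * \<rho>0) + c) * (norm v)\<^sup>2 \<le> (1 / (2 * \<rho>0) + c) * (C3\<^sup>2 * D\<^sup>2)"
      using nv e(2) constants by (intro mult_left_mono add_nonneg_nonneg) auto
    also have "\<dots> < K * D\<^sup>2" using D by (simp add: K(1) algebra_simps)
    finally show ?thesis .
  qed
  have "(C4 * \<kappa> + 2 * K) * D\<^sup>2 \<le> \<Phi> T" using \<Phi> by (simp add: \<Phi>_def \<psi>1_def \<psi>2_def C4_def)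
  then have "2 * (K * D\<^sup>2) \<le> \<Phi> t" using \<Phi>_ge[OF t(1)] by (simp add: power2_eq_square algebra_simps)
  moreover have "(1 - \<theta>) * \<psi>2 t \<le> K * D\<^sup>2"
    unfolding t(2) using \<theta> K0 by (intro mult_left_le_one_le) auto
  ultimately have th: "K * D\<^sup>2 \<le> \<theta> * \<psi>1 t" by (simp add: \<Phi>_def)
  have c0: "0 \<le> 1 / (2 * \<rho>0) * (norm v)\<^sup>2" "0 \<le> c * (norm v)\<^sup>2" using constants e(2) by auto
  \<comment> \<open>Positivity of the product excludes \<open>\<theta> = 0\<close>; then
    \<open>\<theta> <= 1\<close> allows the factor to be dropped.\<close>
  have "0 < \<theta> * \<psi>1 t" using th K' c0 by (simp add: distrib_right)
  then have "\<theta> * \<psi>1 t \<le> \<psi>1 t" using \<theta> by (intro mult_left_le_one_le) (auto simp: zero_less_mult_iff)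
  then have depth: "1 / (2 * \<rho>0) * (norm v)\<^sup>2 < \<xi> \<bullet> v"
    using th K' c0 by (simp add: \<psi>1_def v_def distrib_right)
  \<comment> \<open>The strict inequality places the point in the open inner ball, which is disjoint
    from the closure of the complement.\<close>
  have "?z t \<notin> closure (- S)" using \<xi>(2)[of "?z t"] depth by (auto simp: v_def)
  then have inS: "?z t \<in> S" using closure_subset[of "- S"] by blast
  have tb: "?z t \<in> ball x1 e" using dist[OF t(1)] C3(2) by (simp add: dist_norm norm_minus_commute)
  have "g (?z t) \<le> g x1 + p \<bullet> v + c * (norm v)\<^sup>2" using p(2)[OF tb] by (simp add: v_def)
  also have "\<dots> < g x1 + p \<bullet> v + \<psi>2 t" using K' c0 by (simp add: t(2) distrib_right)
  also have "\<dots> = \<beta> - ?R t" by (simp add: \<psi>2_def v_def)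
  finally have "?R t + g (?z t) < \<beta>" by simp
  moreover have "z \<notin> interior S" using z by (simp add: closure_complement)
  ultimately show ?thesis
    using value_function_less[OF u, of z t \<beta>] inS tb e(1) t(1) ad by auto
qed

lemma running_cost_dependence:
  assumes u: "admissible_control U u" "admissible_control U u'"
    and agree: "\<And>s. 0 \<le> s \<Longrightarrow> s \<le> T \<Longrightarrow> u' s = u s" and "0 \<le> T"
  shows "\<bar>running_cost z u' T - running_cost x u T\<bar> \<le> L * T * exp (L * T) * norm (z - x)"
proof -
  have hi: "((\<lambda>s. r (trajectory f z u' s) (u' s) - r (trajectory f x u s) (u s)) has_integral
      (running_cost z u' T - running_cost x u T)) {0..T}"
    using has_integral_diff[OF running_cost_has_integral[OF u(2), of 0 T z] running_cost_has_integral[OF u(1), of 0 T x]] \<open>0 \<le> T\<close>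
    by (simp add: running_cost_0 u)
  have "norm (running_cost z u' T - running_cost x u T) \<le> (L * (norm (z - x) * exp (L * T))) * content (cbox 0 T)"
  proof (rule has_integral_bound[OF _ hi[folded cbox_interval]])
    show "0 \<le> L * (norm (z - x) * exp (L * T))" using constants by simp
    fix s assume s: "s \<in> cbox 0 T"
    have "norm (r (trajectory f z u' s) (u' s) - r (trajectory f x u s) (u s)) \<le> L * norm (trajectory f z u' s - trajectory f x u s)"
      using s agree[of s] r_lip[OF control_in_U[OF u(1), of s]] by simp
    also have "\<dots> \<le> L * (norm (z - x) * exp (L * s))"
      using s trajectory_dependence[OF u agree, of T s z x] constants by (intro mult_left_mono) auto
    also have "\<dots> \<le> L * (norm (z - x) * exp (L * T))"
      using s constants by (intro mult_left_mono) auto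
    finally show "norm (r (trajectory f z u' s) (u' s) - r (trajectory f x u s) (u s)) \<le> L * (norm (z - x) * exp (L * T))" .
  qed
  then show ?thesis using \<open>0 \<le> T\<close> by (simp add: mult_ac)
qed

text \<open>The height is the cost of the given control, which may exceed \<open>V x\<close>. The
  constant depends only on the two bounds for the hitting time and on the upper model of
  \<open>g\<close>. The lower bound \<open>Tl\<close> leaves time to stop earlier; the upper bound
  \<open>Tm\<close> controls the exponential factors.\<close>

theorem exterior_sphere_at_cost:
  assumes Tl: "0 < Tl" "Tl \<le> Tm" and e: "e > 0" and c: "c \<ge> 0"
  obtains \<sigma> where "\<sigma> \<ge> 0"
    "\<And>x u T. \<lbrakk>admissible_control U u; x \<notin> S; Tl \<le> T; T \<le> Tm; trajectory f x u T \<in> S;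
       \<And>s. 0 \<le> s \<Longrightarrow> s < T \<Longrightarrow> trajectory f x u s \<notin> S; ball (trajectory f x u T) e \<subseteq> W;
       \<exists>p. \<forall>y\<in>ball (trajectory f x u T) e. g y \<le> g (trajectory f x u T) +
           p \<bullet> (y - trajectory f x u T) + c * (norm (y - trajectory f x u T))\<^sup>2\<rbrakk> \<Longrightarrow>
       \<exists>k\<in>sphere_normals (hypo S (value_function f r g U S)) \<sigma>
           (x, running_cost x u T + g (trajectory f x u T)). 0 \<le> snd k"
proof -
  let ?H = "hypo S (value_function f r g U S)"
  have Tm: "Tm > 0" using Tl by simp
  define E where "E = exp (L * Tm)"
  \<comment> \<open>\<open>B * D\<close> bounds the margin at time \<open>T\<close>: its summands
    come from \<open>\<beta>\<close>, from the change of the running cost and from the linear term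
    of the model. The choice of \<open>\<kappa>\<close> gives
    \<open>\<gamma> * \<kappa> - 1 = B\<close>, as the preceding lemma expects.\<close>
  define B where "B = 1 + L * Tm * E + G * E"
  define \<kappa> where "\<kappa> = (B + 1) / \<gamma>"
  define C3 where "C3 = E + N * \<kappa>"
  define K where "K = (1 / (2 * \<rho>0) + c) * C3\<^sup>2 + 1"
  define Q where "Q = (1 + G + L * Tm) * E"
  define C2 where "C2 = Tm * ((Q + 1) * L * E\<^sup>2)"
  \<comment> \<open>\<open>C2\<close> is the error of the adjoint arc; the remaining terms are the
    surplus that the weighted sum must have at time \<open>T\<close>.\<close>
  define s0 where "s0 = C2 + (2 + G) * L * C3 * \<kappa> + 2 * K"
  \<comment> \<open>\<open>1 / M\<close> will be a lower bound for the norm of the unnormalized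
    normal \<open>(q0, \<mu>)\<close>.\<close>
  define M where "M = (1 + L * Tm) * E + 1 + G"
  define \<delta> where "\<delta> = min (1 / K) (min (e / (2 * C3)) (Tl / \<kappa>))"
  \<comment> \<open>The term \<open>1 / \<delta>\<close> makes the inequality trivial at distance at
    least \<open>\<delta>\<close>; the first term treats the near points.\<close>
  define \<sigma> where "\<sigma> = s0 * M + 1 / \<delta>"
  have E: "E > 0" by (simp add: E_def)
  have "B > 0" using constants Tm E G by (auto simp: B_def intro!: add_pos_nonneg)
  then have \<kappa>: "\<kappa> > 0" using \<gamma>_pos by (simp add: \<kappa>_def)
  have C3: "C3 > 0" using E \<kappa> constants by (simp add: C3_def add_pos_pos)
  have K: "K > 0" using constants c by (auto simp: K_def intro!: add_nonneg_pos mult_nonneg_nonneg add_nonneg_nonneg)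
  have Q: "Q \<ge> 0" using constants Tm E G by (simp add: Q_def)
  have s0: "s0 \<ge> 0" using constants Tm E G C3 \<kappa> K Q by (simp add: s0_def C2_def)
  have M: "M > 0" using constants Tm E G by (auto simp: M_def intro!: add_pos_nonneg mult_pos_pos)
  have \<delta>: "\<delta> > 0" using K C3 \<kappa> e Tl by (simp add: \<delta>_def)
  have \<sigma>: "\<sigma> \<ge> 0" using s0 M \<delta> by (simp add: \<sigma>_def)
  show thesis
  proof (rule that[OF \<sigma>])
    fix x u T
    let ?y = "trajectory f x u"
    let ?J = "running_cost x u T + g (?y T)"
    assume u: "admissible_control U u" and x: "x \<notin> S" and T: "Tl \<le> T" "T \<le> Tm" and hit: "?y T \<in> S"
      "\<And>s. 0 \<le> s \<Longrightarrow> s < T \<Longrightarrow> ?y s \<notin> S" and bW: "ball (?y T) e \<subseteq> W"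
      and "\<exists>p. \<forall>y\<in>ball (?y T) e. g y \<le> g (?y T) + p \<bullet> (y - ?y T) + c * (norm (y - ?y T))\<^sup>2"
    then obtain p where p: "\<And>y. y \<in> ball (?y T) e \<Longrightarrow> g y \<le> g (?y T) + p \<bullet> (y - ?y T) + c * (norm (y - ?y T))\<^sup>2"
      by blast
    define x1 where "x1 = ?y T"
    have T0: "0 < T" "0 \<le> T" using T Tl by auto
    have xi: "x \<notin> interior S" using x interior_subset by blast
    have fr: "x1 \<in> frontier S" unfolding x1_def by (rule hit_in_frontier[OF u xi T0(2) hit])
    then have "x1 \<in> W" using W by blast
    then have pG: "norm p \<le> G"
      using supergradient_norm_le[OF W(1), of x1 g G e p c] g_lip[of x1] p e c G(1) by (simp add: x1_def)
    obtain \<xi> where \<xi>: "norm \<xi> = 1" "\<And>y. y \<in> closure (- S) \<Longrightarrow> \<xi> \<bullet> (y - x1) \<le> 1 / (2 * \<rho>0) * (norm (y - x1))\<^sup>2"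
      using inner_ball[OF fr] by blast
    obtain \<omega>0 where \<omega>0: "\<omega>0 \<in> U" "0 \<le> \<xi> \<bullet> f x1 \<omega>0"
      using entering_velocity_exists[OF u T0(1) hit(2) \<xi>[unfolded x1_def]] unfolding x1_def by blast
    have sec: "continuous_on U (\<lambda>\<omega>. (x1, \<omega>))" "(\<lambda>\<omega>. (x1, \<omega>)) ` U \<subseteq> UNIV \<times> U"
      by (auto intro!: continuous_intros)
    have fc: "continuous_on U (\<lambda>\<omega>. f x1 \<omega>)"
      using continuous_on_compose2[OF f_cont sec] by simp
    have rc: "continuous_on U (\<lambda>\<omega>. r x1 \<omega>)"
      using continuous_on_compose2[OF r_cont sec] by simp
    have rp: "r x1 \<omega> + p \<bullet> f x1 \<omega> > 0" if "\<omega> \<in> U" for \<omega>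
    proof -
      have "\<bar>p \<bullet> f x1 \<omega>\<bar> \<le> G * N"
        using f_bound[OF that, of x1] pG G by (intro order_trans[OF Cauchy_Schwarz_ineq2] mult_mono) auto
      then show ?thesis using r_lower[OF that, of x1] \<gamma>_pos by (simp add: \<gamma>_def)
    qed
    obtain \<theta> \<omega>1 where \<theta>: "0 \<le> \<theta>" "\<theta> \<le> 1" and \<omega>1: "\<omega>1 \<in> U"
      and opt: "0 \<le> \<theta> * (\<xi> \<bullet> f x1 \<omega>1) - (1 - \<theta>) * (r x1 \<omega>1 + p \<bullet> f x1 \<omega>1)"
        "\<And>\<omega>. \<omega> \<in> U \<Longrightarrow> \<theta> * (\<xi> \<bullet> f x1 \<omega>) - (1 - \<theta>) * (r x1 \<omega> + p \<bullet> f x1 \<omega>) \<le> 0"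
      by (rule balanced_weight_exists[of U "\<lambda>\<omega>. \<xi> \<bullet> f x1 \<omega>" "\<lambda>\<omega>. r x1 \<omega> + p \<bullet> f x1 \<omega>", OF compact_U _ _ rp \<omega>0])
        (auto intro!: continuous_intros fc rc intro: that)
    define \<mu> where "\<mu> = 1 - \<theta>"
    have \<mu>: "0 \<le> \<mu>" "\<mu> \<le> 1" using \<theta> by (auto simp: \<mu>_def)
    define qT where "qT = \<theta> *\<^sub>R \<xi> - \<mu> *\<^sub>R p"
    obtain q0 where q0: "norm qT \<le> (norm q0 + \<mu> * L * T) * exp (L * T)"
      and dual: "\<And>z u'. admissible_control U u' \<Longrightarrow> (\<And>s. 0 \<le> s \<Longrightarrow> s \<le> T \<Longrightarrow> u' s = u s) \<Longrightarrow>
       q0 \<bullet> (z - x) - T * (((norm qT + \<mu> * L * T) * exp (L * T) + \<mu>) * L * (exp (L * T))\<^sup>2) * (norm (z - x))\<^sup>2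
       \<le> qT \<bullet> (trajectory f z u' T - trajectory f x u T) - \<mu> * (running_cost z u' T - running_cost x u T)"
      using adjoint_arc_exists[OF u T0(2) \<mu>(1), of qT x] by blast
    have eT: "exp (L * T) \<le> E" "1 \<le> exp (L * T)" using T T0 constants by (auto simp: E_def)
    have LT: "L * T \<le> L * Tm" using T constants by simp
    have muLT: "\<mu> * L * T \<le> L * Tm"
      using mult_mono[OF \<mu>(2) LT] \<mu> constants T0 by (simp add: mult.assoc)
    have nqT: "norm qT \<le> 1 + G"
    proof -
      have "norm qT \<le> \<theta> * norm \<xi> + \<mu> * norm p"
        unfolding qT_def using norm_triangle_ineq4[of "\<theta> *\<^sub>R \<xi>" "\<mu> *\<^sub>R p"] \<theta> \<mu> by simp
      also have "\<dots> \<le> 1 * 1 + 1 * G" using \<theta> \<mu> \<xi> pG by (intro add_mono mult_mono) auto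
      finally show ?thesis by simp
    qed
    define n where "n = norm (q0, \<mu>)"
    have nq: "norm q0 \<le> n" "\<mu> \<le> n"
      using norm_fst_le[of q0 \<mu>] norm_snd_le[of \<mu> q0] \<mu> by (auto simp: n_def)
    \<comment> \<open>The normal cannot be small: \<open>\<theta> + \<mu> = 1\<close>,
      \<open>\<theta>\<close> is at most \<open>norm qT + \<mu> * norm p\<close>, and Gronwall's
      inequality bounds \<open>norm qT\<close> by \<open>norm q0\<close> and
      \<open>\<mu>\<close>.\<close>
    have "1 \<le> n * M"
    proof -
      have n0: "0 \<le> n" by (simp add: n_def)
      have "\<mu> * L * T \<le> n * (L * Tm)"
        using mult_mono[OF nq(2) LT] n0 \<mu> constants T0 by (simp add: mult.assoc)
      then have "(norm q0 + \<mu> * L * T) * exp (L * T) \<le> (n + n * (L * Tm)) * E"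
        using n0 constants Tm by (intro mult_mono[OF add_mono[OF nq(1)] eT(1)]) auto
      then have 1: "norm qT \<le> (n + n * (L * Tm)) * E" using q0 by linarith
      have "\<theta> *\<^sub>R \<xi> = qT + \<mu> *\<^sub>R p" by (simp add: qT_def)
      then have "\<theta> \<le> norm qT + \<mu> * norm p"
        using norm_triangle_ineq[of qT "\<mu> *\<^sub>R p"] \<xi>(1) \<theta> \<mu> by (metis abs_of_nonneg mult.right_neutral norm_scaleR)
      moreover have "\<mu> * norm p \<le> n * G" using nq(2) pG n0 by (intro mult_mono) auto
      ultimately have "1 \<le> (n + n * (L * Tm)) * E + n * G + n" using 1 nq(2) by (simp add: \<mu>_def)
      then show ?thesis by (simp add: M_def algebra_simps)
    qed
    then have n: "n > 0" using M by (metis less_le_trans zero_less_mult_pos2 zero_less_one)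
    define k where "k = (1 / n) *\<^sub>R (q0, \<mu>)"
    have "norm k = 1" using n by (simp add: k_def n_def[symmetric] del: scaleR_Pair)
    moreover have "k \<bullet> (a - (x, ?J)) \<le> \<sigma> * (norm (a - (x, ?J)))\<^sup>2" if a: "a \<in> ?H" for a
    proof (rule ccontr)
      assume viol: "\<not> ?thesis"
      obtain z \<beta> where zb: "a = (z, \<beta>)" by fastforce
      have z: "z \<in> closure (- S)" and \<beta>: "ereal \<beta> \<le> value_function f r g U S z"
        using a zb by (auto simp: hypo_def)
      define D where "D = norm (a - (x, ?J))"
      have kD: "k \<bullet> (a - (x, ?J)) \<le> D"
        using norm_cauchy_schwarz[of k "a - (x, ?J)"] \<open>norm k = 1\<close> by (simp add: D_def)
      have D0: "D \<noteq> 0" using viol by (auto simp: D_def)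
      then have Dpos: "D > 0" by (simp add: D_def)
      have "D < \<delta>"
      proof (rule ccontr)
        assume "\<not> D < \<delta>"
        then have "D \<le> (1 / \<delta>) * D\<^sup>2" using \<delta> Dpos by (simp add: field_simps power2_eq_square)
        also have "\<dots> \<le> \<sigma> * D\<^sup>2" using s0 M by (intro mult_right_mono) (auto simp: \<sigma>_def)
        finally show False using viol kD by (simp add: D_def)
      qed
      then have D: "K * D \<le> 1" "C3 * D < e" "\<kappa> * D \<le> T"
      proof -
        assume "D < \<delta>"
        then have "D < 1 / K" "D < e / (2 * C3)" "D < Tl / \<kappa>" by (auto simp: \<delta>_def)
        then show "K * D \<le> 1" "C3 * D < e" "\<kappa> * D \<le> T" using K C3 \<kappa> T e Dpos by (auto simp: field_simps)
      qed
      have zx: "norm (z - x) \<le> D" "\<bar>\<beta> - ?J\<bar> \<le> D"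
        using norm_fst_le[of "z - x" "\<beta> - ?J"] norm_snd_le[of "\<beta> - ?J" "z - x"] by (simp_all add: D_def zb)
      \<comment> \<open>The perturbed start follows the old control up to \<open>T\<close> and then
        the maximizer \<open>\<omega>1\<close>.\<close>
      define u' where "u' = (\<lambda>t. if t \<le> T then u t else \<omega>1)"
      have u': "admissible_control U u'" unfolding u'_def by (rule admissible_control_switch[OF u \<omega>1])
      have agree: "\<And>s. 0 \<le> s \<Longrightarrow> s \<le> T \<Longrightarrow> u' s = u s" by (simp add: u'_def)
      define w where "w = trajectory f z u' T - x1"
      define \<Delta> where "\<Delta> = running_cost z u' T - running_cost x u T"
      have nw: "norm w \<le> E * D"
      proof -
        have "norm w \<le> norm (z - x) * exp (L * T)"
          using trajectory_dependence[OF u u' agree T0(2) order_refl, of z x] by (simp add: w_def x1_def)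
        also have "\<dots> \<le> D * E" using zx eT Dpos by (intro mult_mono) auto
        finally show ?thesis by (simp add: mult.commute)
      qed
      have nd: "\<bar>\<Delta>\<bar> \<le> L * Tm * E * D"
      proof -
        have "\<bar>\<Delta>\<bar> \<le> L * T * exp (L * T) * norm (z - x)"
          unfolding \<Delta>_def by (rule running_cost_dependence[OF u u' agree T0(2)])
        also have "\<dots> \<le> L * Tm * E * D"
          using zx eT LT Dpos constants T0 Tm E by (intro mult_mono) auto
        finally show ?thesis .
      qed
      have "s0 * D\<^sup>2 \<le> n * (\<sigma> * D\<^sup>2)"
      proof -
        have "s0 * 1 \<le> s0 * (n * M)" using \<open>1 \<le> n * M\<close> s0 by (intro mult_left_mono) auto
        also have "\<dots> \<le> n * \<sigma>" using n \<delta> by (simp add: \<sigma>_def algebra_simps)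
        finally show ?thesis by (simp add: mult.assoc[symmetric] mult_right_mono)
      qed
      also have "\<dots> \<le> n * (k \<bullet> (a - (x, ?J)))" using viol n by (intro mult_left_mono) (auto simp: D_def)
      also have "\<dots> = q0 \<bullet> (z - x) + \<mu> * (\<beta> - ?J)" using n by (simp add: k_def zb algebra_simps)
      finally have 1: "s0 * D\<^sup>2 \<le> q0 \<bullet> (z - x) + \<mu> * (\<beta> - ?J)" .
      have "T * (((norm qT + \<mu> * L * T) * exp (L * T) + \<mu>) * L * (exp (L * T))\<^sup>2) * (norm (z - x))\<^sup>2 \<le> C2 * D\<^sup>2"
        unfolding C2_def Q_def
        using T T0 nqT muLT eT \<mu> zx constants Tm G E Dpos
        by (intro mult_mono power_mono add_mono) (auto intro!: add_nonneg_nonneg mult_nonneg_nonneg)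
      then have 2: "q0 \<bullet> (z - x) - C2 * D\<^sup>2 \<le> qT \<bullet> w - \<mu> * \<Delta>"
        using dual[OF u' agree, of z] by (simp add: w_def x1_def \<Delta>_def)
      define b where "b = \<beta> - running_cost z u' T - g x1"
      have b: "b = (\<beta> - ?J) - \<Delta>" by (simp add: b_def \<Delta>_def x1_def)
      have "s0 * D\<^sup>2 - C2 * D\<^sup>2 \<le> qT \<bullet> w + \<mu> * b" using 1 2 by (simp add: b algebra_simps)
      also have "\<dots> = \<theta> * (\<xi> \<bullet> w) + (1 - \<theta>) * (b - p \<bullet> w)"
        by (simp add: qT_def \<mu>_def inner_diff_left algebra_simps)
      finally have 3: "((2 + G) * L * C3 * \<kappa> + 2 * K) * D\<^sup>2 \<le> \<theta> * (\<xi> \<bullet> w) + (1 - \<theta>) * (b - p \<bullet> w)"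
        by (simp add: s0_def algebra_simps)
      have "\<bar>p \<bullet> w\<bar> \<le> G * (E * D)"
        using pG nw G by (intro order_trans[OF Cauchy_Schwarz_ineq2] mult_mono) auto
      then have "\<bar>b - p \<bullet> w\<bar> \<le> D + L * Tm * E * D + G * (E * D)" using zx(2) nd unfolding b by linarith
      also have "\<dots> = B * D" by (simp add: B_def algebra_simps)
      also have "B = \<gamma> * \<kappa> - 1" using \<gamma>_pos by (simp add: \<kappa>_def)
      finally have 4: "\<bar>b - p \<bullet> w\<bar> \<le> (\<gamma> * \<kappa> - 1) * D" .
      have "value_function f r g U S z < ereal \<beta>"
      proof (rule value_function_less_near_hit[where ?C1.0 = E and \<kappa> = \<kappa> and ?C3.0 = C3 and K = K, OF u' z fr \<xi> pG p[folded x1_def] bW[folded x1_def] c \<theta> _ opt Dpos])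
        show "u' s = \<omega>1" if "T < s" for s using that by (simp add: u'_def)
        show "norm (trajectory f z u' T - x1) \<le> E * D" using nw by (simp add: w_def)
      qed (assumption | rule \<kappa> D C3_def K_def 3[unfolded b_def w_def] 4[unfolded b_def w_def])+
      then show False using \<beta> by simp
    qed
    ultimately have "k \<in> sphere_normals ?H \<sigma> (x, ?J)" by (simp add: sphere_normals_def)
    \<comment> \<open>The sign is recorded for the limit argument, where it forces the normals at
      frontier points above the limit height to be horizontal.\<close>
    moreover have "0 \<le> snd k" using n \<mu> by (simp add: k_def)
    ultimately show "\<exists>k\<in>sphere_normals ?H \<sigma> (x, ?J). 0 \<le> snd k" by blast
  qed
qed

section \<open>Bounds for the value function, and spheres at all frontier points of the closed
  hypograph\<close>

abbreviation (input) "V \<equiv> value_function f r g U S"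

lemma value_function_less_imp_cost:
  assumes "V x < ereal \<beta>"
  obtains u T where "admissible_control U u" "hitting_time f S x u = ereal T" "0 \<le> T" "trajectory f x u T \<in> S"
    "\<And>s. 0 \<le> s \<Longrightarrow> s < T \<Longrightarrow> trajectory f x u s \<notin> S"
    "running_cost x u T + g (trajectory f x u T) < \<beta>"
proof -
  obtain u where u: "admissible_control U u" "hitting_time f S x u < \<infinity>" "exit_cost f r g S x u < \<beta>"
    using assms unfolding value_function_def INF_less_iff by auto
  then obtain t where "0 \<le> t" "trajectory f x u t \<in> S" unfolding hitting_time_finite_iff by blast
  then obtain T where T: "hitting_time f S x u = ereal T" "0 \<le> T" "trajectory f x u T \<in> S"
    "\<And>s. 0 \<le> s \<Longrightarrow> s < T \<Longrightarrow> trajectory f x u s \<notin> S"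
    using hitting_time_attained[OF u(1) closed_S] by metis
  then show thesis using that[OF u(1) T] u(3) exit_cost_eq[OF u(1) T(1)] by simp
qed

lemma value_function_unreachable:
  assumes "x \<notin> reachable_set f U S" shows "V x = \<infinity>"
proof -
  have "{u. admissible_control U u \<and> hitting_time f S x u < \<infinity>} = {}"
    using assms unfolding reachable_set_def by blast
  then show ?thesis unfolding value_function_def by (simp only: INF_empty top_ereal_def)
qed

lemma value_function_reachable: "x \<in> reachable_set f U S \<Longrightarrow> V x < \<infinity>"
  unfolding value_function_def reachable_set_def INF_less_iff by auto

text \<open>The end point is within \<open>N * T\<close> of \<open>x\<close>, so the terminal cost
  falls below \<open>g w\<close> by at most \<open>G * (norm (x - w) + N * T)\<close>, while the
  running cost is at least \<open>r0 * T\<close>. Thus a bounded cost entails a bounded hitting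
  time.\<close>

lemma cost_lower_bound:
  assumes u: "admissible_control U u" and x: "x \<notin> S" and T: "0 \<le> T" "trajectory f x u T \<in> S"
    "\<And>s. 0 \<le> s \<Longrightarrow> s < T \<Longrightarrow> trajectory f x u s \<notin> S" and w: "w \<in> frontier S"
  shows "g w - G * norm (x - w) + \<gamma> * T \<le> running_cost x u T + g (trajectory f x u T)"
proof -
  let ?y = "trajectory f x u T"
  have "x \<notin> interior S" using x interior_subset by blast
  then have "?y \<in> frontier S" by (rule hit_in_frontier[OF u _ T])
  then have "\<bar>g w - g ?y\<bar> \<le> G * norm (w - ?y)" using W w by (intro g_lip) auto
  moreover have "norm (w - ?y) \<le> norm (x - w) + N * T"
    using trajectory_lipschitz(1)[OF u, of 0 T x] T norm_triangle_ineq4[of "w - x" "?y - x"]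
    by (simp add: trajectory_0[OF u] norm_minus_commute)
  then have "G * norm (w - ?y) \<le> G * (norm (x - w) + N * T)" using G by (intro mult_left_mono)
  moreover have "r0 * T \<le> running_cost x u T"
    using running_cost_growth[OF u, of 0 T x] T by (simp add: running_cost_0 u)
  moreover have "\<gamma> * T = r0 * T - G * (N * T)" by (simp add: \<gamma>_def algebra_simps)
  moreover have "G * (norm (x - w) + N * T) = G * norm (x - w) + G * (N * T)" by (simp add: distrib_left)
  ultimately show ?thesis by linarith
qed

lemma frontier_target_nonempty:
  assumes "x \<notin> S" "S \<noteq> {}" shows "frontier S \<noteq> {}"
  using assms frontier_eq_empty by blast

text \<open>\<open>g\<close> may be unbounded below, so finiteness rests on the Lipschitz comparison
  of all possible end points with one fixed frontier point \<open>w\<close>.\<close>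

lemma value_function_real:
  assumes x: "x \<in> reachable_set f U S - S"
  shows "ereal (real_of_ereal (V x)) = V x"
proof -
  obtain u where u: "admissible_control U u" "hitting_time f S x u < \<infinity>"
    using x by (auto simp: reachable_set_def)
  then obtain y where "y \<in> S" unfolding hitting_time_finite_iff by blast
  then obtain w where w: "w \<in> frontier S" using frontier_target_nonempty x by blast
  have "ereal (g w - G * norm (x - w)) \<le> V x"
  proof (rule ccontr)
    assume "\<not> ?thesis"
    then obtain u T where uT: "admissible_control U u" "0 \<le> T" "trajectory f x u T \<in> S"
      "\<And>s. 0 \<le> s \<Longrightarrow> s < T \<Longrightarrow> trajectory f x u s \<notin> S"
      "running_cost x u T + g (trajectory f x u T) < g w - G * norm (x - w)"
      using value_function_less_imp_cost[of x "g w - G * norm (x - w)"] by (metis not_le)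
    have "g w - G * norm (x - w) + \<gamma> * T \<le> running_cost x u T + g (trajectory f x u T)"
      using cost_lower_bound[OF uT(1) _ uT(2-4) w] x by blast
    moreover have "\<gamma> * T \<ge> 0" using \<gamma>_pos uT(2) by simp
    ultimately show False using uT(5) by linarith
  qed
  moreover have "V x < \<infinity>" using value_function_reachable x by blast
  ultimately show ?thesis by (cases "V x") auto
qed

text \<open>A frontier point above the graph is a limit of points \<open>(z, J)\<close> with spheres lying below it;
  their limit normal is then horizontal, so the sphere may be translated upwards.\<close>

theorem hypo_exterior_sphere:
  assumes x0: "x0 \<notin> S" and S: "S \<noteq> {}" and sc: "locally_semiconcave g"
  obtains \<sigma> \<delta> where "\<sigma> \<ge> 0" "\<delta> > 0"
    "\<And>p. p \<in> frontier (closure (hypo S V)) \<Longrightarrow> dist p (x0, \<beta>0) < \<delta> \<Longrightarrow>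
       sphere_normals (closure (hypo S V)) \<sigma> p \<noteq> {}"
proof -
  let ?H = "closure (hypo S V)"
  obtain w where w: "w \<in> frontier S" using frontier_target_nonempty[OF x0 S] by blast
  define d0 where "d0 = infdist x0 S"
  have d0: "d0 > 0" using infdist_pos_not_in_closed[OF closed_S S x0] by (simp add: d0_def)
  define \<delta> where "\<delta> = min 1 (d0 / 4)"
  have \<delta>: "\<delta> > 0" "\<delta> \<le> 1" "\<delta> \<le> d0 / 4" using d0 by (auto simp: \<delta>_def)
  \<comment> \<open>Starting points within \<open>2 * \<delta>\<close> of \<open>x0\<close> are at
    least \<open>d0 / 2\<close> away from \<open>S\<close>, and the speed is below
    \<open>N\<close>.\<close>
  define Tl where "Tl = d0 / (2 * N)"
  have Tl: "Tl > 0" using d0 constants by (simp add: Tl_def)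
  define A where "A = G * (norm (x0 - w) + 2)"
  \<comment> \<open>A control of cost below \<open>\<beta>0 + 2\<close> has its hitting time bounded
    by the quotient; \<open>A\<close> allows for starting points at distance up to 2 from
    \<open>x0\<close>.\<close>
  define Tm where "Tm = max Tl ((\<beta>0 + 2 - g w + A) / \<gamma>)"
  have Tm: "Tl \<le> Tm" by (simp add: Tm_def)
  \<comment> \<open>All end points of the trajectories in question lie in this compact set, on which
    the upper model of \<open>g\<close> and the distance to the complement of \<open>W\<close> are
    uniform.\<close>
  define K where "K = frontier S \<inter> cball x0 (2 + N * Tm)"
  have "compact K" by (simp add: K_def closed_Int_compact)
  then obtain e1 c where e1: "e1 > 0" "c > 0"
    "\<And>x. x \<in> K \<Longrightarrow> \<exists>p. \<forall>y\<in>ball x e1. g y \<le> g x + p \<bullet> (y - x) + c * (norm (y - x))\<^sup>2"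
    using locally_semiconcave_upper_model_compact[OF sc] by metis
  have "K \<subseteq> W" using W by (auto simp: K_def)
  then obtain e2 where e2: "e2 > 0" "(\<Union>x\<in>K. ball x e2) \<subseteq> W"
    using compact_subset_open_imp_ball_epsilon_subset[OF \<open>compact K\<close> W(1)] by blast
  define e where "e = min e1 e2"
  have e: "e > 0" using e1 e2 by (simp add: e_def)
  obtain \<sigma> where \<sigma>: "\<sigma> \<ge> 0" and sphere: "\<And>x u T. \<lbrakk>admissible_control U u; x \<notin> S; Tl \<le> T; T \<le> Tm; trajectory f x u T \<in> S;
       \<And>s. 0 \<le> s \<Longrightarrow> s < T \<Longrightarrow> trajectory f x u s \<notin> S; ball (trajectory f x u T) e \<subseteq> W;
       \<exists>p. \<forall>y\<in>ball (trajectory f x u T) e. g y \<le> g (trajectory f x u T) +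
           p \<bullet> (y - trajectory f x u T) + c * (norm (y - trajectory f x u T))\<^sup>2\<rbrakk> \<Longrightarrow>
       \<exists>k\<in>sphere_normals (hypo S V) \<sigma> (x, running_cost x u T + g (trajectory f x u T)). 0 \<le> snd k"
    by (rule exterior_sphere_at_cost[OF Tl Tm e less_imp_le[OF e1(2)]]) blast
  have near: "\<exists>J k. g w - A \<le> J \<and> J < b \<and> k \<in> sphere_normals (hypo S V) \<sigma> (z, J) \<and> 0 \<le> snd k"
    if zb: "(z, b) \<notin> hypo S V" "dist (z, b) (x0, \<beta>0) < 2 * \<delta>" for z b
  proof -
    have dz: "dist z x0 < 2 * \<delta>" "\<bar>b - \<beta>0\<bar> < 2 * \<delta>"
      using zb(2) dist_fst_le[of "(z, b)" "(x0, \<beta>0)"] dist_snd_le[of "(z, b)" "(x0, \<beta>0)"]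
      by (auto simp: dist_real_def)
    have far: "d0 / 2 \<le> dist z y" if "y \<in> S" for y
      using infdist_le[OF that, of x0] dist_triangle[of x0 y z] dz \<delta> by (simp add: d0_def dist_commute)
    have zS: "z \<notin> S" using far[of z] d0 by auto
    then have "z \<in> closure (- S)" using closure_subset by blast
    then have "V z < ereal b" using zb(1) by (auto simp: hypo_def)
    then obtain u T where uT: "admissible_control U u" "0 \<le> T" "trajectory f z u T \<in> S"
      "\<And>s. 0 \<le> s \<Longrightarrow> s < T \<Longrightarrow> trajectory f z u s \<notin> S"
      "running_cost z u T + g (trajectory f z u T) < b"
      by (rule value_function_less_imp_cost) blast
    let ?y = "trajectory f z u T"
    have ny: "norm (?y - z) \<le> N * T"
      using trajectory_lipschitz(1)[OF uT(1), of 0 T z] uT(2) by (simp add: trajectory_0[OF uT(1)])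
    have "norm (z - w) \<le> norm (x0 - w) + 2"
      using dz \<delta> norm_triangle_ineq[of "z - x0" "x0 - w"] by (simp add: dist_norm)
    then have "G * norm (z - w) \<le> A" unfolding A_def using G by (intro mult_left_mono)
    then have low: "g w - A + \<gamma> * T \<le> running_cost z u T + g ?y"
      using cost_lower_bound[OF uT(1) zS uT(2-4) w] by linarith
    have "d0 / 2 \<le> N * T" using far[OF uT(3)] ny by (simp add: dist_norm norm_minus_commute)
    then have "Tl \<le> T" using constants by (simp add: Tl_def field_simps)
    have "\<gamma> * T \<le> \<beta>0 + 2 - g w + A" using low uT(5) dz(2) \<delta> by linarith
    then have "T \<le> (\<beta>0 + 2 - g w + A) / \<gamma>" using \<gamma>_pos by (simp add: field_simps)
    then have "T \<le> Tm" by (simp add: Tm_def)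
    have "z \<notin> interior S" using zS interior_subset by blast
    then have fr: "?y \<in> frontier S" by (rule hit_in_frontier[OF uT(1) _ uT(2-4)])
    have "dist x0 ?y \<le> 2 + N * Tm"
    proof -
      have "dist x0 ?y \<le> dist z x0 + norm (?y - z)"
        using dist_triangle[of x0 ?y z] by (simp add: dist_commute dist_norm norm_minus_commute)
      moreover have "N * T \<le> N * Tm" using \<open>T \<le> Tm\<close> constants by simp
      ultimately show ?thesis using dz \<delta> ny by linarith
    qed
    then have yK: "?y \<in> K" using fr by (simp add: K_def)
    have "ball ?y e \<subseteq> W" using e2(2) yK by (force simp: e_def)
    moreover have "\<exists>p. \<forall>y\<in>ball ?y e. g y \<le> g ?y + p \<bullet> (y - ?y) + c * (norm (y - ?y))\<^sup>2"
      using e1(3)[OF yK] by (force simp: e_def)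
    ultimately obtain k where "k \<in> sphere_normals (hypo S V) \<sigma> (z, running_cost z u T + g ?y)" "0 \<le> snd k"
      using sphere[OF uT(1) zS \<open>Tl \<le> T\<close> \<open>T \<le> Tm\<close> uT(3,4)] by blast
    moreover have "g w - A \<le> running_cost z u T + g ?y"
      using low mult_nonneg_nonneg[OF less_imp_le[OF \<gamma>_pos] uT(2)] by linarith
    ultimately show ?thesis using uT(5) by blast
  qed
  show thesis
  proof (rule that[OF \<sigma> \<delta>(1)])
    fix p assume p: "p \<in> frontier ?H" "dist p (x0, \<beta>0) < \<delta>"
    obtain z b where zb: "p = (z, b)" by fastforce
    have pH: "(z, b) \<in> ?H" using p(1) zb by (simp add: frontier_def)
    have "p \<in> closure (- ?H)" using p(1) by (simp add: frontier_def closure_complement)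
    then obtain pn where pn: "\<And>n. pn n \<in> - ?H" "pn \<longlonglongrightarrow> p"
      unfolding closure_sequential by blast
    have "eventually (\<lambda>n. dist (pn n) p < \<delta>) sequentially" using pn(2) \<delta>(1) by (rule tendstoD)
    then obtain m where m: "\<And>n. n \<ge> m \<Longrightarrow> dist (pn n) p < \<delta>" by (auto simp: eventually_sequentially)
    define q where "q n = pn (n + m)" for n
    have q: "q \<longlonglongrightarrow> (z, b)" unfolding q_def zb[symmetric] using pn(2) by (rule LIMSEQ_ignore_initial_segment)
    have "\<exists>J k. g w - A \<le> J \<and> J < snd (q n) \<and> k \<in> sphere_normals (hypo S V) \<sigma> (fst (q n), J) \<and> 0 \<le> snd k" for n
    proof (rule near)
      show "(fst (q n), snd (q n)) \<notin> hypo S V" using pn(1)[of "n + m"] closure_subset by (auto simp: q_def)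
      show "dist (fst (q n), snd (q n)) (x0, \<beta>0) < 2 * \<delta>"
        using dist_triangle[of "q n" "(x0, \<beta>0)" p] m[of "n + m"] p(2) by (simp add: q_def)
    qed
    then obtain J k where Jk: "\<And>n. g w - A \<le> J n" "\<And>n. J n < snd (q n)"
      "\<And>n. k n \<in> sphere_normals (hypo S V) \<sigma> (fst (q n), J n)" "\<And>n. 0 \<le> snd (k n)" by metis
    have sq: "(\<lambda>n. snd (q n)) \<longlonglongrightarrow> b" "(\<lambda>n. fst (q n)) \<longlonglongrightarrow> z"
      using tendsto_snd[OF q] tendsto_fst[OF q] by auto
    obtain B where B: "\<And>n. \<bar>snd (q n)\<bar> \<le> B"
      using convergent_imp_Bseq[of "\<lambda>n. snd (q n)"] sq(1) unfolding Bseq_def convergent_def by auto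
    \<comment> \<open>The heights are bounded below by the cost estimate and above by the convergent
      last coordinates of \<open>q\<close>.\<close>
    have "bounded (range (\<lambda>n. (k n, J n)))"
    proof (rule bounded_subset)
      show "range (\<lambda>n. (k n, J n)) \<subseteq> cball 0 1 \<times> {g w - A..B}"
        using Jk(1) Jk(3) order_trans[OF less_imp_le[OF Jk(2)] order_trans[OF abs_ge_self B]]
        by (auto simp: sphere_normals_def)
    qed (intro bounded_Times bounded_cball bounded_closed_interval)
    then obtain l s where s: "strict_mono (s :: nat \<Rightarrow> nat)" "((\<lambda>n. (k n, J n)) \<circ> s) \<longlonglongrightarrow> l"
      using bounded_imp_convergent_subsequence by blast
    define k0 where "k0 = fst l"
    define J0 where "J0 = snd l"
    have lim: "(\<lambda>n. k (s n)) \<longlonglongrightarrow> k0" "(\<lambda>n. J (s n)) \<longlonglongrightarrow> J0"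
      using tendsto_fst[OF s(2)] tendsto_snd[OF s(2)] by (auto simp: k0_def J0_def o_def)
    have sqs: "(\<lambda>n. snd (q (s n))) \<longlonglongrightarrow> b" "(\<lambda>n. fst (q (s n))) \<longlonglongrightarrow> z"
      using LIMSEQ_subseq_LIMSEQ[OF sq(1) s(1)] LIMSEQ_subseq_LIMSEQ[OF sq(2) s(1)] by (auto simp: o_def)
    have "k0 \<in> sphere_normals (hypo S V) \<sigma> (z, J0)"
      by (rule sphere_normals_limit[OF tendsto_Pair[OF sqs(2) lim(2)] lim(1) Jk(3)])
    then have k0: "k0 \<in> sphere_normals ?H \<sigma> (z, J0)" by (simp add: sphere_normals_closure)
    have "J0 \<le> b"
      by (rule LIMSEQ_le[OF lim(2) sqs(1)]) (auto intro: less_imp_le Jk(2))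
    have \<mu>0: "0 \<le> snd k0"
      by (rule LIMSEQ_le_const[OF tendsto_snd[OF lim(1)]]) (auto intro: Jk(4))
    obtain \<kappa> \<mu> where k\<mu>: "k0 = (\<kappa>, \<mu>)" by fastforce
    show "sphere_normals ?H \<sigma> p \<noteq> {}"
    proof (cases "J0 = b")
      case True
      then show ?thesis using k0 zb by auto
    next
      case False
      then have "J0 < b" using \<open>J0 \<le> b\<close> by simp
      have sph: "\<kappa> \<bullet> (z' - z) + \<mu> * (b' - J0) \<le> \<sigma> * ((norm (z' - z))\<^sup>2 + (b' - J0)\<^sup>2)"
        if "(z', b') \<in> ?H" for z' b'
      proof -
        have "k0 \<bullet> ((z', b') - (z, J0)) \<le> \<sigma> * (norm ((z', b') - (z, J0)))\<^sup>2"
          using k0 that unfolding sphere_normals_def by blast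
        then show ?thesis by (simp add: k\<mu> norm_Pair)
      qed
      \<comment> \<open>The vertical segment between \<open>(z, J0)\<close> and
        \<open>(z, b)\<close> lies in \<open>?H\<close>, since \<open>(z, b)\<close> does; the
        sphere at its lower end tolerates it only if the normal has no upward component.\<close>
      have "\<mu> \<le> t * \<sigma>" if t: "0 < t" "t \<le> b - J0" for t
      proof -
        have "(z, J0 + t) \<in> ?H" using closure_hypo_downward[OF pH] t by simp
        from sph[OF this] have "t * \<mu> \<le> t * (t * \<sigma>)" by (simp add: power2_eq_square mult_ac)
        then show ?thesis using t by simp
      qed
      then have ev: "eventually (\<lambda>t. \<mu> \<le> t * \<sigma>) (at_right 0)"
        using \<open>J0 < b\<close> unfolding eventually_at_right_field by (intro exI[of _ "b - J0"]) auto
      have "((\<lambda>t. t * \<sigma>) \<longlongrightarrow> 0 * \<sigma>) (at_right 0)" by (intro tendsto_intros)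
      then have "\<mu> \<le> 0" using tendsto_lowerbound[OF _ ev] by auto
      then have "\<mu> = 0" using \<mu>0 k\<mu> by simp
      have "k0 \<bullet> (a - (z, b)) \<le> \<sigma> * (norm (a - (z, b)))\<^sup>2" if a: "a \<in> ?H" for a
      proof -
        obtain z' b' where a': "a = (z', b')" by fastforce
        \<comment> \<open>Before the sphere at height \<open>J0\<close> is applied, the point is
          lowered to \<open>min b' J0\<close>. It stays in \<open>?H\<close>, and its vertical
          distance to \<open>J0\<close> is at most that of \<open>b'\<close> to
          \<open>b\<close>.\<close>
        have "(z', min b' J0) \<in> ?H" using closure_hypo_downward[of z' b' S V "min b' J0"] a a' by simp
        from sph[OF this] have "\<kappa> \<bullet> (z' - z) \<le> \<sigma> * ((norm (z' - z))\<^sup>2 + (min b' J0 - J0)\<^sup>2)"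
          by (simp add: \<open>\<mu> = 0\<close>)
        also have "\<dots> \<le> \<sigma> * ((norm (z' - z))\<^sup>2 + (b' - b)\<^sup>2)"
        proof (intro mult_left_mono add_left_mono \<sigma>)
          have "\<bar>min b' J0 - J0\<bar> \<le> \<bar>b' - b\<bar>" using \<open>J0 < b\<close> by (auto simp: min_def)
          then show "(min b' J0 - J0)\<^sup>2 \<le> (b' - b)\<^sup>2" unfolding abs_le_square_iff[symmetric] .
        qed
        finally show ?thesis by (simp add: k\<mu> a' \<open>\<mu> = 0\<close> norm_Pair)
      qed
      then have "k0 \<in> sphere_normals ?H \<sigma> p" using k0 zb by (simp add: sphere_normals_def)
      then show ?thesis by blast
    qed
  qed
qed

text \<open>Off the reachable set \<open>V\<close> is infinite, so continuity relative to that set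
  already puts a full neighbourhood of every point strictly below the graph into the
  hypograph.\<close>

lemma graph_in_closure_interior_hypo:
  assumes x: "x \<in> reachable_set f U S - S" and cont: "continuous_on (reachable_set f U S) V"
  shows "(x, real_of_ereal (V x)) \<in> closure (interior (hypo S V))"
proof -
  let ?v = "real_of_ereal (V x)"
  have below: "(x, ?v - \<epsilon>) \<in> interior (hypo S V)" if "\<epsilon> > 0" for \<epsilon>
  proof -
    have "ereal (?v - \<epsilon> / 2) < ereal ?v" using that by simp
    then have lt: "ereal (?v - \<epsilon> / 2) < V x" by (simp add: value_function_real[OF x])
    have "(V \<longlongrightarrow> V x) (at x within reachable_set f U S)"
      using cont x by (simp add: continuous_on)
    then have "eventually (\<lambda>y. ereal (?v - \<epsilon> / 2) < V y) (at x within reachable_set f U S)"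
      using lt by (rule order_tendstoD)
    then obtain d1 where d1: "d1 > 0" "\<And>y. y \<in> reachable_set f U S \<Longrightarrow> dist y x < d1 \<Longrightarrow> ereal (?v - \<epsilon> / 2) < V y"
      unfolding eventually_at using lt by metis
    obtain d2 where d2: "d2 > 0" "ball x d2 \<subseteq> - S"
      using open_contains_ball[of "- S"] closed_S x by auto
    define d where "d = min d1 d2"
    have "ball x d \<times> {..<?v - \<epsilon> / 2} \<subseteq> hypo S V"
    proof clarify
      fix y b assume y: "y \<in> ball x d" and b: "b < ?v - \<epsilon> / 2"
      have "y \<in> closure (- S)" using y d2 closure_subset by (fastforce simp: d_def)
      moreover have "ereal (?v - \<epsilon> / 2) \<le> V y"
        using d1(2)[of y] y value_function_unreachable[of y] by (cases "y \<in> reachable_set f U S") (auto simp: d_def dist_commute less_imp_le)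
      then have "ereal b \<le> V y" using b by (meson ereal_less_eq(3) less_imp_le order_trans)
      ultimately show "(y, b) \<in> hypo S V" by (simp add: hypo_def)
    qed
    moreover have "open (ball x d \<times> {..<?v - \<epsilon> / 2})" by (intro open_Times) auto
    moreover have "(x, ?v - \<epsilon>) \<in> ball x d \<times> {..<?v - \<epsilon> / 2}" using that d1 d2 by (simp add: d_def)
    ultimately show ?thesis by (meson interiorI)
  qed
  have "(\<lambda>n. (x, ?v - 1 / real (Suc n))) \<longlonglongrightarrow> (x, ?v - 0)"
    by (intro tendsto_intros LIMSEQ_Suc[OF lim_1_over_n])
  moreover have "(x, ?v - 1 / real (Suc n)) \<in> interior (hypo S V)" for n by (intro below) simp
  ultimately show ?thesis unfolding closure_sequential by (intro exI[of _ "\<lambda>n. (x, ?v - 1 / real (Suc n))"]) auto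
qed

text \<open>The exterior spheres and pointedness at the graph point over \<open>x\<close> give one
  radius for all nearby base points; these local radii are then glued into a continuous
  function.\<close>

theorem phi_convex_hypo_value_function:
  assumes S: "S \<noteq> {}" and sc: "locally_semiconcave g"
    and cont: "continuous_on (reachable_set f U S) V"
    and pointed: "\<And>x. x \<in> reachable_set f U S - S \<Longrightarrow>
      pointed_cone (proximal_normals (hypo S V) (x, real_of_ereal (V x)))"
  shows "phi_convex_hypo (reachable_set f U S - S) S V"
proof -
  let ?D = "reachable_set f U S - S" and ?H = "closure (hypo S V)"
  let ?v = "\<lambda>x. real_of_ereal (V x)"
  define P where "P x \<rho> \<longleftrightarrow> (\<forall>v\<in>proximal_normals (hypo S V) (x, ?v x). norm v = 1 \<longrightarrow>
      realized_by_ball (hypo S V) (x, ?v x) v \<rho>)" for x \<rho>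
  have "\<exists>\<phi>. continuous_on ?D \<phi> \<and> (\<forall>x\<in>?D. \<phi> x > (0::real)) \<and> (\<forall>x\<in>?D. P x (\<phi> x))"
  proof (rule continuous_radius_from_local)
    show "P x \<rho>'" if "P x \<rho>" "0 < \<rho>'" "\<rho>' \<le> \<rho>" for x \<rho> \<rho>'
    proof -
      have "norm v / (2 * \<rho>) * t\<^sup>2 \<le> norm v / (2 * \<rho>') * t\<^sup>2" for v :: "'a \<times> real" and t
        using that by (intro mult_right_mono divide_left_mono) auto
      then show ?thesis using that(1) unfolding P_def realized_by_ball_def by (meson order_trans)
    qed
    show "P x \<rho>" if \<rho>: "0 < \<rho>" and all: "\<And>\<rho>'. 0 < \<rho>' \<Longrightarrow> \<rho>' < \<rho> \<Longrightarrow> P x \<rho>'" for x \<rho>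
      unfolding P_def realized_by_ball_def
    proof (intro ballI impI)
      fix v y assume v: "v \<in> proximal_normals (hypo S V) (x, ?v x)" "norm v = 1" and y: "y \<in> hypo S V"
      let ?h = "y - (x, ?v x)"
      have "t * (2 * \<rho> * (v \<bullet> ?h)) \<le> (norm ?h)\<^sup>2" if t: "0 < t" "t < 1" for t
      proof -
        have "P x (t * \<rho>)" using t \<rho> by (intro all) auto
        then have "v \<bullet> ?h \<le> norm v / (2 * (t * \<rho>)) * (norm ?h)\<^sup>2"
          using v y unfolding P_def realized_by_ball_def by blast
        then show ?thesis using t \<rho> v(2) by (simp add: field_simps)
      qed
      then have "2 * \<rho> * (v \<bullet> ?h) \<le> (norm ?h)\<^sup>2" by (rule field_le_mult_one_interval)
      then show "v \<bullet> ?h \<le> norm v / (2 * \<rho>) * (norm ?h)\<^sup>2" using \<rho> v(2) by (simp add: field_simps)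
    qed
    show "\<exists>d>0. \<exists>\<rho>>0. \<forall>y\<in>?D. dist y x < d \<longrightarrow> P y \<rho>" if x: "x \<in> ?D" for x
    proof -
      obtain \<sigma> \<delta> where \<sigma>: "\<sigma> \<ge> 0" "\<delta> > 0"
        "\<And>p. p \<in> frontier ?H \<Longrightarrow> dist p (x, ?v x) < \<delta> \<Longrightarrow> sphere_normals ?H \<sigma> p \<noteq> {}"
        using hypo_exterior_sphere[OF _ S sc, of x "?v x"] x by blast
      have "pointed_cone (proximal_normals ?H (x, ?v x))"
        using pointed[OF x] by (simp add: proximal_normals_closure)
      then obtain \<rho> d where \<rho>: "\<rho> > 0" "d > 0"
        "\<And>p v. p \<in> closure (interior ?H) \<Longrightarrow> dist p (x, ?v x) < d \<Longrightarrow> v \<in> proximal_normals ?H p \<Longrightarrow>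
           norm v = 1 \<Longrightarrow> realized_by_ball ?H p v \<rho>"
        using exterior_sphere_pointed_imp_realized[OF closed_closure \<sigma>] by blast
      \<comment> \<open>The radius is valid near the graph point in the product space; continuity of
        \<open>V\<close> turns this into a neighbourhood of \<open>x\<close>.\<close>
      have "(V \<longlongrightarrow> V x) (at x within reachable_set f U S)"
        using cont x by (simp add: continuous_on)
      then have "(V \<longlongrightarrow> ereal (?v x)) (at x within reachable_set f U S)"
        by (simp only: value_function_real[OF x])
      then have "(V \<longlongrightarrow> ereal (?v x)) (at x within reachable_set f U S)"
        by (simp only: value_function_real[OF x])
      then have "(?v \<longlongrightarrow> ?v x) (at x within reachable_set f U S)"
        by (rule lim_real_of_ereal)
      then have "((\<lambda>y. (y, ?v y)) \<longlongrightarrow> (x, ?v x)) (at x within reachable_set f U S)"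
        by (rule tendsto_Pair[OF tendsto_ident_at])
      then have "eventually (\<lambda>y. dist (y, ?v y) (x, ?v x) < d) (at x within reachable_set f U S)"
        using \<rho>(2) by (rule tendstoD)
      then obtain d' where d': "d' > 0"
        "\<And>y. y \<in> reachable_set f U S \<Longrightarrow> dist y x < d' \<Longrightarrow> dist (y, ?v y) (x, ?v x) < d"
        unfolding eventually_at using \<rho>(2) by (metis dist_self)
      have "P y \<rho>" if y: "y \<in> ?D" "dist y x < d'" for y
        unfolding P_def
      proof (intro ballI impI)
        fix v assume v: "v \<in> proximal_normals (hypo S V) (y, ?v y)" "norm v = 1"
        have "(y, ?v y) \<in> closure (interior ?H)"
          using graph_in_closure_interior_hypo[OF y(1) cont]
            closure_mono[OF interior_mono[OF closure_subset[of "hypo S V"]]] by blast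
        then have "realized_by_ball ?H (y, ?v y) v \<rho>"
          using \<rho>(3) d'(2)[of y] y v by (simp add: proximal_normals_closure)
        then show "realized_by_ball (hypo S V) (y, ?v y) v \<rho>"
          using closure_subset[of "hypo S V"] unfolding realized_by_ball_def by blast
      qed
      then show ?thesis using d'(1) \<rho>(1) by blast
    qed
  qed
  then show ?thesis unfolding phi_convex_hypo_def P_def by blast
qed

end

theorem corollary3p3:
  fixes U :: "(real^'m) set" and S :: "(real^'d) set"
    and f :: "real^'d \<Rightarrow> real^'m \<Rightarrow> real^'d"
    and r :: "real^'d \<Rightarrow> real^'m \<Rightarrow> real"
    and g :: "real^'d \<Rightarrow> real"
    and Df :: "real^'d \<Rightarrow> real^'m \<Rightarrow> (real^'d) \<Rightarrow>\<^sub>L (real^'d)"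
    and Dr :: "real^'d \<Rightarrow> real^'m \<Rightarrow> (real^'d) \<Rightarrow>\<^sub>L real"
    and N L r0 \<rho>0 :: real
    and V :: "real^'d \<Rightarrow> ereal" and R :: "(real^'d) set"
  defines "V \<equiv> value_function f r g U S"
    and "R \<equiv> reachable_set f U S"
  assumes control_set: "compact U" "U \<noteq> {}"
    and target: "closed S" "S \<noteq> {}"
    and constants: "N > 0" "L > 0" "r0 > 0" "\<rho>0 > 0"
    and convexity: "\<And>x. convex {(v, l). \<exists>\<omega>\<in>U. v = f x \<omega> \<and> l \<ge> r x \<omega>}"
    and f_continuous: "continuous_on (UNIV \<times> U) (\<lambda>(x, \<omega>). f x \<omega>)"
    and f_bounded: "\<And>x \<omega>. \<omega> \<in> U \<Longrightarrow> norm (f x \<omega>) < N"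
    and f_derivative: "\<And>x \<omega>. \<omega> \<in> U \<Longrightarrow> ((\<lambda>z. f z \<omega>) has_derivative blinfun_apply (Df x \<omega>)) (at x)"
    and Df_continuous: "continuous_on (UNIV \<times> U) (\<lambda>(x, \<omega>). Df x \<omega>)"
    and f_lipschitz: "\<And>x y \<omega>. \<omega> \<in> U \<Longrightarrow> norm (f y \<omega> - f x \<omega>) \<le> L * norm (y - x)"
    and Df_lipschitz: "\<And>x y \<omega>. \<omega> \<in> U \<Longrightarrow> norm (Df y \<omega> - Df x \<omega>) \<le> L * norm (y - x)"
    and r_continuous: "continuous_on (UNIV \<times> U) (\<lambda>(x, \<omega>). r x \<omega>)"
    and r_derivative: "\<And>x \<omega>. \<omega> \<in> U \<Longrightarrow> ((\<lambda>z. r z \<omega>) has_derivative blinfun_apply (Dr x \<omega>)) (at x)"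
    and Dr_continuous: "continuous_on (UNIV \<times> U) (\<lambda>(x, \<omega>). Dr x \<omega>)"
    and r_lipschitz: "\<And>x y \<omega>. \<omega> \<in> U \<Longrightarrow>
        \<bar>r y \<omega> - r x \<omega>\<bar> + norm (Dr y \<omega> - Dr x \<omega>) \<le> L * norm (y - x)"
    and r_lower_bound: "\<And>x \<omega>. \<omega> \<in> U \<Longrightarrow> r x \<omega> \<ge> r0"
    and terminal_cost: "\<exists>W G. open W \<and> frontier S \<subseteq> W \<and> 0 \<le> G \<and> G < r0 / N \<and>
        (\<forall>x\<in>W. \<forall>y\<in>W. \<bar>g y - g x\<bar> \<le> G * norm (y - x))"
    and inner_ball: "\<And>x. x \<in> frontier S \<Longrightarrow>
        \<exists>\<xi> \<in> proximal_normals (closure (- S)) x. norm \<xi> = 1 \<and>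
          (\<forall>y \<in> closure (- S). \<xi> \<bullet> (y - x) \<le> 1 / (2 * \<rho>0) * (norm (y - x))\<^sup>2)"
    and g_semiconcave: "locally_semiconcave g"
    and V_continuous: "continuous_on R V"
    and pointed: "\<And>x. x \<in> R - S \<Longrightarrow>
        pointed_cone (proximal_normals (hypo S V) (x, real_of_ereal (V x)))"
  shows "phi_convex_hypo (R - S) S V"
proof -
  obtain W G where WG: "open W" "frontier S \<subseteq> W" "0 \<le> G" "G < r0 / N"
    "\<And>x y. x \<in> W \<Longrightarrow> y \<in> W \<Longrightarrow> \<bar>g y - g x\<bar> \<le> G * norm (y - x)"
    using terminal_cost by metis
  interpret exit_problem f r g Df Dr U S W N L r0 \<rho>0 G
  proof
    show "\<exists>\<xi>. norm \<xi> = 1 \<and> (\<forall>y\<in>closure (- S). \<xi> \<bullet> (y - x) \<le> 1 / (2 * \<rho>0) * (norm (y - x))\<^sup>2)"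
      if "x \<in> frontier S" for x
      using inner_ball[OF that] by blast
  qed (fact control_set target constants f_continuous f_bounded f_derivative Df_continuous f_lipschitz
      Df_lipschitz r_continuous r_derivative Dr_continuous r_lipschitz r_lower_bound WG)+
  show ?thesis
    unfolding V_def R_def
    by (rule phi_convex_hypo_value_function)
      (use target(2) g_semiconcave V_continuous pointed in \<open>simp_all add: V_def R_def\<close>)
qed

end
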